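(* In the case of either topology, $S^1\times\mathbb{R}^3$ or $S^2\times\mathbb{R}^2$, the map $F:(0,\infty)\times(0,\infty)\to(0,\infty)\times(0,\infty)$ sending the initial conditions $(a_0,-f_0)$ (respectively $(b_0,-f_0)$) to the asymptotic slopes $(a'_\infty,b'_\infty)$ is continuous.
   Context: Consider smooth functions $a,b,f$ of $r\ge0$, with $a,b>0$ for $r>0$, satisfying for $r>0$ the soliton equations $$f''=\frac{a''}{a}+2\frac{b''}{b}-1,\qquad a''=-2\frac{a'b'}{b}+a'f'+a,\qquad b''=\frac{1-(b')^2}{b}-\frac{a'b'}{a}+b'f'+b.$$ $S^1\times\mathbb{R}^3$ boundary conditions, $a_0>0$, $f_0<0$: $a(0)=a_0$, $a'(0)=0$, $b(0)=0$, $b'(0)=1$, $f(0)=f'(0)=0$, $f''(0)=f_0$. $S^2\times\mathbb{R}^2$ boundary conditions, $b_0>0$, $f_0<0$: $a(0)=0$, $a'(0)=1$, $b(0)=b_0$, $b'(0)=0$, $f(0)=f'(0)=0$, $f''(0)=f_0$. In each case there is a unique solution, defined on $[0,\infty)$, and the limits $a'_\infty=\lim_{r\to\infty}a'(r)$, $b'_\infty=\lim_{r\to\infty}b'(r)$ exist and are finite and positive. The map $F$ is defined by $F(a_0,-f_0)=(a'_\infty,b'_\infty)$ in the $S^1\times\mathbb{R}^3$ case, and by $F(b_0,-f_0)=(a'_\infty,b'_\infty)$ in the $S^2\times\mathbb{R}^2$ case. *)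

theory Defs
  imports "HOL-Analysis.Analysis"
begin

(* Functions of r >= 0 are modelled as functions on the whole line of which only the values on
   {0..} are ever used: the derivative below is relative to {0..}, hence one-sided at r = 0 and
   equal to the ordinary derivative for r > 0. *)
definition D :: "(real \<Rightarrow> real) \<Rightarrow> real \<Rightarrow> real" where
  "D g = (\<lambda>r. vector_derivative g (at r within {0..}))"

definition smooth_halfline :: "(real \<Rightarrow> real) \<Rightarrow> bool" where
  "smooth_halfline g \<longleftrightarrow> (\<forall>k. (D ^^ k) g differentiable_on {0..})"

definition soliton :: "(real \<Rightarrow> real) \<Rightarrow> (real \<Rightarrow> real) \<Rightarrow> (real \<Rightarrow> real) \<Rightarrow> bool" where
  "soliton a b f \<longleftrightarrow>
     smooth_halfline a \<and> smooth_halfline b \<and> smooth_halfline f \<and>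
     (\<forall>r>0. a r > 0 \<and> b r > 0 \<and>
        D (D f) r = D (D a) r / a r + 2 * (D (D b) r / b r) - 1 \<and>
        D (D a) r = - 2 * (D a r * D b r / b r) + D a r * D f r + a r \<and>
        D (D b) r = (1 - (D b r)\<^sup>2) / b r - D a r * D b r / a r + D b r * D f r + b r)"

definition bc_S1R3 ::
    "real \<Rightarrow> real \<Rightarrow> (real \<Rightarrow> real) \<Rightarrow> (real \<Rightarrow> real) \<Rightarrow> (real \<Rightarrow> real) \<Rightarrow> bool" where
  "bc_S1R3 a0 f0 a b f \<longleftrightarrow>
     a 0 = a0 \<and> D a 0 = 0 \<and> b 0 = 0 \<and> D b 0 = 1 \<and> f 0 = 0 \<and> D f 0 = 0 \<and> D (D f) 0 = f0"

definition bc_S2R2 ::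
    "real \<Rightarrow> real \<Rightarrow> (real \<Rightarrow> real) \<Rightarrow> (real \<Rightarrow> real) \<Rightarrow> (real \<Rightarrow> real) \<Rightarrow> bool" where
  "bc_S2R2 b0 f0 a b f \<longleftrightarrow>
     a 0 = 0 \<and> D a 0 = 1 \<and> b 0 = b0 \<and> D b 0 = 0 \<and> f 0 = 0 \<and> D f 0 = 0 \<and> D (D f) 0 = f0"

(* The parameter pair is (a_0, -f_0), resp. (b_0, -f_0), so f_0 is minus the second component.
   The definite description ranges over the pair of slopes rather than over the solution, since
   the values of a, b, f at negative arguments are arbitrary. *)
definition slopes ::
    "(real \<Rightarrow> real \<Rightarrow> (real \<Rightarrow> real) \<Rightarrow> (real \<Rightarrow> real) \<Rightarrow> (real \<Rightarrow> real) \<Rightarrow> bool)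
      \<Rightarrow> real \<times> real \<Rightarrow> real \<times> real" where
  "slopes bc p = (THE s. \<exists>a b f. soliton a b f \<and> bc (fst p) (- snd p) a b f \<and>
      (D a \<longlongrightarrow> fst s) at_top \<and> (D b \<longlongrightarrow> snd s) at_top)"

definition F_S1R3 :: "real \<times> real \<Rightarrow> real \<times> real" where
  "F_S1R3 = slopes bc_S1R3"

definition F_S2R2 :: "real \<times> real \<Rightarrow> real \<times> real" where
  "F_S2R2 = slopes bc_S2R2"

end

(* Put Y = b^2, g = -f and xi = a'/a + 2 b'/b - f'. The quantity f'' + xi f' - 2 f is constant along
   solutions, say -k, and with this first integral in place of the first equation the system takes the
   divergence form
     (Y e^g a')' = Y e^g a,   (a e^g Y')' = a e^g (2 + 2 Y),   (a Y e^g g')' = a Y e^g (k + 2 g).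
   Integrating it gives a fixed point problem for weighted averages over [0, r], which are regular at
   r = 0. Monotonicity of a, Y, g keeps all quotients of weights below 1, so Picard iteration preserves
   explicit growth bounds on the whole half-line and converges locally uniformly in r and in the
   parameters. This gives existence, uniqueness, smoothness and joint continuity of the solution.

   Conversely the first integral yields xi' = 1 - A^2 - 2 B^2, where A = a'/a and B = b'/b, since the
   defect G of this identity satisfies G' = -2 xi G and vanishes in the limit r = 0. Then
   (a Y e^g g'')' > 0, so g'' > 0, which forces g' and hence xi to grow linearly; therefore A and B are
   O(1/r). The logarithmic derivatives z of a' and b' solve z' = -c z + O(1/r^2) with c >= 1, so they are
   O(1/r^2), and ln a' and ln b' converge at the rate 1/r. All constants depend only on bounds at r = 1,
   so the convergence is uniform for nearby parameters and the limits are continuous. *)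

theory Submission
  imports Defs
begin

text \<open>Three obstacles shape the development. At r = 0 one warping function vanishes, so
  \<open>a'/a\<close> or \<open>b'/b\<close> is singular there. In the rescaled averages
  \<open>Av\<close> the powers of r cancel, so one integral equation serves the whole half-line and
  no separate local theory at 0 is needed. The rescaled collapsing function, however, is an average
  without a factor r in front: it reacts to the other unknowns with a constant that is not small,
  and only a norm that weights it differently yields a contraction. Finally, pointwise convergence
  of the slopes says nothing about continuity of the limit, so each asymptotic estimate runs with
  constants computed from a single M that controls six numbers at r = 1. The sign g = -f makes the
  potential increase from 0. The constant k is fixed by regularity at 0: the average in the equation
  for g' gives \<open>(n + 1) g''(0) = k\<close>, so k is 3 or 2 times -f0 in the two
  topologies.\<close>

section \<open>Rescaled averages and their dependence on r and on parameters\<close>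

text \<open>For r > 0 this is \<open>r^-(n+1)\<close> times the integral of \<open>s^n * h s\<close>
  over [0, r]. The rescaled form also makes sense at r = 0, and its domain of integration does not
  depend on r.\<close>

definition Av :: "nat \<Rightarrow> (real \<Rightarrow> real) \<Rightarrow> real \<Rightarrow> real" where
  "Av n h r = integral {0..1} (\<lambda>t. t ^ n * h (t * r))"

text \<open>Joint continuity in the parameter and the radius, rather than continuity in each, is the
  property that survives both integration in r and locally uniform limits.\<close>

definition jcont :: "'p::topological_space set \<Rightarrow> ('p \<Rightarrow> real \<Rightarrow> real) \<Rightarrow> bool" where
  "jcont P h \<longleftrightarrow> continuous_on (P \<times> {0..}) (\<lambda>z. h (fst z) (snd z))"

lemma jcont_slice: "jcont P h \<Longrightarrow> p \<in> P \<Longrightarrow> continuous_on {0..} (h p)"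
  unfolding jcont_def
  using continuous_on_compose2[of "P \<times> {0..}" "\<lambda>z. h (fst z) (snd z)" "{0..}" "\<lambda>r. (p, r)"]
    continuous_on_Pair[OF continuous_on_const[of "{0::real..}" p] continuous_on_id] by force

lemma jcont_at: "jcont P h \<Longrightarrow> r \<ge> 0 \<Longrightarrow> continuous_on P (\<lambda>p. h p r)"
  unfolding jcont_def
  using continuous_on_compose2[of "P \<times> {0..}" "\<lambda>z. h (fst z) (snd z)" P "\<lambda>p. (p, r)"]
    continuous_on_Pair[OF continuous_on_id[of P] continuous_on_const[of P r]] by force

text \<open>An integral over the fixed compact interval [0, 1] of a jointly continuous integrand
  depends continuously on the remaining variables.\<close>

lemma jcont_Av:
  assumes "jcont P h"
  shows "jcont P (\<lambda>p. Av n (h p))"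
proof -
  have "continuous_on ((P \<times> {0..}) \<times> cbox 0 (1::real))
      (\<lambda>(z, t). t ^ n * h (fst z) (t * snd z))"
    unfolding case_prod_beta
    by (intro continuous_intros
        continuous_on_compose2[OF assms[unfolded jcont_def],
          where f = "\<lambda>w. (fst (fst w), snd w * snd (fst w))", simplified])
      (auto intro!: continuous_intros)
  from integral_continuous_on_param[OF this] show ?thesis
    by (simp add: jcont_def Av_def case_prod_beta)
qed

lemma continuous_on_Av:
  assumes "continuous_on {0..} h"
  shows "continuous_on {0..} (Av n h)"
proof -
  \<comment> \<open>A one-point parameter set reduces the claim to \<open>jcont_Av\<close>.\<close>
  have "jcont {0::real} (\<lambda>_. h)"
    unfolding jcont_def by (intro continuous_on_compose2[OF assms]) (auto intro!: continuous_intros)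
  from jcont_slice[OF jcont_Av[OF this]] show ?thesis by simp
qed

lemma Av_integrable:
  fixes h :: "real \<Rightarrow> real"
  assumes "continuous_on {0..} h" "r \<ge> 0"
  shows "(\<lambda>t. t ^ n * h (t * r)) integrable_on {0..1}"
proof -
  have "continuous_on {0..1} (\<lambda>t. t ^ n * h (t * r))"
    by (intro continuous_on_mult continuous_on_compose2[OF assms(1), of "{0..1}" "\<lambda>t. t * r"])
      (use assms(2) in \<open>auto intro!: continuous_intros\<close>)
  then show ?thesis by (rule integrable_continuous_real)
qed

lemma Av_mono:
  assumes "continuous_on {0..} h" "continuous_on {0..} k" "r \<ge> 0"
    "\<And>s. 0 \<le> s \<Longrightarrow> s \<le> r \<Longrightarrow> h s \<le> k s"
  shows "Av n h r \<le> Av n k r"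
  unfolding Av_def using assms(3)
  by (intro integral_le Av_integrable mult_left_mono assms) (auto intro!: mult_left_le_one_le)

lemma power_integral_01: "integral {0..1} (\<lambda>t::real. t ^ n) = 1 / (n + 1)"
proof -
  have "((\<lambda>t::real. t ^ n) has_integral 1 ^ (n + 1) / (n + 1) - 0 ^ (n + 1) / (n + 1)) {0..1}"
  proof (rule fundamental_theorem_of_calculus, simp)
    fix x :: real
    have "((\<lambda>t. t ^ (n + 1) / (n + 1)) has_real_derivative real (n + 1) * x ^ n / (n + 1))
      (at x within {0..1})"
      by (rule DERIV_cdivide) (use DERIV_pow[of "n + 1" x] in simp)
    then show "((\<lambda>t. t ^ (n + 1) / (n + 1)) has_vector_derivative x ^ n) (at x within {0..1})"
      by (simp add: has_real_derivative_iff_has_vector_derivative)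
  qed
  then show ?thesis by (simp add: integral_unique)
qed

lemma Av_const: "Av n (\<lambda>_. c) r = c / (n + 1)"
  unfolding Av_def by (simp add: power_integral_01)

lemma Av_at_0: "Av n h 0 = h 0 / (n + 1)"
  unfolding Av_def by (simp add: power_integral_01)

lemma Av_cmult: "Av n (\<lambda>s. c * h s) r = c * Av n h r"
  unfolding Av_def by (simp add: mult.left_commute)

lemma Av_diff:
  assumes "continuous_on {0..} h" "continuous_on {0..} k" "r \<ge> 0"
  shows "Av n (\<lambda>s. h s - k s) r = Av n h r - Av n k r"
  unfolding Av_def using assms
  by (subst integral_diff[symmetric]) (auto intro!: Av_integrable simp: algebra_simps)

lemma Av_nonneg:
  assumes "continuous_on {0..} h" "r \<ge> 0" "\<And>s. 0 \<le> s \<Longrightarrow> s \<le> r \<Longrightarrow> 0 \<le> h s"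
  shows "0 \<le> Av n h r"
  using Av_mono[OF continuous_on_const assms(1,2,3), of n] by (simp add: Av_const)

text \<open>The substitution s = t r, with the power of r moved to the left so that r = 0 is
  included.\<close>

lemma Av_FTC:
  assumes h: "continuous_on {0..} h" and r: "r \<ge> 0"
  shows "r ^ (n + 1) * Av n h r = integral {0..r} (\<lambda>s. s ^ n * h s)"
proof -
  have "((\<lambda>t. r *\<^sub>R ((t * r) ^ n * h (t * r))) has_integral
      integral {0 * r..1 * r} (\<lambda>s. s ^ n * h s)) {0..1}"
    by (rule has_integral_substitution[where c = 0 and d = r])
      (use r in \<open>auto intro!: continuous_intros derivative_eq_intros mult_left_le_one_le
        continuous_on_subset[OF h]\<close>)
  moreover have "(\<lambda>t. r *\<^sub>R ((t * r) ^ n * h (t * r))) = (\<lambda>t. r ^ (n + 1) * (t ^ n * h (t * r)))"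
    by (simp add: power_mult_distrib algebra_simps)
  ultimately have "((\<lambda>t. r ^ (n + 1) * (t ^ n * h (t * r))) has_integral
      integral {0..r} (\<lambda>s. s ^ n * h s)) {0..1}" by simp
  from integral_unique[OF this] show ?thesis by (simp add: Av_def del: power_Suc)
qed

lemma Av_antideriv:
  assumes h: "continuous_on {0..} h" and r: "r \<ge> 0"
  shows "((\<lambda>r. r ^ (n + 1) * Av n h r) has_real_derivative r ^ n * h r) (at r within {0..})"
proof -
  \<comment> \<open>The fundamental theorem is applied on the compact interval [0, r + 1], which has
    the same germ at r as the half-line.\<close>
  have *: "((\<lambda>r. integral {0..r} (\<lambda>s. s ^ n * h s)) has_real_derivative r ^ n * h r)
      (at r within {0..r + 1})"
    using r by (intro integral_has_real_derivative continuous_intros continuous_on_subset[OF h]) auto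
  have "((\<lambda>r. r ^ (n + 1) * Av n h r) has_real_derivative r ^ n * h r) (at r within {0..r + 1})"
    by (rule has_field_derivative_transform_within[OF *, of 1])
      (use r in \<open>auto simp: Av_FTC[OF h, symmetric]\<close>)
  moreover have "at r within {0..r + 1} = at r within {0..}"
    using r by (intro at_within_nhd[of _ "{..<r+1}"]) auto
  ultimately show ?thesis by simp
qed

lemma Av0_antideriv:
  assumes "continuous_on {0..} h" and "r \<ge> 0"
  shows "((\<lambda>r. r * Av 0 h r) has_real_derivative h r) (at r within {0..})"
  using Av_antideriv[OF assms, of 0] by simp

subsection \<open>Functions with continuous derivatives on the half-line\<close>

text \<open>C^k relative to {0..}, one-sided at 0. The derivative is existentially quantified, so
  closure rules can supply any convenient form of it.\<close>

primrec ck :: "nat \<Rightarrow> (real \<Rightarrow> real) \<Rightarrow> bool" where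
  "ck 0 g \<longleftrightarrow> continuous_on {0..} g"
| "ck (Suc k) g \<longleftrightarrow>
    (\<exists>g'. (\<forall>r\<ge>0. (g has_real_derivative g' r) (at r within {0..})) \<and> ck k g')"

lemma ck_SucI:
  "(\<And>r. r \<ge> 0 \<Longrightarrow> (g has_real_derivative g' r) (at r within {0..})) \<Longrightarrow> ck k g' \<Longrightarrow> ck (Suc k) g"
  unfolding ck.simps by blast

lemma ck_cong: "ck k g \<Longrightarrow> (\<And>r. r \<ge> 0 \<Longrightarrow> g r = h r) \<Longrightarrow> ck k h"
proof (cases k)
  case 0
  then show "ck k g \<Longrightarrow> (\<And>r. r \<ge> 0 \<Longrightarrow> g r = h r) \<Longrightarrow> ck k h"
    using continuous_on_cong[of "{0..}" "{0..}" g h] by auto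
next
  case (Suc j)
  assume k: "ck k g" and e: "\<And>r. r \<ge> 0 \<Longrightarrow> g r = h r"
  from k Suc obtain g' where g': "\<And>r. r \<ge> 0 \<Longrightarrow> (g has_real_derivative g' r) (at r within {0..})"
    "ck j g'" by auto
  show "ck k h" unfolding Suc
    by (rule ck_SucI[OF _ g'(2)], rule has_field_derivative_transform_within[OF g'(1), of _ 1])
      (auto simp: e)
qed

lemma ck_Suc_D: "ck (Suc k) g \<Longrightarrow> ck k g"
proof (induction k arbitrary: g)
  case 0
  then obtain g' where "\<And>r. r \<ge> 0 \<Longrightarrow> (g has_real_derivative g' r) (at r within {0..})" by auto
  then show ?case by (auto intro!: DERIV_continuous_on[of _ g g'])
next
  case (Suc k)
  then obtain g' where g': "\<And>r. r \<ge> 0 \<Longrightarrow> (g has_real_derivative g' r) (at r within {0..})"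
    "ck (Suc k) g'" by (subst (asm) ck.simps) blast
  show ?case by (rule ck_SucI[OF g'(1)]) (use g'(2) Suc.IH in blast)+
qed

lemma ck_imp_cont: "ck k g \<Longrightarrow> continuous_on {0..} g"
  by (induction k) (use ck_Suc_D in \<open>auto simp del: ck.simps(2)\<close>)

lemma ck_const: "ck k (\<lambda>_. c)"
  by (induction k arbitrary: c) (auto intro!: exI[of _ "\<lambda>_. 0"] continuous_intros)

lemma ck_ident: "ck k (\<lambda>r. r)"
  by (cases k) (auto intro!: exI[of _ "\<lambda>_. 1"] ck_const continuous_intros)

lemma ck_add: "ck k f \<Longrightarrow> ck k g \<Longrightarrow> ck k (\<lambda>r. f r + g r)"
proof (induction k arbitrary: f g)
  case 0
  then show ?case by (auto intro!: continuous_intros)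
next
  case (Suc k)
  then obtain f' g' where f': "\<And>r. r \<ge> 0 \<Longrightarrow> (f has_real_derivative f' r) (at r within {0..})" "ck k f'"
    and g': "\<And>r. r \<ge> 0 \<Longrightarrow> (g has_real_derivative g' r) (at r within {0..})" "ck k g'" by auto
  show ?case
    by (rule ck_SucI[OF _ Suc.IH[OF f'(2) g'(2)]]) (auto intro!: derivative_eq_intros f' g')
qed

lemma ck_mult: "ck k f \<Longrightarrow> ck k g \<Longrightarrow> ck k (\<lambda>r. f r * g r)"
proof (induction k arbitrary: f g)
  case 0
  then show ?case by (auto intro!: continuous_intros)
next
  case (Suc k)
  then obtain f' g' where f': "\<And>r. r \<ge> 0 \<Longrightarrow> (f has_real_derivative f' r) (at r within {0..})" "ck k f'"
    and g': "\<And>r. r \<ge> 0 \<Longrightarrow> (g has_real_derivative g' r) (at r within {0..})" "ck k g'" by auto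
  note fg = ck_Suc_D[OF Suc.prems(1)] ck_Suc_D[OF Suc.prems(2)]
  show ?case
    by (rule ck_SucI[OF _ ck_add[OF Suc.IH[OF f'(2) fg(2)] Suc.IH[OF g'(2) fg(1)]]])
      (auto intro!: derivative_eq_intros f' g')
qed

lemma ck_power: "ck k f \<Longrightarrow> ck k (\<lambda>r. f r ^ n)"
  by (induction n) (auto intro!: ck_mult ck_const)

lemma ck_uminus: "ck k f \<Longrightarrow> ck k (\<lambda>r. - f r)"
  using ck_mult[OF ck_const[of k "-1"], of f] by simp

lemma ck_exp: "ck k f \<Longrightarrow> ck k (\<lambda>r. exp (f r))"
proof (induction k arbitrary: f)
  case 0
  then show ?case by (auto intro!: continuous_intros)
next
  case (Suc k)
  then obtain f' where f': "\<And>r. r \<ge> 0 \<Longrightarrow> (f has_real_derivative f' r) (at r within {0..})" "ck k f'"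
    by auto
  show ?case
    by (rule ck_SucI[OF _ ck_mult[OF f'(2) Suc.IH[OF ck_Suc_D[OF Suc.prems]]]])
      (auto intro!: derivative_eq_intros f')
qed

lemma ck_inverse:
  "ck k f \<Longrightarrow> (\<And>r. r \<ge> 0 \<Longrightarrow> f r > 0) \<Longrightarrow> ck k (\<lambda>r. inverse (f r))"
proof (induction k arbitrary: f)
  case 0
  then show ?case using continuous_on_inverse[of "{0..}" f] by force
next
  case (Suc k)
  then obtain f' where f': "\<And>r. r \<ge> 0 \<Longrightarrow> (f has_real_derivative f' r) (at r within {0..})" "ck k f'"
    by auto
  have i: "ck k (\<lambda>r. inverse (f r))"
    by (rule Suc.IH[OF ck_Suc_D[OF Suc.prems(1)] Suc.prems(2)])
  have nz: "\<And>r. r \<ge> 0 \<Longrightarrow> f r \<noteq> 0" using Suc.prems(2) by force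
  show ?case
    by (rule ck_SucI[OF _ ck_uminus[OF ck_mult[OF f'(2) ck_mult[OF i i]]]])
      (use DERIV_inverse_fun[OF f'(1)] nz in \<open>auto simp: ac_simps\<close>)
qed

lemma ck_divide:
  "ck k g \<Longrightarrow> ck k f \<Longrightarrow> (\<And>r. r \<ge> 0 \<Longrightarrow> f r > 0) \<Longrightarrow> ck k (\<lambda>r. g r / f r)"
  unfolding divide_inverse by (intro ck_mult ck_inverse)

lemma ck_sqrt:
  "ck k f \<Longrightarrow> (\<And>r. r \<ge> 0 \<Longrightarrow> f r > 0) \<Longrightarrow> ck k (\<lambda>r. sqrt (f r))"
proof (induction k arbitrary: f)
  case 0
  then show ?case by (simp add: continuous_on_real_sqrt)
next
  case (Suc k)
  then obtain f' where f': "\<And>r. r \<ge> 0 \<Longrightarrow> (f has_real_derivative f' r) (at r within {0..})" "ck k f'"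
    by auto
  have i: "ck k (\<lambda>r. 2 * sqrt (f r))"     by (rule ck_mult[OF ck_const Suc.IH[OF ck_Suc_D[OF Suc.prems(1)] Suc.prems(2)]])
  have d: "ck k (\<lambda>r. f' r / (2 * sqrt (f r)))"
    by (rule ck_divide[OF f'(2) i]) (use Suc.prems(2) in auto)
  show ?case
  proof (rule ck_SucI[OF _ d])
    fix r :: real assume r: "r \<ge> 0"
    show "((\<lambda>r. sqrt (f r)) has_real_derivative f' r / (2 * sqrt (f r))) (at r within {0..})"
      using DERIV_chain'[OF f'(1)[OF r] DERIV_real_sqrt[OF Suc.prems(2)[OF r]]]
      by (simp add: field_simps)
  qed
qed

text \<open>Differentiation under the integral sign brings down one factor t and yields
  \<open>Av (n + 1) h'\<close>, again an average; hence no regularity is lost at r = 0.\<close>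

lemma ck_Av: "ck k h \<Longrightarrow> ck k (Av n h)"
proof (induction k arbitrary: h n)
  case 0
  then show ?case by (auto intro!: continuous_on_Av)
next
  case (Suc k)
  then obtain h' where h': "\<And>r. r \<ge> 0 \<Longrightarrow> (h has_real_derivative h' r) (at r within {0..})" "ck k h'"
    by auto
  have c: "continuous_on {0..} h" "continuous_on {0..} h'"
    using ck_imp_cont[OF Suc.prems] ck_imp_cont[OF h'(2)] .
  show ?case
  proof (rule ck_SucI[OF _ Suc.IH[OF h'(2), of "n + 1"]])
    fix r :: real assume r: "r \<ge> 0"
    have "((\<lambda>x. integral (cbox 0 1) (\<lambda>t. t ^ n * h (t * x))) has_real_derivative
      integral (cbox 0 1) (\<lambda>t. t ^ (n + 1) * h' (t * r))) (at r within {0..})"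
    proof (rule leibniz_rule_field_derivative[where fx = "\<lambda>x t. t ^ (n + 1) * h' (t * x)"])
      fix x t :: real assume "x \<in> {0..}" "t \<in> cbox 0 1"
      then have xt: "x \<ge> 0" "t \<ge> 0" "t * x \<ge> 0" by auto
      have "((\<lambda>x. h (t * x)) has_real_derivative h' (t * x) * t) (at x within {0..})"
        by (rule DERIV_image_chain[of h _ "\<lambda>x. t * x", unfolded o_def])
          (use xt in \<open>auto intro!: derivative_eq_intros DERIV_subset[OF h'(1)[OF xt(3)]]\<close>)
      then show "((\<lambda>x. t ^ n * h (t * x)) has_real_derivative t ^ (n + 1) * h' (t * x)) (at x within {0..})"
        by (auto intro!: derivative_eq_intros)
    next
      show "\<And>x. x \<in> {0..} \<Longrightarrow> (\<lambda>t. t ^ n * h (t * x)) integrable_on cbox 0 1"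
        using Av_integrable[OF c(1)] by simp
    next
      show "continuous_on ({0..} \<times> cbox 0 1) (\<lambda>(x, t). t ^ (n + 1) * h' (t * x))"
        unfolding case_prod_beta
        by (intro continuous_intros continuous_on_compose2[OF c(2)]) auto
    qed (use r in auto)
    then show "(Av n h has_real_derivative Av (n + 1) h' r) (at r within {0..})"
      by (simp add: Av_def[abs_def])
  qed
qed

section \<open>Smoothness in terms of the operator \<open>D\<close>\<close>

lemma Ici_islimpt: "(r::real) \<ge> 0 \<Longrightarrow> r islimpt {0..}"
  by (rule islimpt_subset[OF islimpt_greaterThanLessThan1[of r "r + 1"]]) auto

lemma has_deriv_D:
  assumes "(g has_real_derivative g') (at r within {0..})" "r \<ge> 0"
  shows "D g r = g'"
  unfolding D_def using assms
  by (intro vector_derivative_within)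
    (auto simp: has_real_derivative_iff_has_vector_derivative
        trivial_limit_within intro!: Ici_islimpt)

lemma ck_imp_smooth:
  assumes "\<And>k. ck k g"
  shows "smooth_halfline g"
proof -
  \<comment> \<open>The claim is strengthened to all orders j at once, because passing from
    \<open>k\<close> to \<open>Suc k\<close> costs one order.\<close>
  have "ck j ((D ^^ k) g)" for j k
  proof (induction k arbitrary: j)
    case (Suc k)
    from Suc[of "Suc j"] obtain h where h:
      "\<And>r. r \<ge> 0 \<Longrightarrow> ((D ^^ k) g has_real_derivative h r) (at r within {0..})" "ck j h"
      unfolding ck.simps by blast
    show ?case by (rule ck_cong[OF h(2)]) (simp add: has_deriv_D[OF h(1)])
  qed (simp add: assms)
  then have *: "ck (Suc 0) ((D ^^ k) g)" for k by blast
  show ?thesis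
    unfolding smooth_halfline_def differentiable_on_def real_differentiable_def
  proof (intro allI ballI)
    fix k and x :: real assume "x \<in> {0..}"
    with *[of k] show "\<exists>y. ((D ^^ k) g has_real_derivative y) (at x within {0..})"
      unfolding ck.simps by auto
  qed
qed

lemma smooth_deriv:
  assumes "smooth_halfline g" "r \<ge> 0"
  shows "((D ^^ k) g has_real_derivative (D ^^ Suc k) g r) (at r within {0..})"
proof -
  from assms have "(D ^^ k) g differentiable (at r within {0..})"
    by (auto simp: smooth_halfline_def differentiable_on_def)
  then obtain c where c: "((D ^^ k) g has_real_derivative c) (at r within {0..})"
    by (auto simp: real_differentiable_def)
  with has_deriv_D[OF c assms(2)] show ?thesis by simp
qed

subsection \<open>Volterra estimates in exponentially weighted norms\<close>

text \<open>Distance at most e in the exponentially weighted sup norm (Bielecki norm) on [0, T]. As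
  a predicate on e it needs no function space, and estimates compose by arithmetic on e.\<close>

definition cl :: "real \<Rightarrow> real \<Rightarrow> real \<Rightarrow> (real \<Rightarrow> real) \<Rightarrow> (real \<Rightarrow> real) \<Rightarrow> bool" where
  "cl e l T h k \<longleftrightarrow> (\<forall>s\<in>{0..T}. \<bar>h s - k s\<bar> \<le> e * exp (l * s))"

lemma abs_Av_le:
  assumes "continuous_on {0..} h" "continuous_on {0..} k" "r \<ge> 0"
    "\<And>s. 0 \<le> s \<Longrightarrow> s \<le> r \<Longrightarrow> \<bar>h s\<bar> \<le> k s"
  shows "\<bar>Av n h r\<bar> \<le> Av 0 k r"
proof -
  have "norm (integral {0..1} (\<lambda>t. t ^ n * h (t * r))) \<le> integral {0..1} (\<lambda>t. t ^ 0 * k (t * r))"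
  proof (rule integral_norm_bound_integral[OF Av_integrable Av_integrable])
    fix t :: real assume t: "t \<in> {0..1}"
    then have "\<bar>h (t * r)\<bar> \<le> k (t * r)" using assms(3) by (intro assms(4)) (auto intro: mult_left_le_one_le)
    moreover have "\<bar>t ^ n\<bar> \<le> 1" using t by (auto intro: power_le_one)
    ultimately have "\<bar>t ^ n\<bar> * \<bar>h (t * r)\<bar> \<le> 1 * k (t * r)"
      by (intro mult_mono) auto
    then show "norm (t ^ n * h (t * r)) \<le> t ^ 0 * k (t * r)" by (simp add: abs_mult)
  qed (use assms in auto)
  then show ?thesis by (simp add: Av_def)
qed

lemma Av0_exp:
  assumes "l > 0" "r \<ge> 0"
  shows "r * Av 0 (\<lambda>s. e * exp (l * s)) r = e * (exp (l * r) - 1) / l"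
proof -
  have "((\<lambda>s. e * exp (l * s)) has_integral e * exp (l * r) / l - e * exp (l * 0) / l) {0..r}"
    using assms by (intro fundamental_theorem_of_calculus)
      (auto intro!: derivative_eq_intros simp: has_real_derivative_iff_has_vector_derivative[symmetric])
  from integral_unique[OF this] have "integral {0..r} (\<lambda>s. e * exp (l * s)) = e * (exp (l * r) - 1) / l"
    by (simp add: diff_divide_distrib right_diff_distrib)
  then show ?thesis
    using Av_FTC[of "\<lambda>s. e * exp (l * s)" r 0] assms by (simp add: continuous_intros)
qed

text \<open>The source of every contraction: integrating \<open>exp (l * s)\<close> over [0, r]
  gains a factor 1 / l, and l may be chosen as large as desired.\<close>

lemma cl_gain:
  assumes h: "continuous_on {0..} h" "continuous_on {0..} k" and l: "l > 0" "e \<ge> 0" and c: "cl e l T h k"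
  shows "cl (e / l) l T (\<lambda>r. r * Av n h r) (\<lambda>r. r * Av n k r)"
  unfolding cl_def
proof
  fix r assume r: "r \<in> {0..T}"
  have "\<bar>Av n (\<lambda>s. h s - k s) r\<bar> \<le> Av 0 (\<lambda>s. e * exp (l * s)) r"
    using c r by (intro abs_Av_le continuous_intros h) (auto simp: cl_def)
  then have "r * \<bar>Av n (\<lambda>s. h s - k s) r\<bar> \<le> r * Av 0 (\<lambda>s. e * exp (l * s)) r"
    using r by (intro mult_left_mono) auto
  also have "\<dots> \<le> e * exp (l * r) / l"
    using r l by (subst Av0_exp) (auto intro!: divide_right_mono mult_left_mono)
  also have "Av n (\<lambda>s. h s - k s) r = Av n h r - Av n k r"
    using r by (intro Av_diff h) auto
  finally show "\<bar>r * Av n h r - r * Av n k r\<bar> \<le> e / l * exp (l * r)"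
    using r by (simp add: abs_mult right_diff_distrib[symmetric])
qed

text \<open>Without the factor r in front an average merely reproduces the error; a large l does not
  help. This is the situation of the \<open>Sing\<close> component.\<close>

lemma cl_Av:
  assumes h: "continuous_on {0..} h" "continuous_on {0..} k" and l: "l \<ge> 0" "e \<ge> 0" and c: "cl e l T h k"
  shows "cl e l T (Av n h) (Av n k)"
  unfolding cl_def
proof
  fix r assume r: "r \<in> {0..T}"
  have "\<bar>Av n (\<lambda>s. h s - k s) r\<bar> \<le> Av 0 (\<lambda>s. e * exp (l * r)) r"
  proof (intro abs_Av_le continuous_intros h)
    fix s assume s: "0 \<le> s" "s \<le> r"
    then have "\<bar>h s - k s\<bar> \<le> e * exp (l * s)" using c r by (auto simp: cl_def)
    also have "\<dots> \<le> e * exp (l * r)" using s l by (intro mult_left_mono) (auto intro: mult_left_mono)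
    finally show "\<bar>h s - k s\<bar> \<le> e * exp (l * r)" .
  qed (use r in auto)
  then show "\<bar>Av n h r - Av n k r\<bar> \<le> e * exp (l * r)"
    using r by (simp add: Av_const Av_diff h)
qed

lemma cl_mono: "cl e l T h k \<Longrightarrow> e \<le> e' \<Longrightarrow> cl e' l T h k"
  unfolding cl_def by (meson exp_ge_zero mult_right_mono order_trans)

lemma cl_add: "cl e l T h k \<Longrightarrow> cl e' l T h' k' \<Longrightarrow> cl (e + e') l T (\<lambda>s. h s + h' s) (\<lambda>s. k s + k' s)"
  unfolding cl_def by (force simp: distrib_right)

lemma cl_const: "e \<ge> 0 \<Longrightarrow> cl e l T (\<lambda>_. c) (\<lambda>_. c)"
  by (auto simp: cl_def)

lemma cl_mult:
  assumes "cl e l T h k" "cl e' l T h' k'" "\<And>s. s \<in> {0..T} \<Longrightarrow> \<bar>h s\<bar> \<le> B"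
    "\<And>s. s \<in> {0..T} \<Longrightarrow> \<bar>k' s\<bar> \<le> B'"
  shows "cl (B * e' + B' * e) l T (\<lambda>s. h s * h' s) (\<lambda>s. k s * k' s)"
  unfolding cl_def
proof
  fix s assume s: "s \<in> {0..T}"
  have "\<bar>h s * h' s - k s * k' s\<bar> = \<bar>h s * (h' s - k' s) + k' s * (h s - k s)\<bar>"
    by (simp add: algebra_simps)
  also have "\<dots> \<le> \<bar>h s\<bar> * \<bar>h' s - k' s\<bar> + \<bar>k' s\<bar> * \<bar>h s - k s\<bar>"
    by (metis abs_mult abs_triangle_ineq)
  also have "\<dots> \<le> B * (e' * exp (l * s)) + B' * (e * exp (l * s))"
    using assms s order_trans[OF abs_ge_zero assms(3)[OF s]] order_trans[OF abs_ge_zero assms(4)[OF s]]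
    by (intro add_mono mult_mono) (auto simp: cl_def)
  finally show "\<bar>h s * h' s - k s * k' s\<bar> \<le> (B * e' + B' * e) * exp (l * s)"
    by (simp add: algebra_simps)
qed

lemma cl_cmult:
  assumes "cl e l T h k" "c \<ge> 0"
  shows "cl (c * e) l T (\<lambda>s. c * h s) (\<lambda>s. c * k s)"
  using assms mult_left_mono[OF _ assms(2)]
  by (auto simp: cl_def abs_mult right_diff_distrib[symmetric] mult.assoc)

lemma cl_divide:
  assumes "cl e l T h k" "cl e' l T w v" "W > 0" "\<And>s. s \<in> {0..T} \<Longrightarrow> \<bar>k s\<bar> \<le> B"
    "\<And>s. s \<in> {0..T} \<Longrightarrow> w s \<ge> 1 / W" "\<And>s. s \<in> {0..T} \<Longrightarrow> v s \<ge> 1 / W"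
  shows "cl (W * e + B * W\<^sup>2 * e') l T (\<lambda>s. h s / w s) (\<lambda>s. k s / v s)"
  unfolding cl_def
proof
  fix s assume s: "s \<in> {0..T}"
  have wv: "w s > 0" "v s > 0"
    using assms(5,6)[OF s] assms(3) by (auto intro: less_le_trans[of 0 "1/W"])
  have iw: "1 / w s \<le> W" "1 / v s \<le> W"
    using assms(5,6)[OF s] wv assms(3) by (auto simp: field_simps)
  have ee: "0 \<le> e * exp (l * s)" "0 \<le> e' * exp (l * s)"
    using assms(1,2) s by (auto simp: cl_def intro: order_trans[OF abs_ge_zero])
  have "\<bar>h s / w s - k s / v s\<bar> = \<bar>(h s - k s) * (1 / w s) + k s * (v s - w s) * ((1 / w s) * (1 / v s))\<bar>"
    using wv by (simp add: field_simps)
  also have "\<dots> \<le> \<bar>h s - k s\<bar> * (1 / w s) + \<bar>k s\<bar> * \<bar>v s - w s\<bar> * ((1 / w s) * (1 / v s))"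
    using wv by (intro order_trans[OF abs_triangle_ineq]) (auto simp: abs_mult)
  also have "\<dots> \<le> (e * exp (l * s)) * W + B * (e' * exp (l * s)) * (W * W)"
    using assms s wv iw order_trans[OF abs_ge_zero assms(4)[OF s]]
    by (intro add_mono mult_mono ee mult_nonneg_nonneg) (auto simp: cl_def abs_minus_commute)
  finally show "\<bar>h s / w s - k s / v s\<bar> \<le> (W * e + B * W\<^sup>2 * e') * exp (l * s)"
    by (simp add: algebra_simps power2_eq_square)
qed

lemma cl_exp:
  assumes "cl e l T h k" "\<And>s. s \<in> {0..T} \<Longrightarrow> exp (h s) \<le> B" "\<And>s. s \<in> {0..T} \<Longrightarrow> exp (k s) \<le> B"
  shows "cl (B * e) l T (\<lambda>s. exp (h s)) (\<lambda>s. exp (k s))"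
  unfolding cl_def
proof
  \<comment> \<open>The tangent inequality \<open>exp u >= 1 + u\<close> at u = y - x, multiplied by
    \<open>exp x\<close>.\<close>
  have *: "exp x - exp y \<le> B * \<bar>x - y\<bar>" if "exp x \<le> B" for x y :: real
  proof -
    have "1 - exp (y - x) \<le> \<bar>x - y\<bar>" using exp_ge_add_one_self[of "y - x"] by linarith
    then have "exp x * (1 - exp (y - x)) \<le> exp x * \<bar>x - y\<bar>" by (intro mult_left_mono) auto
    also have "\<dots> \<le> B * \<bar>x - y\<bar>" using that by (intro mult_right_mono) auto
    also have "exp x * (1 - exp (y - x)) = exp x - exp y" by (simp add: right_diff_distrib exp_diff)
    finally show ?thesis .
  qed
  fix s assume s: "s \<in> {0..T}"
  have "\<bar>exp (h s) - exp (k s)\<bar> \<le> B * \<bar>h s - k s\<bar>"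
    using *[OF assms(2)[OF s], of "k s"] *[OF assms(3)[OF s], of "h s"] by (simp add: abs_minus_commute)
  also have "\<dots> \<le> B * (e * exp (l * s))"
    using assms(1) s order_trans[OF exp_ge_zero assms(2)[OF s]] by (intro mult_left_mono) (auto simp: cl_def)
  finally show "\<bar>exp (h s) - exp (k s)\<bar> \<le> B * e * exp (l * s)" by simp
qed

text \<open>\<open>r * Jv n w h r\<close> is the variation-of-constants solution u of
  \<open>(r^n w u)' = r^n w h\<close> that is regular at 0.\<close>

definition Jv :: "nat \<Rightarrow> (real \<Rightarrow> real) \<Rightarrow> (real \<Rightarrow> real) \<Rightarrow> real \<Rightarrow> real" where
  "Jv n w h r = Av n (\<lambda>s. w s * h s) r / w r"

lemma Av_abs_bound:
  assumes "continuous_on {0..} h" "r \<ge> 0" "\<And>s. 0 \<le> s \<Longrightarrow> s \<le> r \<Longrightarrow> \<bar>h s\<bar> \<le> B"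
  shows "\<bar>Av n h r\<bar> \<le> B"
  using abs_Av_le[OF assms(1) continuous_on_const assms(2,3), of n] by (simp add: Av_const)

lemma cl_Jv:
  assumes c: "continuous_on {0..} w" "continuous_on {0..} v" "continuous_on {0..} h" "continuous_on {0..} k"
    and W: "W \<ge> 1" and e: "E \<ge> 0" "l \<ge> 0" and cl: "cl E l T w v" "cl E l T h k"
    and b: "\<And>s. s \<in> {0..T} \<Longrightarrow> w s \<in> {1 / W..W}" "\<And>s. s \<in> {0..T} \<Longrightarrow> v s \<in> {1 / W..W}"
      "\<And>s. s \<in> {0..T} \<Longrightarrow> \<bar>h s\<bar> \<le> W" "\<And>s. s \<in> {0..T} \<Longrightarrow> \<bar>k s\<bar> \<le> W"
  shows "cl (3 * W ^ 4 * E) l T (Jv n w h) (Jv n v k)"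
proof -
  have W0: "1 / W > 0" using W by auto
  have w: "\<bar>w s\<bar> \<le> W" "\<bar>v s\<bar> \<le> W" if "s \<in> {0..T}" for s
    using b(1,2)[OF that] order_trans[OF less_imp_le[OF W0], of "w s"]
      order_trans[OF less_imp_le[OF W0], of "v s"] by auto
  have "cl (W * E + W * E) l T (\<lambda>s. w s * h s) (\<lambda>s. v s * k s)"
    by (intro cl_mult cl w b)
  then have *: "cl (W * E + W * E) l T (Av n (\<lambda>s. w s * h s)) (Av n (\<lambda>s. v s * k s))"
    using W e by (intro cl_Av continuous_intros c) auto
  have "\<bar>Av n (\<lambda>s. v s * k s) r\<bar> \<le> W * W" if "r \<in> {0..T}" for r
    using that W by (intro Av_abs_bound continuous_intros c) (auto simp: abs_mult intro!: mult_mono w b)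
  then have "cl (W * (W * E + W * E) + (W * W) * W\<^sup>2 * E) l T (Jv n w h) (Jv n v k)"
    unfolding Jv_def[abs_def] using W b by (intro cl_divide[OF * cl(1)]) auto
  then show ?thesis
  proof (rule cl_mono)
    have "W ^ 2 * E \<le> W ^ 4 * E" using W e by (intro mult_right_mono power_increasing) auto
    then show "W * (W * E + W * E) + W * W * W\<^sup>2 * E \<le> 3 * W ^ 4 * E"
      by (simp add: power2_eq_square power4_eq_xxxx algebra_simps)
  qed
qed

subsection \<open>Fixed points of causal operators\<close>

text \<open>At a singular initial point one of the three unknowns (\<open>Sing\<close>) is not an integral of the others with
  a small factor in front, so a plain sup norm does not give a contraction; it enters with a
  large weight instead.\<close>

datatype comp = Slow | Pot | Sing

type_synonym state = "comp \<Rightarrow> real \<Rightarrow> real"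

text \<open>The weights \<open>w\<close> let the \<open>Sing\<close> component carry a larger error
  than the other two.\<close>

definition near :: "(comp \<Rightarrow> real) \<Rightarrow> real \<Rightarrow> real \<Rightarrow> real \<Rightarrow> state \<Rightarrow> state \<Rightarrow> bool" where
  "near w e l T S S' \<longleftrightarrow> (\<forall>c. cl (w c * e) l T (S c) (S' c))"

definition cont_state :: "state \<Rightarrow> bool" where
  "cont_state S \<longleftrightarrow> (\<forall>c. continuous_on {0..} (S c))"

definition params :: "(real \<times> real) set" where
  "params = {0<..} \<times> {0<..}"

text \<open>\<open>K\<close> is an invariant set on the whole half-line, tailored to the iteration;
  \<open>adm B T\<close> records mere bounds on [0, T]. The contraction is stated for
  \<open>adm\<close> and not for \<open>K\<close>, so that uniqueness also covers solutions that are
  not known to lie in \<open>K\<close>.\<close>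

locale causal =
  fixes \<Phi> :: "real \<times> real \<Rightarrow> state \<Rightarrow> state"
    and K :: "real \<times> real \<Rightarrow> state \<Rightarrow> bool"
    and adm :: "real \<Rightarrow> real \<Rightarrow> state \<Rightarrow> bool"
    and S0 :: "real \<times> real \<Rightarrow> state"
  assumes adm_bound: "adm B T S \<Longrightarrow> s \<in> {0..T} \<Longrightarrow> \<bar>S c s\<bar> \<le> B"
    and adm_mono: "adm B T S \<Longrightarrow> B \<le> B' \<Longrightarrow> adm B' T S"
    and contraction: "\<exists>w l. l > 0 \<and> (\<forall>c. w c \<ge> 1) \<and> (\<forall>p\<in>params. \<forall>S S' e. fst p \<le> B \<longrightarrow> snd p \<le> B \<longrightarrow>
        e \<ge> 0 \<longrightarrow> cont_state S \<longrightarrow> cont_state S' \<longrightarrow> adm B T S \<longrightarrow> adm B T S' \<longrightarrow>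
        near w e l T S S' \<longrightarrow> near w (e / 2) l T (\<Phi> p S) (\<Phi> p S'))"
    and K_adm: "p \<in> params \<Longrightarrow> \<exists>U B. open U \<and> p \<in> U \<and> (\<forall>q\<in>params \<inter> U. fst q \<le> B \<and> snd q \<le> B \<and>
        (\<forall>S. K q S \<longrightarrow> adm B T S))"
    and K_step: "p \<in> params \<Longrightarrow> cont_state S \<Longrightarrow> K p S \<Longrightarrow> K p (\<Phi> p S)"
    and K_start: "p \<in> params \<Longrightarrow> K p (S0 p)"
    and K_limit: "p \<in> params \<Longrightarrow> (\<And>n. K p (X n)) \<Longrightarrow> cont_state L \<Longrightarrow>
        (\<And>c r. r \<ge> 0 \<Longrightarrow> (\<lambda>n. X n c r) \<longlonglongrightarrow> L c r) \<Longrightarrow> K p L"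
    and jcont_start: "jcont params (\<lambda>p. S0 p c)"
    and jcont_step: "(\<And>c. jcont params (\<lambda>p. V p c)) \<Longrightarrow> (\<And>p. p \<in> params \<Longrightarrow> K p (V p)) \<Longrightarrow>
        jcont params (\<lambda>p. \<Phi> p (V p) c)"
begin

primrec iter :: "nat \<Rightarrow> real \<times> real \<Rightarrow> state" where
  "iter 0 p = S0 p"
| "iter (Suc n) p = \<Phi> p (iter n p)"

lemma iter_K_jcont: "(\<forall>c. jcont params (\<lambda>p. iter n p c)) \<and> (\<forall>p\<in>params. K p (iter n p))"
proof (induction n)
  case 0
  then show ?case using jcont_start K_start by simp
next
  case (Suc n)
  then have "cont_state (iter n p)" if "p \<in> params" for p
    using that by (auto simp: cont_state_def intro: jcont_slice)
  with Suc show ?case by (auto intro!: jcont_step K_step)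
qed

lemma cont_iter: "p \<in> params \<Longrightarrow> cont_state (iter n p)"
  using iter_K_jcont[of n] by (auto simp: cont_state_def intro: jcont_slice)

text \<open>\<open>K_adm\<close> provides one bound B for all parameters near p0, so the weights,
  the rate l and the initial error are common to a neighbourhood. The first two iterates differ by
  at most 2 B, which the weights and the exponential, all at least 1, turn into a
  \<open>near\<close> statement; then the error halves at each step.\<close>

lemma iter_near:
  assumes "p0 \<in> params"
  shows "\<exists>U w l e. open U \<and> p0 \<in> U \<and> l > 0 \<and> (\<forall>c. w c \<ge> 1) \<and> e \<ge> 0 \<and>
    (\<forall>p\<in>params \<inter> U.
      (\<forall>S S' e. e \<ge> 0 \<longrightarrow> cont_state S \<longrightarrow> cont_state S' \<longrightarrow> K p S \<longrightarrow> K p S' \<longrightarrow>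
        near w e l T S S' \<longrightarrow> near w (e / 2) l T (\<Phi> p S) (\<Phi> p S')) \<and>
      (\<forall>n. near w (e / 2 ^ n) l T (iter n p) (iter (Suc n) p)))"
proof -
  obtain U B where U: "open U" "p0 \<in> U"
    and B: "\<And>q. q \<in> params \<inter> U \<Longrightarrow> fst q \<le> B \<and> snd q \<le> B \<and> (\<forall>S. K q S \<longrightarrow> adm B T S)"
    using K_adm[OF assms, of T] by blast
  obtain w l where w: "l > 0" "\<And>c. w c \<ge> 1"
    and ctr: "\<And>p S S' e. \<lbrakk>p \<in> params; fst p \<le> B; snd p \<le> B; e \<ge> 0; cont_state S; cont_state S';
      adm B T S; adm B T S'; near w e l T S S'\<rbrakk> \<Longrightarrow> near w (e / 2) l T (\<Phi> p S) (\<Phi> p S')"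
    using contraction[of B T] by blast
  have B0: "B \<ge> 0" using B[of p0] assms U by (auto simp: params_def)
  have ctr': "near w (e / 2) l T (\<Phi> p S) (\<Phi> p S')"
    if "p \<in> params \<inter> U" "e \<ge> 0" "cont_state S" "cont_state S'" "K p S" "K p S'" "near w e l T S S'"
    for p S S' e
    using that B[of p] by (intro ctr) auto
  have it: "near w (2 * B / 2 ^ n) l T (iter n p) (iter (Suc n) p)" if p: "p \<in> params \<inter> U" for n p
  proof (induction n)
    case 0
    show ?case unfolding near_def cl_def
    proof (intro allI ballI)
      fix c s assume s: "s \<in> {0..T}"
      have ad: "adm B T (iter n p)" for n using B[OF p] p iter_K_jcont[of n] by blast
      have "\<bar>iter 0 p c s - iter (Suc 0) p c s\<bar> \<le> 2 * B"
        using adm_bound[OF ad s, of 0 c] adm_bound[OF ad s, of 1 c] by auto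
      also have "\<dots> \<le> w c * (2 * B) * exp (l * s)"
      proof -
        have "1 * 1 \<le> w c * exp (l * s)" using w s by (intro mult_mono) (auto intro: less_imp_le order_trans[of 0 1])
        then show ?thesis using mult_right_mono[of 1 "w c * exp (l * s)" "2 * B"] B0 by (simp add: ac_simps)
      qed
      finally show "\<bar>iter 0 p c s - iter (Suc 0) p c s\<bar> \<le> w c * (2 * B / 2 ^ 0) * exp (l * s)" by simp
    qed
  next
    case (Suc n)
    have "near w (2 * B / 2 ^ n / 2) l T (\<Phi> p (iter n p)) (\<Phi> p (iter (Suc n) p))"
      using p iter_K_jcont[of n] iter_K_jcont[of "Suc n"] cont_iter[of p n] cont_iter[of p "Suc n"] B0
      by (intro ctr' Suc) auto
    then show ?case by simp
  qed
  show ?thesis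
    by (rule exI[of _ U], rule exI[of _ w], rule exI[of _ l], rule exI[of _ "2 * B"],
        intro conjI ballI allI impI) (use U w B0 it ctr' in simp_all)
qed

text \<open>The factor is the partial geometric sum of \<open>1 / 2^i\<close> for i from n to n + j
  - 1.\<close>

lemma near_telescope:
  assumes "\<And>n. near w (e / 2 ^ n) l T (X n) (X (Suc n))"
  shows "near w (e * (2 / 2 ^ n - 2 / 2 ^ (n + j))) l T (X n) (X (n + j))"
proof (induction j)
  case 0
  then show ?case by (simp add: near_def cl_def)
next
  case (Suc j)
  show ?case unfolding near_def cl_def
  proof (intro allI ballI)
    fix c s assume s: "s \<in> {0..T}"
    have 1: "\<bar>X n c s - X (n + j) c s\<bar> \<le> w c * (e * (2 / 2 ^ n - 2 / 2 ^ (n + j))) * exp (l * s)"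
      using Suc s by (auto simp: near_def cl_def)
    have 2: "\<bar>X (n + j) c s - X (n + Suc j) c s\<bar> \<le> w c * (e / 2 ^ (n + j)) * exp (l * s)"
      using assms[of "n + j"] s by (auto simp: near_def cl_def)
    have "w c * (e * (2 / 2 ^ n - 2 / 2 ^ (n + j))) * exp (l * s) + w c * (e / 2 ^ (n + j)) * exp (l * s)
      = w c * (e * (2 / 2 ^ n - 2 / 2 ^ (n + Suc j))) * exp (l * s)"
      by (simp add: field_simps)
    with 1 2 show "\<bar>X n c s - X (n + Suc j) c s\<bar> \<le> w c * (e * (2 / 2 ^ n - 2 / 2 ^ (n + Suc j))) * exp (l * s)"
      by linarith
  qed
qed

text \<open>The limit of the iterates as a telescoping series, which is the form in which the
  Weierstrass M-test gives uniform convergence.\<close>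

definition fixp :: "real \<times> real \<Rightarrow> state" where
  "fixp p c r = iter 0 p c r + (\<Sum>n. iter (Suc n) p c r - iter n p c r)"

lemma fixp_uniform:
  assumes "p0 \<in> params"
  shows "\<exists>U. open U \<and> p0 \<in> U \<and> uniform_limit ((params \<inter> U) \<times> {0..T})
    (\<lambda>n z. iter n (fst z) c (snd z)) (\<lambda>z. fixp (fst z) c (snd z)) sequentially"
proof -
  obtain U w l e where U: "open U" "p0 \<in> U" and w: "l > 0" "\<And>c. w c \<ge> 1" "e \<ge> 0"
    and nr: "\<And>p n. p \<in> params \<inter> U \<Longrightarrow> near w (e / 2 ^ n) l T (iter n p) (iter (Suc n) p)"
    using iter_near[OF assms, of T] by metis
  define M where "M n = w c * e * exp (l * T) * (1/2) ^ n" for n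
  have M: "norm (iter (Suc n) (fst z) c (snd z) - iter n (fst z) c (snd z)) \<le> M n"
    if z: "z \<in> (params \<inter> U) \<times> {0..T}" for n z
  proof -
    have "\<bar>iter n (fst z) c (snd z) - iter (Suc n) (fst z) c (snd z)\<bar>
      \<le> w c * (e / 2 ^ n) * exp (l * snd z)"
      using nr[of "fst z" n] z by (auto simp: near_def cl_def)
    also have "\<dots> \<le> w c * (e / 2 ^ n) * exp (l * T)"
      using w z by (intro mult_left_mono mult_nonneg_nonneg) (auto intro: order_trans[of 0 1])
    finally show ?thesis by (simp add: M_def power_divide abs_minus_commute)
  qed
  have "summable M" unfolding M_def by (intro summable_mult summable_geometric) auto
  from Weierstrass_m_test[OF M this]
  have "uniform_limit ((params \<inter> U) \<times> {0..T})
     (\<lambda>n z. iter 0 (fst z) c (snd z) + (\<Sum>i<n. iter (Suc i) (fst z) c (snd z) - iter i (fst z) c (snd z)))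
     (\<lambda>z. fixp (fst z) c (snd z)) sequentially"
    unfolding fixp_def by (intro uniform_limit_intros)
  moreover have "(\<Sum>i<n. iter (Suc i) p c r - iter i p c r) = iter n p c r - iter 0 p c r" for n p r
    using sum_lessThan_telescope[of "\<lambda>i. iter i p c r" n] .
  ultimately show ?thesis using U by (auto simp del: iter.simps)
qed

lemma fixp_limit:
  assumes "p \<in> params" "r \<ge> 0"
  shows "(\<lambda>n. iter n p c r) \<longlonglongrightarrow> fixp p c r"
proof -
  from fixp_uniform[OF assms(1), where T = r and c = c] obtain U where U: "p \<in> U" "uniform_limit ((params \<inter> U) \<times> {0..r})
    (\<lambda>n z. iter n (fst z) c (snd z)) (\<lambda>z. fixp (fst z) c (snd z)) sequentially" by blast
  from tendsto_uniform_limitI[OF U(2), of "(p, r)"] U(1) assms show ?thesis by auto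
qed

lemma jcont_fixp: "jcont params (\<lambda>p. fixp p c)"
  unfolding jcont_def continuous_on_eq_continuous_within
proof
  fix z0 :: "(real \<times> real) \<times> real" assume z0: "z0 \<in> params \<times> {0..}"
  \<comment> \<open>Uniform convergence holds only near a given parameter and on bounded intervals;
    the margin 1 makes the box a neighbourhood of z0 within the domain.\<close>
  define T where "T = snd z0 + 1"
  from fixp_uniform[of "fst z0", where T = T and c = c] z0 obtain U where U: "open U" "fst z0 \<in> U"
    "uniform_limit ((params \<inter> U) \<times> {0..T})
    (\<lambda>n z. iter n (fst z) c (snd z)) (\<lambda>z. fixp (fst z) c (snd z)) sequentially" by auto
  have "continuous_on (params \<times> {0..}) (\<lambda>z. iter n (fst z) c (snd z))" for n
    using iter_K_jcont[of n] by (simp add: jcont_def)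
  then have "continuous_on ((params \<inter> U) \<times> {0..T}) (\<lambda>z. iter n (fst z) c (snd z))" for n
    by (rule continuous_on_subset) auto
  then have "continuous_on ((params \<inter> U) \<times> {0..T}) (\<lambda>z. fixp (fst z) c (snd z))"
    by (intro uniform_limit_theorem[OF _ U(3)] always_eventually allI) auto
  then have "continuous (at z0 within (params \<inter> U) \<times> {0..T}) (\<lambda>z. fixp (fst z) c (snd z))"
    unfolding continuous_on_eq_continuous_within
    by (rule bspec) (use z0 U(2) in \<open>auto simp: T_def mem_Times_iff\<close>)
  moreover have "at z0 within (params \<inter> U) \<times> {0..T} = at z0 within params \<times> {0..}"
    by (rule at_within_nhd[of _ "U \<times> {..<T}"]) (use z0 U in \<open>auto simp: T_def mem_Times_iff intro: open_Times\<close>)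
  ultimately show "continuous (at z0 within params \<times> {0..}) (\<lambda>z. fixp (fst z) c (snd z))" by simp
qed

lemma cont_fixp: "p \<in> params \<Longrightarrow> cont_state (fixp p)"
  unfolding cont_state_def using jcont_slice[OF jcont_fixp] by blast

lemma K_fixp: "p \<in> params \<Longrightarrow> K p (fixp p)"
  by (rule K_limit[of p "\<lambda>n. iter n p"]) (use iter_K_jcont cont_fixp fixp_limit in blast)+

text \<open>The contraction itself plays the part of continuity of \<open>\<Phi>\<close>: applied to
  the pair of \<open>iter n p\<close> and the limit, it shows that \<open>iter (Suc n) p\<close>
  also tends to \<open>\<Phi> p (fixp p)\<close>.\<close>

lemma fixp_eq:
  assumes p: "p \<in> params" and r: "r \<ge> 0"
  shows "\<Phi> p (fixp p) c r = fixp p c r"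
proof -
  obtain U w l e where U: "p \<in> U" and w: "l > 0" "\<And>c. w c \<ge> 1" "e \<ge> 0"
    and ctr: "\<And>p S S' e. \<lbrakk>p \<in> params \<inter> U; e \<ge> 0; cont_state S; cont_state S'; K p S; K p S';
       near w e l r S S'\<rbrakk> \<Longrightarrow> near w (e / 2) l r (\<Phi> p S) (\<Phi> p S')"
    and nr: "\<And>p n. p \<in> params \<inter> U \<Longrightarrow> near w (e / 2 ^ n) l r (iter n p) (iter (Suc n) p)"
    using iter_near[OF p, of r] by metis
  have "near w (2 * e / 2 ^ n) l r (iter n p) (fixp p)" for n
    unfolding near_def cl_def
  proof (intro allI ballI)
    fix c s assume s: "s \<in> {0..r}"
    have "(\<lambda>j. iter (j + n) p c s) \<longlonglongrightarrow> fixp p c s"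
      using s by (intro LIMSEQ_ignore_initial_segment fixp_limit p) auto
    then have lim: "(\<lambda>j. \<bar>iter n p c s - iter (n + j) p c s\<bar>) \<longlonglongrightarrow> \<bar>iter n p c s - fixp p c s\<bar>"
      by (intro tendsto_intros) (simp add: add.commute)
    have "\<bar>iter n p c s - iter (n + j) p c s\<bar> \<le> w c * (2 * e / 2 ^ n) * exp (l * s)" for j
    proof -
      have "\<bar>iter n p c s - iter (n + j) p c s\<bar>
          \<le> w c * (e * (2 / 2 ^ n - 2 / 2 ^ (n + j))) * exp (l * s)"
        using near_telescope[of w e l r "\<lambda>n. iter n p" n j] nr p U s by (auto simp: near_def cl_def)
      also have "\<dots> \<le> w c * (e * (2 / 2 ^ n)) * exp (l * s)"
        using w order_trans[OF zero_le_one w(2)] by (intro mult_right_mono mult_left_mono) auto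
      finally show ?thesis by (simp add: mult.commute)
    qed
    then show "\<bar>iter n p c s - fixp p c s\<bar> \<le> w c * (2 * e / 2 ^ n) * exp (l * s)"
      by (intro LIMSEQ_le_const2[OF lim]) auto
  qed
  then have "near w (2 * e / 2 ^ n / 2) l r (\<Phi> p (iter n p)) (\<Phi> p (fixp p))" for n
    using p U w iter_K_jcont by (intro ctr cont_iter cont_fixp K_fixp) auto
  then have "\<bar>\<Phi> p (iter n p) c r - \<Phi> p (fixp p) c r\<bar> \<le> w c * (2 * e / 2 ^ n / 2) * exp (l * r)" for n
    using r by (auto simp: near_def cl_def)
  then have "\<bar>iter (Suc n) p c r - \<Phi> p (fixp p) c r\<bar> \<le> w c * e * exp (l * r) * (1 / 2) ^ n" for n
    by (simp add: power_divide)
  then have "\<forall>\<^sub>F n in sequentially. norm (iter (Suc n) p c r - \<Phi> p (fixp p) c r) \<le> w c * e * exp (l * r) * (1 / 2) ^ n"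
    by (intro always_eventually allI) (simp only: real_norm_def)
  moreover have "(\<lambda>n. w c * e * exp (l * r) * (1 / 2) ^ n) \<longlonglongrightarrow> 0"
    by (intro tendsto_mult_right_zero LIMSEQ_power_zero) auto
  ultimately have "(\<lambda>n. iter (Suc n) p c r - \<Phi> p (fixp p) c r) \<longlonglongrightarrow> 0"
    by (rule Lim_null_comparison)
  then have "(\<lambda>n. iter (Suc n) p c r) \<longlonglongrightarrow> \<Phi> p (fixp p) c r"
    by (simp add: LIM_zero_iff)
  with LIMSEQ_Suc[OF fixp_limit[OF p r, of c]] show ?thesis
    by (metis LIMSEQ_unique)
qed

lemma fixp_unique:
  assumes p: "p \<in> params" and r: "r \<ge> 0"
    and S: "cont_state S" "\<And>c r. r \<ge> 0 \<Longrightarrow> \<Phi> p S c r = S c r" "\<exists>B. adm B r S"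
    and S': "cont_state S'" "\<And>c r. r \<ge> 0 \<Longrightarrow> \<Phi> p S' c r = S' c r" "\<exists>B. adm B r S'"
  shows "S c r = S' c r"
proof -
  obtain B1 B2 where B12: "adm B1 r S" "adm B2 r S'" using S S' by blast
  \<comment> \<open>Both states and both parameter components must lie below a single bound before
    the contraction applies.\<close>
  define B where "B = max (max B1 B2) (max (fst p) (snd p))"
  have B: "adm B r S" "adm B r S'" "fst p \<le> B" "snd p \<le> B"
    using B12 by (auto simp: B_def elim!: adm_mono)
  then have B0: "B > 0" using p by (auto simp: params_def)
  obtain w l where w: "l > 0" "\<And>c. w c \<ge> 1"
    and ctr: "\<And>e. e \<ge> 0 \<Longrightarrow> near w e l r S S' \<Longrightarrow> near w (e / 2) l r (\<Phi> p S) (\<Phi> p S')"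
    using contraction[of B r] p B S S' by metis
  have "near w (2 * B / 2 ^ n) l r S S'" for n
  proof (induction n)
    case 0
    show ?case unfolding near_def cl_def
    proof (intro allI ballI)
      fix c s assume s: "s \<in> {0..r}"
      have "1 * 1 \<le> w c * exp (l * s)" using w s by (intro mult_mono) (auto intro: less_imp_le order_trans[of 0 1])
      then have "2 * B \<le> w c * (2 * B) * exp (l * s)"
        using mult_right_mono[of 1 "w c * exp (l * s)" "2 * B"] B0 by (simp add: ac_simps)
      then show "\<bar>S c s - S' c s\<bar> \<le> w c * (2 * B / 2 ^ 0) * exp (l * s)"
        using adm_bound[OF B(1) s, of c] adm_bound[OF B(2) s, of c] by auto
    qed
  next
    case (Suc n)
    from ctr[OF _ Suc] B0 have "near w (2 * B / 2 ^ Suc n) l r (\<Phi> p S) (\<Phi> p S')" by simp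
    then show ?case by (auto simp: near_def cl_def S S')
  qed
  then have "\<bar>S c r - S' c r\<bar> \<le> w c * (2 * B / 2 ^ n) * exp (l * r)" for n
    using r by (auto simp: near_def cl_def)
  then have le: "\<bar>S c r - S' c r\<bar> \<le> w c * (2 * B) * exp (l * r) * (1 / 2) ^ n" for n
    by (simp add: power_divide)
  have "(\<lambda>n. w c * (2 * B) * exp (l * r) * (1 / 2) ^ n) \<longlonglongrightarrow> 0"
    by (intro tendsto_mult_right_zero LIMSEQ_power_zero) auto
  from LIMSEQ_le_const[OF this] le have "\<bar>S c r - S' c r\<bar> \<le> 0" by blast
  then show ?thesis by simp
qed

end

subsection \<open>Comparison lemmas\<close>

lemma pos_of_pos_deriv:
  fixes w :: "real \<Rightarrow> real"
  assumes c: "continuous_on {0..} w" and w0: "w 0 \<ge> 0" and r: "r > 0"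
    and d: "\<And>x. x > 0 \<Longrightarrow> (w has_real_derivative w' x) (at x)" "\<And>x. x > 0 \<Longrightarrow> w' x > 0"
  shows "w r > 0"
proof -
  have "w 0 < w r"
    by (rule DERIV_pos_imp_increasing_open[OF r])
      (use d in \<open>auto intro: continuous_on_subset[OF c]\<close>)
  with w0 show ?thesis by simp
qed

text \<open>Only the sign of \<open>d'\<close> where d is positive enters. If d were positive at r,
  then beyond the last earlier point with d <= 0 it would be nonincreasing, a contradiction.\<close>

lemma barrier:
  fixes d :: "real \<Rightarrow> real"
  assumes r: "x0 \<le> r" and d0: "d x0 \<le> 0"
    and d: "\<And>x. x \<ge> x0 \<Longrightarrow> (d has_real_derivative d' x) (at x)"
      "\<And>x. x \<ge> x0 \<Longrightarrow> d x > 0 \<Longrightarrow> d' x \<le> 0"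
  shows "d r \<le> 0"
proof (rule ccontr)
  assume neg: "\<not> d r \<le> 0"
  have c: "continuous_on {x0..r} d"
    using d(1) by (intro DERIV_continuous_on[of _ d d']) (auto intro: has_field_derivative_at_within)
  define S where "S = {x\<in>{x0..r}. d x \<le> 0}"
  have "closed S" unfolding S_def by (intro continuous_closed_preimage_constant continuous_on_closed_Collect_le c continuous_intros closed_atLeastAtMost)
  then have cS: "compact S" by (intro compact_eq_bounded_closed[THEN iffD2]) (auto simp: S_def intro: bounded_subset[of "{x0..r}"])
  have "x0 \<in> S" using d0 r by (auto simp: S_def)
  then obtain x1 where x1: "x1 \<in> S" "\<And>x. x \<in> S \<Longrightarrow> x \<le> x1"
    using compact_attains_sup[OF cS] by auto
  have lt: "x1 < r" using x1(1) neg by (auto simp: S_def less_eq_real_def)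
  have "d r \<le> d x1"
  proof (rule DERIV_nonpos_imp_decreasing_open[of x1 r d])
    fix x assume x: "x1 < x" "x < r"
    then have "x \<notin> S" using x1(2) by force
    then have "d x > 0" using x x1(1) by (auto simp: S_def)
    then show "\<exists>y. (d has_real_derivative y) (at x) \<and> y \<le> 0"
      using d[of x] x x1(1) by (auto simp: S_def)
  qed (use lt x1(1) in \<open>auto simp: S_def intro: continuous_on_subset[OF c]\<close>)
  then show False using x1(1) neg by (auto simp: S_def)
qed

text \<open>\<open>K / x^2\<close> is a barrier. Above it the damping removes at least
  \<open>K / x^2\<close>, the forcing supplies at most a quarter of this, and the decline of the
  barrier itself costs \<open>2 K / x^3\<close>, at most half of it since x >= 4.\<close>

lemma tail_bound:
  fixes z :: "real \<Rightarrow> real"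
  assumes R: "R \<ge> 4" "r \<ge> R" and K: "K \<ge> 4 * F0" "\<bar>z R\<bar> \<le> K / R\<^sup>2"
    and dz: "\<And>x. x \<ge> R \<Longrightarrow> (z has_real_derivative F x - c x * z x) (at x)"
    and c: "\<And>x. x \<ge> R \<Longrightarrow> c x \<ge> 1" and F: "\<And>x. x \<ge> R \<Longrightarrow> \<bar>F x\<bar> \<le> F0 / x\<^sup>2"
  shows "\<bar>z r\<bar> \<le> K / r\<^sup>2"
proof -
  have K0: "K \<ge> 0" using K(2) R order_trans[OF abs_ge_zero K(2)] by (auto simp: zero_le_divide_iff)
  \<comment> \<open>The sign \<open>\<sigma>\<close> treats the upper and the lower barrier at
    once.\<close>
  have key: "\<sigma> * F x - c x * (\<sigma> * z x) + 2 * K / x ^ 3 \<le> 0"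
    if x: "x \<ge> R" and s: "\<bar>\<sigma>\<bar> = 1" and p: "\<sigma> * z x - K / x\<^sup>2 > 0" for x \<sigma>
  proof -
    have x4: "x \<ge> 4" using x R by simp
    have "\<sigma> * F x \<le> \<bar>F x\<bar>" using s by (metis abs_ge_self abs_mult mult_1)
    also have "\<dots> \<le> F0 / x\<^sup>2" by (rule F[OF x])
    also have "\<dots> \<le> K / 4 / x\<^sup>2" using K by (intro divide_right_mono) auto
    finally have 1: "\<sigma> * F x \<le> K / 4 / x\<^sup>2" .
    have "K / x\<^sup>2 \<ge> 0" using K0 by simp
    then have "1 * (\<sigma> * z x) \<le> c x * (\<sigma> * z x)" using p c[OF x] by (intro mult_right_mono) auto
    then have 2: "K / x\<^sup>2 \<le> c x * (\<sigma> * z x)" using p by simp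
    have "2 * K / x ^ 3 = (2 / x) * (K / x\<^sup>2)" by (simp add: power3_eq_cube power2_eq_square)
    also have "\<dots> \<le> (1 / 2) * (K / x\<^sup>2)" using x4 K0 by (intro mult_right_mono) (auto simp: field_simps)
    finally have 3: "2 * K / x ^ 3 \<le> (1 / 2) * (K / x\<^sup>2)" .
    have "K / 4 / x\<^sup>2 = (1 / 4) * (K / x\<^sup>2)" by simp
    with 1 2 3 \<open>K / x\<^sup>2 \<ge> 0\<close> show ?thesis by linarith
  qed
  have "\<sigma> * z r - K / r\<^sup>2 \<le> 0" if s: "\<bar>\<sigma>\<bar> = 1" for \<sigma>
  proof (rule barrier[of R r "\<lambda>x. \<sigma> * z x - K / x\<^sup>2" "\<lambda>x. \<sigma> * F x - c x * (\<sigma> * z x) + 2 * K / x ^ 3"])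
    have "\<sigma> * z R \<le> \<bar>z R\<bar>" using s by (metis abs_ge_self abs_mult mult_1)
    then show "\<sigma> * z R - K / R\<^sup>2 \<le> 0" using K by linarith
    fix x assume x: "x \<ge> R"
    have "x > 0" using x R by simp
    then show "((\<lambda>x. \<sigma> * z x - K / x\<^sup>2) has_real_derivative \<sigma> * F x - c x * (\<sigma> * z x) + 2 * K / x ^ 3) (at x)"
      by (auto intro!: derivative_eq_intros dz[OF x] simp: power2_eq_square power3_eq_cube field_simps)
  qed (use R key[OF _ s] in auto)
  from this[of 1] this[of "-1"] show ?thesis by auto
qed

lemma deriv_shifted_inverse:
  fixes c x d :: real
  assumes "c + x > 0"
  shows "((\<lambda>x. 1 / (c + x)) has_real_derivative - 1 / (c + x)\<^sup>2) (at x)"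
    "((\<lambda>x. d / (c + x)\<^sup>2) has_real_derivative - (2 * d / (c + x) ^ 3)) (at x)"
proof -
  show "((\<lambda>x. 1 / (c + x)) has_real_derivative - 1 / (c + x)\<^sup>2) (at x)"
    by (rule derivative_eq_intros refl)+ (use assms in \<open>auto simp: power2_eq_square\<close>)
  have *: "((\<lambda>t. d / t\<^sup>2) has_real_derivative - (2 * d / t ^ 3)) (at t)" if "t > 0" for t
    by (rule derivative_eq_intros refl)+ (use that in \<open>auto simp: power2_eq_square power3_eq_cube mult.assoc mult.commute[of d]\<close>)
  have "((+) c has_real_derivative 1) (at x)" by (auto intro!: derivative_eq_intros)
  from DERIV_chain'[OF this *[OF assms]]
  show "((\<lambda>x. d / (c + x)\<^sup>2) has_real_derivative - (2 * d / (c + x) ^ 3)) (at x)" by simp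
qed

text \<open>\<open>L - K / x\<close> increases and \<open>L + K / x\<close> decreases, so the limit
  is enclosed between them; this gives the explicit rate needed for uniformity in the
  parameter.\<close>

lemma tail_limit:
  fixes L :: "real \<Rightarrow> real"
  assumes R: "R > 0" and d: "\<And>x. x \<ge> R \<Longrightarrow> (L has_real_derivative z x) (at x)"
    "\<And>x. x \<ge> R \<Longrightarrow> \<bar>z x\<bar> \<le> K / x\<^sup>2"
  shows "\<exists>l. \<forall>r\<ge>R. \<bar>L r - l\<bar> \<le> K / r"
proof -
  have lo: "L x - K / x \<le> L y - K / y" if "R \<le> x" "x \<le> y" for x y
  proof (rule DERIV_nonneg_imp_nondecreasing[OF that(2)], intro exI conjI)
    fix t assume t: "x \<le> t" "t \<le> y"
    show "((\<lambda>x. L x - K / x) has_real_derivative z t + K / t\<^sup>2) (at t)"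
      using t that R by (auto intro!: derivative_eq_intros d simp: power2_eq_square)
    show "z t + K / t\<^sup>2 \<ge> 0" using d(2)[of t] t that by auto
  qed
  have hi: "L y + K / y \<le> L x + K / x" if "R \<le> x" "x \<le> y" for x y
  proof (rule DERIV_nonpos_imp_nonincreasing[OF that(2)], intro exI conjI)
    fix t assume t: "x \<le> t" "t \<le> y"
    show "((\<lambda>x. L x + K / x) has_real_derivative z t - K / t\<^sup>2) (at t)"
      using t that R by (auto intro!: derivative_eq_intros d simp: power2_eq_square)
    show "z t - K / t\<^sup>2 \<le> 0" using d(2)[of t] t that by auto
  qed
  have "K / R\<^sup>2 \<ge> 0" using order_trans[OF abs_ge_zero d(2)[of R]] by simp
  then have K: "K \<ge> 0" using R by (simp add: zero_le_divide_iff)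
  have lh: "L x - K / x \<le> L y + K / y" if "R \<le> x" "R \<le> y" for x y
  proof -
    have m: "R \<le> max x y" using that by simp
    then have "K / max x y \<ge> 0" using K R by (intro divide_nonneg_nonneg) auto
    with lo[OF that(1) max.cobounded1[of x y]] hi[OF that(2) max.cobounded2[of y x]]
    show ?thesis by linarith
  qed
  define l where "l = (SUP x\<in>{R..}. L x - K / x)"
  have "\<bar>L r - l\<bar> \<le> K / r" if r: "r \<ge> R" for r
  proof -
    have "L r - K / r \<le> l" unfolding l_def
      by (rule cSUP_upper) (use r lh[of _ R] in \<open>auto intro!: bdd_aboveI2\<close>)
    moreover have "l \<le> L r + K / r" unfolding l_def
      by (rule cSUP_least) (use r lh in auto)
    ultimately show ?thesis by linarith
  qed
  then show ?thesis by blast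
qed

subsection \<open>The conserved form of the soliton equations\<close>

text \<open>Here \<open>Y = b\<^sup>2\<close>, \<open>g = - f\<close>, and the equation for \<open>g'\<close> is the first integral. The conditions \<open>init\<close> hold
  for either factor collapsing at \<open>0\<close>.\<close>

locale flow =
  fixes k :: real and a a1 Y Y1 g g1 :: "real \<Rightarrow> real"
  assumes k_pos: "k > 0"
    and cont: "continuous_on {0..} a" "continuous_on {0..} a1" "continuous_on {0..} Y"
      "continuous_on {0..} Y1" "continuous_on {0..} g" "continuous_on {0..} g1"
    and a_pos: "r > 0 \<Longrightarrow> a r > 0" and Y_pos: "r > 0 \<Longrightarrow> Y r > 0" and g_nonneg: "r > 0 \<Longrightarrow> g r \<ge> 0"
    and da: "r > 0 \<Longrightarrow> (a has_real_derivative a1 r) (at r)"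
    and dY: "r > 0 \<Longrightarrow> (Y has_real_derivative Y1 r) (at r)"
    and dg: "r > 0 \<Longrightarrow> (g has_real_derivative g1 r) (at r)"
    and da1: "r > 0 \<Longrightarrow> (a1 has_real_derivative a r - a1 r * (Y1 r / Y r + g1 r)) (at r)"
    and dY1: "r > 0 \<Longrightarrow> (Y1 has_real_derivative 2 + 2 * Y r - Y1 r * (a1 r / a r + g1 r)) (at r)"
    and dg1: "r > 0 \<Longrightarrow> (g1 has_real_derivative
        k + 2 * g r - g1 r * (a1 r / a r + Y1 r / Y r + g1 r)) (at r)"
    and init: "a 0 * Y 0 = 0" "a 0 * Y1 0 = 0" "Y 0 * a1 0 \<ge> 0" "g1 0 = 0"
begin

section \<open>Positivity and the first integral\<close>

definition A where "A r = a1 r / a r"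
definition B where "B r = Y1 r / (2 * Y r)"
definition xi where "xi r = A r + 2 * B r + g1 r"
text \<open>The right-hand side of the equation for \<open>g1\<close>, hence \<open>g''\<close> in a
  form that can be differentiated once more.\<close>

definition v' where "v' r = k + 2 * g r - g1 r * xi r"
definition W where "W r = a r * Y r * exp (g r)"

lemma Y1_B: "r > 0 \<Longrightarrow> Y1 r = 2 * B r * Y r"
  using Y_pos[of r] by (simp add: B_def)

lemma a1_A: "r > 0 \<Longrightarrow> a1 r = A r * a r"
  using a_pos[of r] by (simp add: A_def)

text \<open>By the divergence form \<open>Y e^g a1\<close> is strictly increasing, and
  \<open>init\<close> makes it nonnegative at 0 whichever factor collapses. \<open>Y1_pos\<close>
  and \<open>g1_pos\<close> repeat the argument with their own weights.\<close>

lemma a1_pos: assumes "r > 0" shows "a1 r > 0"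
proof -
  have "Y r * exp (g r) * a1 r > 0"
  proof (rule pos_of_pos_deriv[OF _ _ assms])
    fix x :: real assume x: "x > 0"
    note p = a_pos[OF x] Y_pos[OF x]
    show "((\<lambda>r. Y r * exp (g r) * a1 r) has_real_derivative Y x * exp (g x) * a x) (at x)"
      by (rule derivative_eq_intros dY[OF x] dg[OF x] da1[OF x] refl)+ (use p in \<open>simp add: field_simps\<close>)
    show "Y x * exp (g x) * a x > 0" using p by simp
  qed (use init in \<open>auto intro!: continuous_intros cont simp: zero_le_mult_iff mult_le_0_iff\<close>)
  then show ?thesis by (rule zero_less_mult_pos) (simp add: Y_pos[OF assms])
qed

lemma Y1_pos: assumes "r > 0" shows "Y1 r > 0"
proof -
  have "a r * exp (g r) * Y1 r > 0"
  proof (rule pos_of_pos_deriv[OF _ _ assms])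
    fix x :: real assume x: "x > 0"
    note p = a_pos[OF x] Y_pos[OF x]
    show "((\<lambda>r. a r * exp (g r) * Y1 r) has_real_derivative a x * exp (g x) * (2 + 2 * Y x)) (at x)"
      by (rule derivative_eq_intros da[OF x] dg[OF x] dY1[OF x] refl)+ (use p in \<open>simp add: field_simps\<close>)
    show "a x * exp (g x) * (2 + 2 * Y x) > 0" using p by (simp add: add_pos_pos)
  qed (use init in \<open>auto intro!: continuous_intros cont\<close>)
  then show ?thesis by (rule zero_less_mult_pos) (simp add: a_pos[OF assms])
qed

lemma dW: assumes "r > 0" shows "(W has_real_derivative xi r * W r) (at r)"
  unfolding W_def[abs_def] xi_def A_def B_def
  by (rule derivative_eq_intros da[OF assms] dg[OF assms] dY[OF assms] refl)+
    (use a_pos[OF assms] Y_pos[OF assms] in \<open>simp add: field_simps\<close>)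

lemma W_pos: "r > 0 \<Longrightarrow> W r > 0"
  using a_pos Y_pos by (simp add: W_def)

lemma dg1': assumes "r > 0" shows "(g1 has_real_derivative v' r) (at r)"
  using dg1[OF assms] by (simp add: v'_def xi_def A_def B_def)

lemma g1_pos: assumes "r > 0" shows "g1 r > 0"
proof -
  have "W r * g1 r > 0"
  proof (rule pos_of_pos_deriv[OF _ _ assms])
    fix x :: real assume x: "x > 0"
    show "((\<lambda>r. W r * g1 r) has_real_derivative W x * (k + 2 * g x)) (at x)"
      by (rule derivative_eq_intros dW[OF x] dg1'[OF x] refl)+ (simp add: v'_def algebra_simps)
    show "W x * (k + 2 * g x) > 0" using W_pos[OF x] k_pos g_nonneg[OF x] by (simp add: add_pos_nonneg)
  qed (use init in \<open>auto intro!: continuous_intros cont simp: W_def\<close>)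
  then show ?thesis using W_pos[OF assms] by (simp add: zero_less_mult_iff)
qed

lemma A_pos: "r > 0 \<Longrightarrow> A r > 0" and B_pos: "r > 0 \<Longrightarrow> B r > 0"
  using a_pos Y_pos a1_pos Y1_pos by (auto simp: A_def B_def)

lemma dA: assumes "r > 0" shows "(A has_real_derivative 1 - xi r * A r) (at r)"
proof -
  have *: "(A has_real_derivative ((a r - a1 r * (Y1 r / Y r + g1 r)) * a r - a1 r * a1 r) / (a r * a r)) (at r)"
    unfolding A_def[abs_def] using a_pos[OF assms]
    by (intro DERIV_divide da1 da assms) auto
  show ?thesis
    by (rule DERIV_cong[OF *]) (use a_pos[OF assms] Y_pos[OF assms] in
      \<open>simp add: Y1_B[OF assms] a1_A[OF assms] xi_def field_simps\<close>)
qed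

lemma dB: assumes "r > 0" shows "(B has_real_derivative 1 + 1 / Y r - xi r * B r) (at r)"
proof -
  have *: "(B has_real_derivative ((2 + 2 * Y r - Y1 r * (a1 r / a r + g1 r)) * (2 * Y r) - Y1 r * (2 * Y1 r))
      / (2 * Y r * (2 * Y r))) (at r)"
    unfolding B_def[abs_def] using Y_pos[OF assms]
    by (intro DERIV_divide DERIV_cmult dY dY1 assms) auto
  show ?thesis
    by (rule DERIV_cong[OF *]) (use a_pos[OF assms] Y_pos[OF assms] in
      \<open>simp add: Y1_B[OF assms] a1_A[OF assms] xi_def field_simps\<close>)
qed

text \<open>The defect in \<open>\<xi>' = 1 - A\<^sup>2 - 2 * B\<^sup>2\<close>, see \<open>dxi_G\<close>.\<close>

definition G where "G r = 2 / Y r + (A r)\<^sup>2 + 2 * (B r)\<^sup>2 - (xi r)\<^sup>2 + 2 + k + 2 * g r"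

lemma dxi_G: assumes "r > 0" shows "(xi has_real_derivative 1 - (A r)\<^sup>2 - 2 * (B r)\<^sup>2 + G r) (at r)"
proof -
  have *: "(xi has_real_derivative (1 - xi r * A r) + 2 * (1 + 1 / Y r - xi r * B r) + v' r) (at r)"
    unfolding xi_def[abs_def]
    by (intro DERIV_add DERIV_cmult dA[unfolded xi_def] dB[unfolded xi_def] dg1' assms)
  show ?thesis
  proof (rule DERIV_cong[OF *])
    have "xi r * (A r + 2 * B r + g1 r) = (xi r)\<^sup>2" by (simp add: xi_def power2_eq_square)
    then show "1 - xi r * A r + 2 * (1 + 1 / Y r - xi r * B r) + v' r = 1 - (A r)\<^sup>2 - 2 * (B r)\<^sup>2 + G r"
      by (simp add: v'_def G_def algebra_simps)
  qed
qed

lemma dG: assumes "r > 0" shows "(G has_real_derivative - 2 * xi r * G r) (at r)"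
proof -
  have dY': "((\<lambda>r. 2 / Y r) has_real_derivative - 2 * Y1 r / (Y r)\<^sup>2) (at r)"
    by (rule derivative_eq_intros dY[OF assms] refl)+ (use Y_pos[OF assms] in \<open>auto simp: power2_eq_square\<close>)
  have *: "(G has_real_derivative - 2 * Y1 r / (Y r)\<^sup>2 + 2 * A r * (1 - xi r * A r)
      + 2 * (2 * B r * (1 + 1 / Y r - xi r * B r)) - 2 * xi r * (1 - (A r)\<^sup>2 - 2 * (B r)\<^sup>2 + G r)
      + 2 * g1 r) (at r)"
    unfolding G_def[abs_def]
    by (rule derivative_eq_intros dA[OF assms] dB[OF assms] dxi_G[OF assms] dg[OF assms] dY' refl)+
      (simp add: G_def)
  show ?thesis
  proof (rule DERIV_cong[OF *])
    have e: "- 2 * Y1 r / (Y r)\<^sup>2 = - 4 * B r / Y r"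
      using Y_pos[OF assms] by (simp add: Y1_B[OF assms] power2_eq_square)
    show "- 2 * Y1 r / (Y r)\<^sup>2 + 2 * A r * (1 - xi r * A r)
      + 2 * (2 * B r * (1 + 1 / Y r - xi r * B r)) - 2 * xi r * (1 - (A r)\<^sup>2 - 2 * (B r)\<^sup>2 + G r)
      + 2 * g1 r = - 2 * xi r * G r"
      unfolding e by (simp add: xi_def algebra_simps power2_eq_square)
  qed
qed

text \<open>\<open>G\<close> itself is singular at 0, but \<open>W^2 * G\<close> has derivative 0
  and equals the expression \<open>Q\<close>, in which all denominators are cleared.
  \<open>Q\<close> is continuous up to 0, and each of its terms contains a factor that
  \<open>init\<close> makes vanish there.\<close>

lemma G_zero: assumes r: "r > 0" shows "G r = 0"
proof -
  define Q where "Q r = (exp (g r))\<^sup>2 * (2 * a r * (a r * Y r) - (a r * Y1 r)\<^sup>2 / 2 - 2 * a1 r * Y1 r * (a r * Y r)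
    - 2 * g1 r * (a1 r * Y r * (a r * Y r) + a r * Y1 r * (a r * Y r))
    + (a r * Y r)\<^sup>2 * (2 - (g1 r)\<^sup>2 + k + 2 * g r))" for r
  have QW: "Q x = (W x)\<^sup>2 * G x" if "x > 0" for x
    using a_pos[OF that] Y_pos[OF that] unfolding Q_def W_def G_def xi_def A_def B_def
    by (simp add: field_simps power2_eq_square)
  have Q0: "Q 0 = 0" unfolding Q_def init(1,2,4) by simp
  have "Q r = Q 0"
  proof (rule DERIV_isconst_end[OF r])
    show "continuous_on {0..r} Q" unfolding Q_def[abs_def]
      by (intro continuous_intros continuous_on_subset[OF cont(1)] continuous_on_subset[OF cont(2)]
        continuous_on_subset[OF cont(3)] continuous_on_subset[OF cont(4)] continuous_on_subset[OF cont(5)]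
        continuous_on_subset[OF cont(6)]) auto
    fix x assume x: "0 < x" "x < r"
    have "((\<lambda>x. (W x)\<^sup>2 * G x) has_real_derivative 0) (at x)"
      by (rule derivative_eq_intros dW[OF x(1)] dG[OF x(1)] refl)+ (simp add: power2_eq_square)
    then show "(Q has_real_derivative 0) (at x)"
      by (rule has_field_derivative_transform_within_open[of _ _ _ "{0<..}"]) (use x QW in auto)
  qed
  then show ?thesis using Q0 QW[OF r] W_pos[OF r] by simp
qed

lemma dxi: "r > 0 \<Longrightarrow> (xi has_real_derivative 1 - (A r)\<^sup>2 - 2 * (B r)\<^sup>2) (at r)"
  using dxi_G[of r] G_zero[of r] by simp

lemma dv': assumes "r > 0"
  shows "(v' has_real_derivative (1 + (A r)\<^sup>2 + 2 * (B r)\<^sup>2) * g1 r - xi r * v' r) (at r)"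
  unfolding v'_def[abs_def]
  by (rule derivative_eq_intros dxi[OF assms] dg[OF assms] dg1'[OF assms] refl)+
    (simp add: v'_def algebra_simps)

text \<open>\<open>Z\<close> is \<open>W * v'\<close> with the denominators cleared: continuous up
  to 0, zero there, and with positive derivative afterwards. The identity for \<open>xi'\<close> is
  what removes the terms of unclear sign.\<close>

lemma v'_pos: assumes r: "r > 0" shows "v' r > 0"
proof -
  define Z where "Z r = W r * (k + 2 * g r)
    - g1 r * exp (g r) * (a1 r * Y r + a r * Y1 r + a r * Y r * g1 r)" for r
  have ZW: "Z x = W x * v' x" if "x > 0" for x
    using a_pos[OF that] Y_pos[OF that] unfolding Z_def W_def v'_def xi_def A_def B_def
    by (simp add: field_simps)
  have "Z r > 0"
  proof (rule pos_of_pos_deriv[OF _ _ r])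
    show "continuous_on {0..} Z" unfolding Z_def[abs_def] W_def[abs_def]
      by (intro continuous_intros cont)
    show "Z 0 \<ge> 0" unfolding Z_def W_def init(1) init(4) by simp
    fix x :: real assume x: "x > 0"
    have "((\<lambda>x. W x * v' x) has_real_derivative W x * ((1 + (A x)\<^sup>2 + 2 * (B x)\<^sup>2) * g1 x)) (at x)"
      by (rule derivative_eq_intros dW[OF x] dv'[OF x] refl)+ (simp add: algebra_simps)
    then show "(Z has_real_derivative W x * ((1 + (A x)\<^sup>2 + 2 * (B x)\<^sup>2) * g1 x)) (at x)"
      by (rule has_field_derivative_transform_within_open[of _ _ _ "{0<..}"]) (use x ZW in auto)
    show "W x * ((1 + (A x)\<^sup>2 + 2 * (B x)\<^sup>2) * g1 x) > 0"
      using W_pos[OF x] g1_pos[OF x] by (intro mult_pos_pos add_pos_nonneg) auto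
  qed
  then show ?thesis using ZW[OF r] W_pos[OF r] by (simp add: zero_less_mult_iff)
qed

text \<open>By \<open>dlna\<close> and \<open>dlnb\<close> these are the logarithmic derivatives of \<open>a'\<close> and \<open>b'\<close>.\<close>

definition za where "za r = 1 / A r - xi r + A r"
definition zb where "zb r = (1 + 1 / Y r) / B r - xi r + B r"

lemma dza: assumes r: "r > 0" shows "(za has_real_derivative 2 * (B r)\<^sup>2 - (1 / A r - A r) * za r) (at r)"
proof -
  have *: "(za has_real_derivative - (1 - xi r * A r) / (A r * A r) - (1 - (A r)\<^sup>2 - 2 * (B r)\<^sup>2) + (1 - xi r * A r)) (at r)"
  proof -
    have "((\<lambda>r. 1 / A r) has_real_derivative - (1 - xi r * A r) / (A r * A r)) (at r)"
      by (rule derivative_eq_intros dA[OF r] refl)+ (use A_pos[OF r] in auto)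
    from DERIV_add[OF DERIV_diff[OF this dxi[OF r]] dA[OF r]] show ?thesis
      by (simp add: za_def[abs_def])
  qed
  show ?thesis
    by (rule DERIV_cong[OF *]) (use A_pos[OF r] in \<open>simp add: za_def field_simps power2_eq_square\<close>)
qed

lemma dzb: assumes r: "r > 0"
  shows "(zb has_real_derivative ((A r)\<^sup>2 + (B r)\<^sup>2 - 1 / Y r) - ((1 + 1 / Y r) / B r - B r) * zb r) (at r)"
proof -
  have dY': "((\<lambda>r. 1 + 1 / Y r) has_real_derivative - 2 * B r / Y r) (at r)"
    by (rule derivative_eq_intros dY[OF r] refl)+ (use Y_pos[OF r] in \<open>auto simp: Y1_B[OF r]\<close>)
  have *: "(zb has_real_derivative ((- 2 * B r / Y r) * B r - (1 + 1 / Y r) * (1 + 1 / Y r - xi r * B r)) / (B r * B r)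
     - (1 - (A r)\<^sup>2 - 2 * (B r)\<^sup>2) + (1 + 1 / Y r - xi r * B r)) (at r)"
    using DERIV_add[OF DERIV_diff[OF DERIV_divide[OF dY' dB[OF r]] dxi[OF r]] dB[OF r]] B_pos[OF r]
    by (simp add: zb_def[abs_def])
  show ?thesis
    by (rule DERIV_cong[OF *]) (use B_pos[OF r] Y_pos[OF r] in \<open>simp add: zb_def field_simps power2_eq_square\<close>)
qed

lemma dlna: assumes r: "r > 0" shows "((\<lambda>r. ln (a1 r)) has_real_derivative za r) (at r)"
proof -
  have *: "((\<lambda>r. ln (a1 r)) has_real_derivative 1 / a1 r * (a r - a1 r * (Y1 r / Y r + g1 r))) (at r)"
    using DERIV_chain'[OF da1[OF r] DERIV_ln_divide[OF a1_pos[OF r]]] by simp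
  show ?thesis
    by (rule DERIV_cong[OF *]) (use a_pos[OF r] Y_pos[OF r] A_pos[OF r] in
      \<open>simp add: za_def xi_def Y1_B[OF r] a1_A[OF r] field_simps\<close>)
qed

definition b1 where "b1 r = Y1 r / (2 * sqrt (Y r))"

lemma b1_pos: "r > 0 \<Longrightarrow> b1 r > 0"
  using Y1_pos[of r] Y_pos[of r] by (simp add: b1_def)

lemma dlnb: assumes r: "r > 0" shows "((\<lambda>r. ln (b1 r)) has_real_derivative zb r) (at r)"
proof -
  have 1: "((\<lambda>r. ln (Y1 r)) has_real_derivative 1 / Y1 r * (2 + 2 * Y r - Y1 r * (a1 r / a r + g1 r))) (at r)"
    using DERIV_chain'[OF dY1[OF r] DERIV_ln_divide[OF Y1_pos[OF r]]] by simp
  have 2: "((\<lambda>r. ln (Y r)) has_real_derivative 1 / Y r * Y1 r) (at r)"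
    using DERIV_chain'[OF dY[OF r] DERIV_ln_divide[OF Y_pos[OF r]]] by simp
  have *: "((\<lambda>r. ln (Y1 r) - ln 2 - (1 / 2) * ln (Y r)) has_real_derivative
      1 / Y1 r * (2 + 2 * Y r - Y1 r * (a1 r / a r + g1 r)) - 0 - (1 / 2) * (1 / Y r * Y1 r)) (at r)"
    by (intro DERIV_diff DERIV_cmult 1 2 DERIV_const)
  have "((\<lambda>r. ln (Y1 r) - ln 2 - (1 / 2) * ln (Y r)) has_real_derivative zb r) (at r)"
    by (rule DERIV_cong[OF *]) (use a_pos[OF r] Y_pos[OF r] B_pos[OF r] in
      \<open>simp add: zb_def xi_def Y1_B[OF r] a1_A[OF r] field_simps\<close>)
  moreover have "ln (Y1 x) - ln 2 - (1 / 2) * ln (Y x) = ln (b1 x)" if "x > 0" for x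
    using Y1_pos[OF that] Y_pos[OF that] by (simp add: b1_def ln_div ln_mult ln_sqrt)
  ultimately show ?thesis
    using has_field_derivative_transform_within_open[of
        "\<lambda>r. ln (Y1 r) - ln 2 - (1 / 2) * ln (Y r)" "zb r" r "{0<..}" "\<lambda>r. ln (b1 r)"] r by simp
qed

section \<open>Asymptotics with constants that depend on \<open>M\<close> only\<close>

text \<open>The whole interface between a solution and its asymptotic constants. The six
  inequalities involve values at r = 1 only, so their strict versions persist under small changes of
  the parameter.\<close>

definition bounded_at_1 :: "real \<Rightarrow> bool" where
  "bounded_at_1 M \<longleftrightarrow> A 1 \<le> M \<and> B 1 \<le> M \<and> 1 / Y 1 \<le> M \<and> xi 1 \<le> M \<and> 1 / M \<le> g1 1 \<and> 1 / M \<le> v' 1"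

context
  fixes M :: real
  assumes M: "M \<ge> 1" and bd: "bounded_at_1 M"
begin

lemma bd': "A 1 \<le> M" "B 1 \<le> M" "1 / Y 1 \<le> M" "xi 1 \<le> M" "1 / M \<le> g1 1" "1 / M \<le> v' 1"
  using bd by (auto simp: bounded_at_1_def)

lemma xi_ge: "r > 0 \<Longrightarrow> xi r \<ge> A r" "r > 0 \<Longrightarrow> xi r \<ge> 2 * B r" "r > 0 \<Longrightarrow> xi r \<ge> g1 r"
  using A_pos[of r] B_pos[of r] g1_pos[of r] by (auto simp: xi_def)

lemma A_le: assumes "r \<ge> 1" shows "A r \<le> M"
proof -
  have "A r - M \<le> 0"
  proof (rule barrier[of 1 r "\<lambda>x. A x - M" "\<lambda>x. 1 - xi x * A x"])
    fix x :: real assume x: "x \<ge> 1"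
    then show "((\<lambda>x. A x - M) has_real_derivative 1 - xi x * A x) (at x)"
      using DERIV_diff[OF dA DERIV_const[of M], of x] by simp
    \<comment> \<open>Above the level M >= 1 the damping \<open>xi A >= A^2\<close> exceeds the
      source 1.\<close>
    assume p: "A x - M > 0"
    have "1 * 1 \<le> A x * A x" using p M by (intro mult_mono) auto
    also have "\<dots> \<le> xi x * A x" using x p M by (intro mult_right_mono xi_ge) auto
    finally show "1 - xi x * A x \<le> 0" by simp
  qed (use bd' assms in auto)
  then show ?thesis by simp
qed

lemma Y_mono: assumes "1 \<le> x" "x \<le> y" shows "Y x \<le> Y y"
  by (rule DERIV_nonneg_imp_nondecreasing[OF assms(2)])
    (use assms dY Y1_pos in \<open>meson less_eq_real_def less_le_trans order_trans zero_less_one\<close>)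

lemma iY_le: assumes "r \<ge> 1" shows "1 / Y r \<le> M"
  using divide_left_mono[OF Y_mono[of 1 r], of 1] assms bd'(3) Y_pos[of 1] Y_pos[of r] by simp

lemma B_le: assumes "r \<ge> 1" shows "B r \<le> M + 1"
proof -
  have "B r - (M + 1) \<le> 0"
  proof (rule barrier[of 1 r "\<lambda>x. B x - (M + 1)" "\<lambda>x. 1 + 1 / Y x - xi x * B x"])
    fix x :: real assume x: "x \<ge> 1"
    then show "((\<lambda>x. B x - (M + 1)) has_real_derivative 1 + 1 / Y x - xi x * B x) (at x)"
      using DERIV_diff[OF dB DERIV_const[of "M + 1"], of x] by simp
    \<comment> \<open>Here \<open>xi B >= 2 B^2\<close> beats the source \<open>1 + 1 / Y\<close>,
      which is at most M + 1.\<close>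
    assume p: "B x - (M + 1) > 0"
    have "(M + 1) * 1 \<le> (2 * B x) * B x" using p M by (intro mult_mono) auto
    also have "\<dots> \<le> xi x * B x" using x p M by (intro mult_right_mono xi_ge) auto
    finally show "1 + 1 / Y x - xi x * B x \<le> 0" using iY_le[OF x] by simp
  qed (use bd' assms in auto)
  then show ?thesis by simp
qed

lemma xi_le: assumes "r \<ge> 1" shows "xi r \<le> M + r"
proof -
  have "xi r - r \<le> xi 1 - 1"
  proof (rule DERIV_nonpos_imp_nonincreasing[OF assms], intro exI conjI)
    fix x :: real assume x: "1 \<le> x" "x \<le> r"
    show "((\<lambda>x. xi x - x) has_real_derivative (1 - (A x)\<^sup>2 - 2 * (B x)\<^sup>2) - 1) (at x)"
      using x by (intro DERIV_diff dxi DERIV_ident) auto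
    show "(1 - (A x)\<^sup>2 - 2 * (B x)\<^sup>2) - 1 \<le> 0"
      using zero_le_power2[of "A x"] zero_le_power2[of "B x"] by linarith
  qed
  then show ?thesis using bd' by simp
qed

text \<open>The solution of \<open>(3 M + 2) dl = (1 - dl) / M\<close>. Since
  \<open>xi <= g1 + 3 M + 2\<close> and \<open>g1 >= 1 / M\<close>, this choice gives
  \<open>xi * dl <= g1\<close>.\<close>

definition dl where "dl = 1 / (1 + M * (3 * M + 2))"

lemma dl: "0 < dl" "dl \<le> 1 / M"
proof -
  have "M * 1 \<le> M * (3 * M + 2)" using M by (intro mult_left_mono) auto
  then have "M \<le> 1 + M * (3 * M + 2)" "0 < 1 + M * (3 * M + 2)" using M by linarith+
  then show "0 < dl" "dl \<le> 1 / M" using M unfolding dl_def by (simp, intro divide_left_mono) auto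
qed

lemma g1_ge1: assumes "r \<ge> 1" shows "g1 r \<ge> 1 / M"
proof -
  have "g1 1 \<le> g1 r"
  proof (rule DERIV_nonneg_imp_nondecreasing[OF assms], intro exI conjI)
    fix x :: real assume x: "1 \<le> x" "x \<le> r"
    show "(g1 has_real_derivative v' x) (at x)" "v' x \<ge> 0"
      using x by (auto intro!: dg1' v'_pos less_imp_le)
  qed
  then show ?thesis using bd' by simp
qed

text \<open>Where \<open>v' < dl\<close>, the damping \<open>xi v'\<close> is at most
  \<open>g1\<close> while the source is at least \<open>g1\<close>, so \<open>v'\<close> cannot sink
  through \<open>dl\<close>.\<close>

lemma v'_ge: assumes "r \<ge> 1" shows "v' r \<ge> dl"
proof -
  have "dl - v' r \<le> 0"
  proof (rule barrier[of 1 r "\<lambda>x. dl - v' x" "\<lambda>x. - ((1 + (A x)\<^sup>2 + 2 * (B x)\<^sup>2) * g1 x - xi x * v' x)"])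
    fix x :: real assume x: "x \<ge> 1"
    then show "((\<lambda>x. dl - v' x) has_real_derivative - ((1 + (A x)\<^sup>2 + 2 * (B x)\<^sup>2) * g1 x - xi x * v' x)) (at x)"
      using DERIV_diff[OF DERIV_const[of dl] dv', of x] by simp
    assume p: "dl - v' x > 0"
    have x0: "x > 0" using x by simp
    have "xi x * v' x \<le> (g1 x + (3 * M + 2)) * dl"
      using p v'_pos[OF x0] A_le[OF x] B_le[OF x] g1_pos[OF x0] M
      by (intro mult_mono) (auto simp: xi_def)
    also have "\<dots> = g1 x * dl + (3 * M + 2) * dl" by (simp add: distrib_right)
    also have "(3 * M + 2) * dl = (1 / M) * (1 - dl)"
    proof -
      have "1 - dl = M * (3 * M + 2) * dl"
        using M unfolding dl_def by (simp add: field_simps add_pos_nonneg less_imp_neq[symmetric] add_nonneg_eq_0_iff)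
      then show ?thesis using M by simp
    qed
    also have "\<dots> \<le> g1 x * (1 - dl)"
      using g1_ge1[OF x] dl M by (intro mult_right_mono) (auto intro: order_trans[OF dl(2)])
    also have "g1 x * dl + g1 x * (1 - dl) = 1 * g1 x" by (simp add: algebra_simps)
    also have "\<dots> \<le> (1 + (A x)\<^sup>2 + 2 * (B x)\<^sup>2) * g1 x"
      using g1_pos[OF x0] by (intro mult_right_mono) auto
    finally show "- ((1 + (A x)\<^sup>2 + 2 * (B x)\<^sup>2) * g1 x - xi x * v' x) \<le> 0" by simp
  qed (use bd' dl assms in auto)
  then show ?thesis by simp
qed

lemma g1_ge: assumes "r \<ge> 1" shows "g1 r \<ge> dl * r"
proof -
  have "g1 1 - dl * 1 \<le> g1 r - dl * r"
  proof (rule DERIV_nonneg_imp_nondecreasing[OF assms], intro exI conjI)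
    fix x :: real assume x: "1 \<le> x" "x \<le> r"
    show "((\<lambda>r. g1 r - dl * r) has_real_derivative v' x - dl * 1) (at x)"
      using x by (intro DERIV_diff dg1' DERIV_cmult DERIV_ident) auto
    show "v' x - dl * 1 \<ge> 0" using v'_ge x by simp
  qed
  then show ?thesis using bd' dl by simp
qed

text \<open>From \<open>r2\<close> on, \<open>dl * x >= 2\<close>, so the slope
  \<open>K1 / x^2\<close> of the barrier uses up at most half of the damping \<open>dl * K1\<close>.
  In \<open>K1\<close> the first summand covers the starting value at \<open>r2\<close>, the second
  makes the other half of the damping absorb the source.\<close>

definition r2 where "r2 = 1 + 2 / dl"
definition K1 where "K1 = (M + 1) * r2 + 2 * (M + 1) / dl"

lemma r2: "r2 \<ge> 1" using dl by (simp add: r2_def)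

text \<open>Since \<open>\<xi> \<ge> dl * r\<close>, the function \<open>K1 / r\<close> is a supersolution of \<open>h' = q - \<xi> h\<close>.\<close>

lemma inverse_decay:
  assumes r: "r \<ge> r2" and h: "\<And>x. x \<ge> 1 \<Longrightarrow> (h has_real_derivative q x - xi x * h x) (at x)"
    and q: "\<And>x. x \<ge> 1 \<Longrightarrow> q x \<le> M + 1" and h1: "h r2 \<le> M + 1"
  shows "h r \<le> K1 / r"
proof -
  have K1: "K1 \<ge> (M + 1) * r2" "K1 \<ge> 2 * (M + 1) / dl" "K1 \<ge> 0"
    using M dl r2 by (auto simp: K1_def intro!: add_nonneg_nonneg mult_nonneg_nonneg divide_nonneg_nonneg)
  have "h r - K1 / r \<le> 0"
  proof (rule barrier[OF r, of "\<lambda>x. h x - K1 / x" "\<lambda>x. q x - xi x * h x + K1 / x\<^sup>2"])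
    have "(M + 1) * r2 / r2 \<le> K1 / r2" using K1(1) r2 by (intro divide_right_mono) auto
    then show "h r2 - K1 / r2 \<le> 0" using h1 r2 by simp
    fix x assume x: "x \<ge> r2"
    then have x1: "x \<ge> 1" using r2 by simp
    show "((\<lambda>x. h x - K1 / x) has_real_derivative q x - xi x * h x + K1 / x\<^sup>2) (at x)"
      by (rule h[OF x1] derivative_eq_intros refl)+ (use x1 in \<open>auto simp: power2_eq_square\<close>)
    assume p: "h x - K1 / x > 0"
    have "dl * K1 = dl * x * (K1 / x)" using x1 by simp
    also have "\<dots> \<le> xi x * h x"
    proof (rule mult_mono)
      show "dl * x \<le> xi x" using x1 g1_ge[OF x1] xi_ge(3)[of x] by simp
      then show "0 \<le> xi x" using x1 dl mult_nonneg_nonneg[of dl x] by linarith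
    qed (use p x1 K1 in auto)
    finally have 1: "dl * K1 \<le> xi x * h x" .

    have "2 / dl \<le> x" using x by (simp add: r2_def)
    then have "2 \<le> dl * x" using dl by (simp add: field_simps)
    also have "\<dots> \<le> dl * x\<^sup>2" using dl x1 by (intro mult_left_mono) (auto simp: power2_eq_square)
    finally have "2 * K1 \<le> dl * x\<^sup>2 * K1" using K1 by (intro mult_right_mono)
    then have 2: "K1 / x\<^sup>2 \<le> dl * K1 / 2" using x1 by (simp add: field_simps)
    have 3: "M + 1 \<le> dl * K1 / 2" using K1(2) dl by (simp add: field_simps)
    show "q x - xi x * h x + K1 / x\<^sup>2 \<le> 0" using 1 2 3 q[OF x1] by linarith
  qed
  then show ?thesis by simp
qed

lemma A_decay: assumes "r \<ge> r2" shows "A r \<le> K1 / r"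
  by (rule inverse_decay[OF assms, of A "\<lambda>_. 1"]) (use dA A_le[OF r2] M in auto)

lemma B_decay: assumes "r \<ge> r2" shows "B r \<le> K1 / r"
  by (rule inverse_decay[OF assms, of B "\<lambda>x. 1 + 1 / Y x"]) (use dB B_le[OF r2] iY_le in auto)

text \<open>With s = M + x, \<open>1 / s\<close> balances the source against the largest possible
  damping \<open>xi <= s\<close>. The correction \<open>(M + 1) / s^2\<close> makes the comparison
  function vanish at x = 1, and it leaves a surplus \<open>(M + 1) / s\<close> that pays for the
  correction's own derivative.\<close>

lemma lower_decay:
  assumes r: "r \<ge> 1" and h: "\<And>x. x \<ge> 1 \<Longrightarrow> (h has_real_derivative q x - xi x * h x) (at x)"
    and q: "\<And>x. x \<ge> 1 \<Longrightarrow> q x \<ge> 1" and h0: "\<And>x. x \<ge> 1 \<Longrightarrow> h x > 0"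
  shows "h r \<ge> 1 / (M + r) - (M + 1) / (M + r)\<^sup>2"
proof -
  have "1 / (M + r) - (M + 1) / (M + r)\<^sup>2 - h r \<le> 0"
  proof (rule barrier[OF r, of "\<lambda>x. 1 / (M + x) - (M + 1) / (M + x)\<^sup>2 - h x"
        "\<lambda>x. - 1 / (M + x)\<^sup>2 + 2 * (M + 1) / (M + x) ^ 3 - (q x - xi x * h x)"])
    have "1 / (M + 1) - (M + 1) / (M + 1)\<^sup>2 = 0" using M by (simp add: power2_eq_square)
    then show "1 / (M + 1) - (M + 1) / (M + 1)\<^sup>2 - h 1 \<le> 0" using h0[of 1] by simp
    fix x :: real assume x: "x \<ge> 1"
    define s where "s = M + x"
    have s: "s \<ge> 2" using x M by (simp add: s_def)
    have "((\<lambda>x. 1 / (M + x) - (M + 1) / (M + x)\<^sup>2) has_real_derivative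
        - 1 / (M + x)\<^sup>2 + 2 * (M + 1) / (M + x) ^ 3) (at x)"
      using s DERIV_diff[OF deriv_shifted_inverse(1)[of M x] deriv_shifted_inverse(2)[of M x "M + 1"]]
      unfolding s_def by simp
    from DERIV_diff[OF this h[OF x]]
    show "((\<lambda>x. 1 / (M + x) - (M + 1) / (M + x)\<^sup>2 - h x) has_real_derivative
        - 1 / (M + x)\<^sup>2 + 2 * (M + 1) / (M + x) ^ 3 - (q x - xi x * h x)) (at x)" .
    assume "1 / (M + x) - (M + 1) / (M + x)\<^sup>2 - h x > 0"
    then have p: "h x \<le> 1 / s - (M + 1) / s\<^sup>2" by (simp add: s_def)
    have "xi x * h x \<le> s * (1 / s - (M + 1) / s\<^sup>2)"
      using p xi_le[OF x] h0[OF x] s by (intro mult_mono) (auto simp: s_def)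
    also have "\<dots> = 1 - (M + 1) / s" using s by (simp add: field_simps power2_eq_square)
    finally have 1: "(M + 1) / s \<le> q x - xi x * h x" using q[OF x] by linarith
    have "2 * (M + 1) / s ^ 3 = (2 / (s * s)) * ((M + 1) / s)" by (simp add: power3_eq_cube)
    also have "\<dots> \<le> 1 * ((M + 1) / s)"
    proof (intro mult_right_mono)
      have "2 * 1 \<le> s * s" using s by (intro mult_mono) auto
      then show "2 / (s * s) \<le> 1" using s by simp
    qed (use s M in auto)
    finally have 2: "2 * (M + 1) / s ^ 3 \<le> (M + 1) / s" by simp
    have "1 / s\<^sup>2 \<ge> 0" by simp
    with 1 2 have "- (1 / s\<^sup>2) + 2 * (M + 1) / s ^ 3 - (q x - xi x * h x) \<le> 0" by linarith
    then show "- 1 / (M + x)\<^sup>2 + 2 * (M + 1) / (M + x) ^ 3 - (q x - xi x * h x) \<le> 0"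
      by (simp add: s_def)
  qed
  then show ?thesis by simp
qed

lemma A_lower: assumes "r \<ge> 1" shows "A r \<ge> 1 / (M + r) - (M + 1) / (M + r)\<^sup>2"
  by (rule lower_decay[OF assms, of A "\<lambda>_. 1"]) (use dA A_pos in auto)

lemma B_lower: assumes "r \<ge> 1" shows "B r \<ge> 1 / (M + r) - (M + 1) / (M + r)\<^sup>2"
  by (rule lower_decay[OF assms, of B "\<lambda>x. 1 + 1 / Y x"]) (use dB B_pos Y_pos in \<open>auto simp: less_imp_le\<close>)

definition K2 where "K2 = M * (M + 1)\<^sup>2 * exp 2"

text \<open>Integrates the lower bound for \<open>B = Y' / (2 Y)\<close>: it says that
  \<open>E\<close>, which is Y divided by \<open>s^2 exp (2 (M + 1) / s)\<close> with s = M + x, is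
  nondecreasing. The constant \<open>K2\<close> is read off from \<open>E 1\<close> and
  \<open>Y 1 >= 1 / M\<close>. The result turns the term \<open>1 / Y\<close> in the equation for
  \<open>zb\<close> into O(1/r^2).\<close>

lemma Y_growth: assumes r: "r \<ge> 1" shows "1 / Y r \<le> K2 / r\<^sup>2"
proof -
  define E where "E x = Y x * (inverse (M + x))\<^sup>2 * exp (- (2 * (M + 1) * inverse (M + x)))" for x
  have "E 1 \<le> E r"
  proof (rule DERIV_nonneg_imp_nondecreasing[OF r], intro exI conjI)
    fix x :: real assume x: "1 \<le> x" "x \<le> r"
    define s where "s = M + x"
    have s: "s > 0" "M + x > 0" using x M by (auto simp: s_def)
    have x0: "x > 0" using x by simp
    have i: "((\<lambda>x. inverse (M + x)) has_real_derivative - (inverse s * inverse s)) (at x)"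
      using s by (auto intro!: derivative_eq_intros simp: s_def)
    show "(E has_real_derivative 2 * E x * (B x - inverse s + (M + 1) * (inverse s)\<^sup>2)) (at x)"
      unfolding E_def[abs_def] s_def
      by (rule derivative_eq_intros dY[OF x0] i[unfolded s_def] refl)+
        (simp add: Y1_B[OF x0] algebra_simps power2_eq_square)
    have "B x - inverse s + (M + 1) * (inverse s)\<^sup>2 \<ge> 0"
      using B_lower[OF x(1)] by (simp add: s_def divide_inverse power_inverse)
    then show "2 * E x * (B x - inverse s + (M + 1) * (inverse s)\<^sup>2) \<ge> 0"
      using Y_pos[OF x0] by (auto simp: E_def intro!: mult_nonneg_nonneg)
  qed
  moreover have "E r \<le> Y r * (inverse (M + r))\<^sup>2 * 1"
    unfolding E_def using r M Y_pos[of r] by (intro mult_left_mono) auto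
  moreover have "E 1 = Y 1 * (inverse (M + 1))\<^sup>2 * exp (- 2)"
  proof -
    have "2 * (M + 1) * inverse (M + 1) = 2" using M by (simp add: field_simps)
    then show ?thesis unfolding E_def by (simp only:)
  qed
  moreover have "(inverse M) * ((inverse (M + 1))\<^sup>2 * exp (- 2)) \<le> Y 1 * ((inverse (M + 1))\<^sup>2 * exp (- 2))"
    using bd'(3) M Y_pos[of 1] by (intro mult_right_mono) (auto simp: field_simps)
  ultimately have "inverse K2 \<le> Y r * (inverse (M + r))\<^sup>2"
    by (simp add: K2_def exp_minus power_inverse mult.assoc)
  also have "\<dots> \<le> Y r * (inverse r)\<^sup>2"
    using r M Y_pos[of r] by (intro mult_left_mono power_mono le_imp_inverse_le) auto
  finally have *: "inverse K2 \<le> Y r * (inverse r)\<^sup>2" .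
  have "K2 > 0" using M by (simp add: K2_def)
  with * r Y_pos[of r] show ?thesis by (simp add: field_simps)
qed

text \<open>At \<open>RR\<close> the decay estimates are valid, \<open>K1 / r\<close> has dropped to
  1/2 and \<open>tail_bound\<close> applies. \<open>Z0\<close> bounds \<open>za\<close> and
  \<open>zb\<close> there, one summand for each of their three terms; \<open>K3\<close> combines
  four times the forcing constant with the starting value. These constants depend on
  \<open>M\<close> alone.\<close>

definition RR where "RR = max 4 (max (2 * K1) r2)"
definition Z0 where "Z0 = (M + 1) * (M + RR)\<^sup>2 + (M + RR) + (M + 1)"
definition K3 where "K3 = 4 * (3 * K1\<^sup>2 + K2) + Z0 * RR\<^sup>2"

lemma RR: "RR \<ge> 4" "RR \<ge> 2 * K1" "RR \<ge> r2" "RR \<ge> 1" "r \<ge> RR \<Longrightarrow> r \<ge> 1"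
  by (auto simp: RR_def)

lemma K12: "K1 \<ge> 0" "K2 \<ge> 0"
  using M dl r2 by (auto simp: K1_def K2_def intro!: add_nonneg_nonneg mult_nonneg_nonneg divide_nonneg_nonneg)

lemma small:
  assumes r: "r \<ge> RR"
  shows "A r \<le> 1 / 2" "B r \<le> 1 / 2" "(A r)\<^sup>2 \<le> K1\<^sup>2 / r\<^sup>2" "(B r)\<^sup>2 \<le> K1\<^sup>2 / r\<^sup>2"
proof -
  have r': "r \<ge> r2" "r \<ge> 2 * K1" "r > 0" using r RR by auto
  have "K1 / r \<le> 1 / 2" using r' by (simp add: field_simps)
  then show "A r \<le> 1 / 2" "B r \<le> 1 / 2" using A_decay[OF r'(1)] B_decay[OF r'(1)] by linarith+
  show "(A r)\<^sup>2 \<le> K1\<^sup>2 / r\<^sup>2" "(B r)\<^sup>2 \<le> K1\<^sup>2 / r\<^sup>2"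
    using power_mono[OF A_decay[OF r'(1)], of 2] power_mono[OF B_decay[OF r'(1)], of 2]
      A_pos[OF r'(3)] B_pos[OF r'(3)] by (auto simp: power_divide)
qed

text \<open>Provides the damping coefficient at least 1 in the equations for \<open>za\<close> (q =
  1) and \<open>zb\<close> (q = 1 + 1 / Y).\<close>

lemma inv_minus_ge1: "0 < x \<Longrightarrow> x \<le> 1 / 2 \<Longrightarrow> q \<ge> 1 \<Longrightarrow> q / x - x \<ge> (1::real)"
proof -
  assume x: "0 < x" "x \<le> 1 / 2" "q \<ge> 1"
  have "2 * x \<le> q" using x by simp
  then have "2 \<le> q / x" using x by (simp add: field_simps)
  then show ?thesis using x by simp
qed

text \<open>The lower bound for h equals \<open>(RR - 1) / (M + RR)^2\<close>, which is positive
  because \<open>RR >= 4\<close>.\<close>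

lemma inv_bound:
  assumes h: "h \<ge> 1 / (M + RR) - (M + 1) / (M + RR)\<^sup>2" and q: "0 \<le> q" "q \<le> M + 1"
  shows "q / h \<le> (M + 1) * (M + RR)\<^sup>2"
proof -
  have s: "M + RR > 0" using M RR by simp
  have "1 / (M + RR)\<^sup>2 \<le> (RR - 1) / (M + RR)\<^sup>2" using RR by (intro divide_right_mono) auto
  also have "\<dots> = (M + RR) / (M + RR)\<^sup>2 - (M + 1) / (M + RR)\<^sup>2"
    unfolding diff_divide_distrib[symmetric] by simp
  also have "(M + RR) / (M + RR)\<^sup>2 = 1 / (M + RR)" using s by (simp add: power2_eq_square)
  finally have h': "1 / (M + RR)\<^sup>2 \<le> h" using h by linarith
  have "q / h \<le> (M + 1) / (1 / (M + RR)\<^sup>2)" using h' q s by (intro frac_le) auto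
  then show ?thesis by simp
qed

lemma za_zb_RR: "\<bar>za RR\<bar> \<le> Z0" "\<bar>zb RR\<bar> \<le> Z0"
proof -
  have R0: "RR > 0" using RR by simp
  note b = A_le[OF RR(4)] B_le[OF RR(4)] xi_le[OF RR(4)] A_pos[OF R0] B_pos[OF R0] iY_le[OF RR(4)]
    Y_pos[OF R0] g1_pos[OF R0]
  have x0: "xi RR \<ge> 0" using b by (simp add: xi_def)
  have "1 / A RR \<le> (M + 1) * (M + RR)\<^sup>2" by (rule inv_bound[OF A_lower[OF RR(4)]]) (use M in auto)
  moreover have "1 / A RR \<ge> 0" using b by simp
  ultimately show "\<bar>za RR\<bar> \<le> Z0" unfolding za_def Z0_def using b x0 M by linarith
  have "(1 + 1 / Y RR) / B RR \<le> (M + 1) * (M + RR)\<^sup>2"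
    by (rule inv_bound[OF B_lower[OF RR(4)]]) (use b in auto)
  moreover have "(1 + 1 / Y RR) / B RR \<ge> 0" using b by simp
  ultimately show "\<bar>zb RR\<bar> \<le> Z0" unfolding zb_def Z0_def using b x0 M by linarith
qed

lemma K3_start: "\<bar>z\<bar> \<le> Z0 \<Longrightarrow> \<bar>z\<bar> \<le> K3 / RR\<^sup>2"
proof -
  assume z: "\<bar>z\<bar> \<le> Z0"
  have "Z0 * RR\<^sup>2 / RR\<^sup>2 \<le> K3 / RR\<^sup>2" using K12 by (intro divide_right_mono) (auto simp: K3_def)
  then show ?thesis using z RR by simp
qed

lemma K3_ge: "K3 \<ge> 4 * (3 * K1\<^sup>2 + K2)" "K3 \<ge> 0"
proof -
  have "Z0 \<ge> 0" using za_zb_RR(1) by linarith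
  then show "K3 \<ge> 4 * (3 * K1\<^sup>2 + K2)" "K3 \<ge> 0" using K12 by (auto simp: K3_def)
qed

lemma za_decay: assumes "r \<ge> RR" shows "\<bar>za r\<bar> \<le> K3 / r\<^sup>2"
proof (rule tail_bound[where z = za and F = "\<lambda>x. 2 * (B x)\<^sup>2" and c = "\<lambda>x. 1 / A x - A x",
      OF RR(1) assms K3_ge(1) K3_start[OF za_zb_RR(1)]])
  fix x assume x: "x \<ge> RR"
  then have x0: "x > 0" using RR(5)[OF x] by simp
  show "(za has_real_derivative 2 * (B x)\<^sup>2 - (1 / A x - A x) * za x) (at x)" by (rule dza[OF x0])
  show "1 / A x - A x \<ge> 1" by (rule inv_minus_ge1) (use small[OF x] A_pos[OF x0] in auto)
  have "2 * (B x)\<^sup>2 \<le> 2 * (K1\<^sup>2 / x\<^sup>2)" using small[OF x] by simp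
  also have "\<dots> \<le> (3 * K1\<^sup>2 + K2) / x\<^sup>2" using K12 by (simp add: divide_right_mono)
  finally show "\<bar>2 * (B x)\<^sup>2\<bar> \<le> (3 * K1\<^sup>2 + K2) / x\<^sup>2" by simp
qed

lemma zb_decay: assumes "r \<ge> RR" shows "\<bar>zb r\<bar> \<le> K3 / r\<^sup>2"
proof (rule tail_bound[where z = zb and F = "\<lambda>x. (A x)\<^sup>2 + (B x)\<^sup>2 - 1 / Y x"
      and c = "\<lambda>x. (1 + 1 / Y x) / B x - B x",
      OF RR(1) assms K3_ge(1) K3_start[OF za_zb_RR(2)]])
  fix x assume x: "x \<ge> RR"
  then have x0: "x > 0" using RR(5)[OF x] by simp
  show "(zb has_real_derivative ((A x)\<^sup>2 + (B x)\<^sup>2 - 1 / Y x) - ((1 + 1 / Y x) / B x - B x) * zb x) (at x)"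
    by (rule dzb[OF x0])
  show "(1 + 1 / Y x) / B x - B x \<ge> 1"
    by (rule inv_minus_ge1) (use small[OF x] B_pos[OF x0] Y_pos[OF x0] in auto)
  have iY: "0 \<le> 1 / Y x" "1 / Y x \<le> K2 / x\<^sup>2" using Y_pos[OF x0] Y_growth[OF RR(5)[OF x]] by auto
  have "(3 * K1\<^sup>2 + K2) / x\<^sup>2 = K1\<^sup>2 / x\<^sup>2 + K1\<^sup>2 / x\<^sup>2 + K1\<^sup>2 / x\<^sup>2 + K2 / x\<^sup>2"
    by (simp add: add_divide_distrib)
  moreover have "K1\<^sup>2 / x\<^sup>2 \<ge> 0" by simp
  moreover have "(A x)\<^sup>2 \<ge> 0" "(B x)\<^sup>2 \<ge> 0" by auto
  ultimately show "\<bar>(A x)\<^sup>2 + (B x)\<^sup>2 - 1 / Y x\<bar> \<le> (3 * K1\<^sup>2 + K2) / x\<^sup>2"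
    using small(3,4)[OF x] iY unfolding abs_le_iff by linarith
qed

lemma slopes_limit:
  "\<exists>l. \<forall>r\<ge>RR. \<bar>ln (a1 r) - l\<bar> \<le> K3 / r" "\<exists>l. \<forall>r\<ge>RR. \<bar>ln (b1 r) - l\<bar> \<le> K3 / r"
proof -
  have pos: "RR > 0" "x \<ge> RR \<Longrightarrow> x > 0" for x using RR(1) by auto
  show "\<exists>l. \<forall>r\<ge>RR. \<bar>ln (a1 r) - l\<bar> \<le> K3 / r" "\<exists>l. \<forall>r\<ge>RR. \<bar>ln (b1 r) - l\<bar> \<le> K3 / r"
    by (rule tail_limit[OF pos(1) dlna[OF pos(2)] za_decay], assumption+,
        rule tail_limit[OF pos(1) dlnb[OF pos(2)] zb_decay], assumption+)
qed

end

end

subsection \<open>Averages with monotone weights\<close>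

lemma Av_power:
  "Av n (\<lambda>s. s ^ j * h s) r = r ^ j * Av (n + j) h r"
  unfolding Av_def by (subst integral_mult_right[symmetric], rule integral_cong)
    (simp add: power_mult_distrib power_add)

text \<open>\<open>r^(n+1) * Av n h r\<close> is the integral of a nonnegative function, hence
  monotone. This is how the monotonicity conditions of the invariant set are recovered after a step
  of the iteration.\<close>

lemma Av_star:
  assumes h: "continuous_on {0..} h" "\<And>s. s \<ge> 0 \<Longrightarrow> h s \<ge> 0" and t: "0 \<le> t" "t \<le> 1" and r: "r \<ge> 0"
  shows "t ^ (n + 1) * Av n h (t * r) \<le> Av n h r"
proof (cases "r = 0")
  case True
  have "t ^ (n + 1) \<le> 1" using t by (rule power_le_one)
  moreover have "Av n h 0 \<ge> 0" using h by (intro Av_nonneg) auto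
  ultimately show ?thesis using True mult_right_mono[of "t ^ (n + 1)" 1 "Av n h 0"] by simp
next
  case False
  then have r0: "r > 0" using r by simp
  have c: "continuous_on {0..x} (\<lambda>s. s ^ n * h s)" for x
    by (intro continuous_intros continuous_on_subset[OF h(1)]) auto
  have "integral {0..t * r} (\<lambda>s. s ^ n * h s) \<le> integral {0..r} (\<lambda>s. s ^ n * h s)"
    using t r by (intro integral_subset_le integrable_continuous_real c)
      (auto intro!: mult_left_le_one_le mult_nonneg_nonneg h(2))
  then have "(t * r) ^ (n + 1) * Av n h (t * r) \<le> r ^ (n + 1) * Av n h r"
    using Av_FTC[OF h(1), of "t * r" n] Av_FTC[OF h(1), of r n] t r by simp
  then have "r ^ (n + 1) * (t ^ (n + 1) * Av n h (t * r)) \<le> r ^ (n + 1) * Av n h r"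
    by (simp add: power_mult_distrib ac_simps)
  then show ?thesis using r0 by (simp only: mult_le_cancel_left_pos zero_less_power)
qed

text \<open>The quotient of weights under the integral, \<open>t^n w (t r) / w r\<close>, is at most
  1, so the weight disappears from the estimate.\<close>

lemma Jv_le:
  assumes c: "continuous_on {0..} w" "continuous_on {0..} h" and r: "r \<ge> 0"
    and w: "w r > 0" "\<And>t. 0 \<le> t \<Longrightarrow> t \<le> 1 \<Longrightarrow> t ^ n * w (t * r) \<le> w r"
    and h: "\<And>s. 0 \<le> s \<Longrightarrow> s \<le> r \<Longrightarrow> h s \<ge> 0"
  shows "Jv n w h r \<le> Av 0 h r"
proof -
  have "Av n (\<lambda>s. w s * h s) r \<le> Av 0 (\<lambda>s. w r * h s) r"
    unfolding Av_def
  proof (rule integral_le[OF Av_integrable Av_integrable])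
    fix t :: real assume t: "t \<in> {0..1}"
    then have "h (t * r) \<ge> 0" using r by (intro h) (auto intro: mult_left_le_one_le)
    then show "t ^ n * (w (t * r) * h (t * r)) \<le> t ^ 0 * (w r * h (t * r))"
      using mult_right_mono[OF w(2)[of t], of "h (t * r)"] t by (simp add: mult.assoc)
  qed (use r in \<open>auto intro!: continuous_intros c\<close>)
  also have "Av 0 (\<lambda>s. w r * h s) r = Av 0 h r * w r" unfolding Av_cmult by (rule mult.commute)
  finally have "Av n (\<lambda>s. w s * h s) r \<le> Av 0 h r * w r" .
  then show ?thesis unfolding Jv_def using w(1) by (simp only: pos_divide_le_eq)
qed

lemma continuous_on_Jv:
  assumes "continuous_on {0..} w" "continuous_on {0..} h" "\<And>s. s \<ge> 0 \<Longrightarrow> w s > 0"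
  shows "continuous_on {0..} (Jv n w h)"
  unfolding Jv_def[abs_def] using assms
  by (intro continuous_intros continuous_on_Av) (auto simp: less_imp_neq[symmetric])

lemma jcont_mult: "jcont P h \<Longrightarrow> jcont P k \<Longrightarrow> jcont P (\<lambda>p r. h p r * k p r)"
  and jcont_add: "jcont P h \<Longrightarrow> jcont P k \<Longrightarrow> jcont P (\<lambda>p r. h p r + k p r)"
  and jcont_exp: "jcont P h \<Longrightarrow> jcont P (\<lambda>p r. exp (h p r))"
  and jcont_power: "jcont P h \<Longrightarrow> jcont P (\<lambda>p r. h p r ^ n)"
  and jcont_const: "jcont P (\<lambda>p r. e)"
  and jcont_r: "jcont P (\<lambda>p r. r)"
  unfolding jcont_def by (auto intro!: continuous_intros)

lemma jcont_divide:
  "jcont P h \<Longrightarrow> jcont P k \<Longrightarrow> (\<And>p r. p \<in> P \<Longrightarrow> r \<ge> 0 \<Longrightarrow> k p r \<noteq> 0) \<Longrightarrow> jcont P (\<lambda>p r. h p r / k p r)"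
  unfolding jcont_def by (auto intro!: continuous_intros)

lemma jcont_param: "continuous_on P q \<Longrightarrow> jcont P (\<lambda>p r. q p)"
  unfolding jcont_def by (auto intro!: continuous_on_compose2[of P q] continuous_intros)

lemma jcont_Jv:
  assumes "jcont P w" "jcont P h" "\<And>p r. p \<in> P \<Longrightarrow> r \<ge> 0 \<Longrightarrow> w p r \<noteq> 0"
  shows "jcont P (\<lambda>p r. Jv n (w p) (h p) r)"
  unfolding Jv_def using assms by (intro jcont_divide jcont_Av jcont_mult)

lemma cl_rmult:
  assumes "cl e l T h k" "e \<ge> 0"
  shows "cl (\<bar>T\<bar> * e) l T (\<lambda>r. r * h r) (\<lambda>r. r * k r)"
  unfolding cl_def
proof
  fix r assume r: "r \<in> {0..T}"
  have "\<bar>r * h r - r * k r\<bar> = r * \<bar>h r - k r\<bar>" using r by (simp add: abs_mult right_diff_distrib[symmetric])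
  also have "\<dots> \<le> \<bar>T\<bar> * (e * exp (l * r))" using assms r by (intro mult_mono) (auto simp: cl_def)
  finally show "\<bar>r * h r - r * k r\<bar> \<le> \<bar>T\<bar> * e * exp (l * r)" by simp
qed

subsection \<open>The singular initial value problem as a fixed point problem\<close>

text \<open>Both topologies at once. For \<open>S\<^sup>1 \<times> \<real>\<^sup>3\<close>: \<open>n = 2\<close>, \<open>x = a\<close>, \<open>z = b\<^sup>2 / r\<^sup>2\<close>; for \<open>S\<^sup>2 \<times> \<real>\<^sup>2\<close>: \<open>n = 1\<close>, \<open>x = b\<^sup>2\<close>,
  \<open>z = a / r\<close>. So \<open>r ^ n * z\<close> is the warping function of the collapsing factor; \<open>m = exp g\<close> and \<open>k = (n + 1) * (- f0)\<close>.\<close>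

locale singular_ivp =
  fixes n :: nat and c b t1 t2 :: real
  assumes n: "1 \<le> n" "n \<le> 2" and cb: "0 \<le> c" "c \<le> 1" "0 < b" "b \<le> 2"
    and tt: "t1 = (if n = 2 then 2 else 0)" "t2 = real n - t1"
begin

lemma t: "0 \<le> t1" "0 \<le> t2" "t1 + t2 = real n"
  using tt n by auto

section \<open>The integral operator and its invariant set\<close>

definition kk :: "real \<times> real \<Rightarrow> real" where "kk p = real (n + 1) * snd p"

text \<open>Derivative of the noncollapsing unknown x: with U the collapsing function, it integrates
  \<open>(U e^g x')' = U e^g b (c + x)\<close>. The choice b = 1, c = 0 gives the source a, and b =
  2, c = 1 gives 2 + 2 Y.\<close>

definition x1 :: "state \<Rightarrow> real \<Rightarrow> real" where
  "x1 S r = r * Jv n (\<lambda>s. exp (S Pot s) * S Sing s) (\<lambda>s. b * (c + S Slow s)) r"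

definition g1 :: "real \<times> real \<Rightarrow> state \<Rightarrow> real \<Rightarrow> real" where
  "g1 p S r = r * Jv n (\<lambda>s. S Slow s * exp (S Pot s) * S Sing s) (\<lambda>s. kk p + 2 * S Pot s) r"

text \<open>Integrating \<open>(x e^g U')' = x e^g (t1 + n U)\<close> for \<open>U = r^n z\<close>
  and dividing by \<open>r^(n-1)\<close> gives \<open>x e^g h = num\<close>, where
  \<open>h = U' / r^(n-1)\<close> is regular at 0. Then z is an average of h.\<close>

definition num :: "real \<times> real \<Rightarrow> state \<Rightarrow> real \<Rightarrow> real" where
  "num p S r = t1 * Av 0 (\<lambda>s. S Slow s * exp (S Pot s)) r + t2 * fst p
     + n * (r * (r * Av n (\<lambda>s. S Slow s * exp (S Pot s) * S Sing s) r))"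

definition h :: "real \<times> real \<Rightarrow> state \<Rightarrow> real \<Rightarrow> real" where
  "h p S r = num p S r / (S Slow r * exp (S Pot r))"

text \<open>\<open>Slow\<close> and \<open>Pot\<close> are genuine integrals, with a factor r in
  front; \<open>Sing\<close> is a bare average.\<close>

definition \<Phi> :: "real \<times> real \<Rightarrow> state \<Rightarrow> state" where
  "\<Phi> p S = (\<lambda>i. case i of
      Slow \<Rightarrow> (\<lambda>r. fst p + r * Av 0 (x1 S) r)
    | Pot \<Rightarrow> (\<lambda>r. r * Av 0 (g1 p S) r)
    | Sing \<Rightarrow> Av (n - 1) (h p S))"

text \<open>Positivity is required on the whole half-line because the weights are divided by and
  must stay continuous there; the bounds concern [0, T] only.\<close>

definition adm :: "real \<Rightarrow> real \<Rightarrow> state \<Rightarrow> bool" where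
  "adm B T S \<longleftrightarrow> B \<ge> 1 \<and> (\<forall>s\<ge>0. S Slow s > 0 \<and> S Sing s > 0) \<and>
    (\<forall>s\<in>{0..T}. S Slow s \<in> {1 / B..B} \<and> S Sing s \<in> {1 / B..B} \<and> \<bar>S Pot s\<bar> \<le> B)"

definition start :: "real \<times> real \<Rightarrow> state" where
  "start p = (\<lambda>i. case i of Slow \<Rightarrow> (\<lambda>_. fst p) | Pot \<Rightarrow> (\<lambda>_. 0) | Sing \<Rightarrow> (\<lambda>_. 1))"

text \<open>A lower bound for \<open>fst p / (x e^g)\<close>, obtained by inserting the upper bounds
  of \<open>K_at\<close> for x and g.\<close>

definition low :: "real \<times> real \<Rightarrow> real \<Rightarrow> real" where
  "low p r = fst p / (c + fst p) * exp (- 2 * r - kk p * exp (2 * r) / 2)"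

text \<open>The growth functions reproduce themselves: \<open>c + x\<close> and
  \<open>kk + 2 g\<close> stay below multiples of \<open>exp (2 r)\<close>, whose integral is half
  as large, and \<open>exp (r^2)\<close> satisfies
  \<open>r^2 * Av 1 (exp (s^2)) = (exp (r^2) - 1) / 2\<close>. In the last line \<open>t^n\<close>
  accompanies \<open>Sing\<close> because \<open>r^n z\<close> is the monotone quantity.\<close>

definition K_at :: "real \<times> real \<Rightarrow> state \<Rightarrow> real \<Rightarrow> bool" where
  "K_at p S r \<longleftrightarrow>
     S Slow r \<ge> fst p \<and> c + S Slow r \<le> (c + fst p) * exp (2 * r) \<and>
     S Pot r \<ge> 0 \<and> S Pot r \<le> kk p * (exp (2 * r) - 1) / 2 \<and>
     S Sing r \<ge> low p r \<and> S Sing r \<le> exp (r\<^sup>2) \<and>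
     (\<forall>t\<in>{0..1}. S Slow (t * r) \<le> S Slow r \<and> S Pot (t * r) \<le> S Pot r \<and> t ^ n * S Sing (t * r) \<le> S Sing r)"

text \<open>An invariant set of \<open>\<Phi>\<close>. The monotonicity conditions bound the weights in the averages by \<open>1\<close>, which
  makes the growth bounds reproduce themselves on the whole half-line.\<close>

definition K :: "real \<times> real \<Rightarrow> state \<Rightarrow> bool" where
  "K p S \<longleftrightarrow> (\<forall>r\<ge>0. K_at p S r)"

lemma kk_pos: "p \<in> params \<Longrightarrow> kk p > 0"
  by (auto simp: kk_def params_def)

lemma low_pos: "p \<in> params \<Longrightarrow> low p r > 0"
  using cb by (auto simp: low_def params_def intro!: mult_pos_pos divide_pos_pos add_nonneg_pos)

lemma low_mono: "p \<in> params \<Longrightarrow> s \<le> r \<Longrightarrow> low p r \<le> low p s"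
  unfolding low_def using kk_pos[of p] cb
  by (intro mult_left_mono) (auto simp: params_def intro!: add_mono diff_mono mult_left_mono divide_right_mono
      divide_nonneg_nonneg)

lemma K_pos: "K p S \<Longrightarrow> p \<in> params \<Longrightarrow> r \<ge> 0 \<Longrightarrow> S Slow r > 0 \<and> S Sing r > 0"
  using low_pos[of p r] by (force simp: K_def K_at_def params_def intro: less_le_trans)

lemma adm_bounds:
  assumes "adm B T S" "s \<in> {0..T}"
  shows "B \<ge> 1" "S Slow s \<in> {1 / B..B}" "S Sing s \<in> {1 / B..B}" "\<bar>S Pot s\<bar> \<le> B"
    "exp (S Pot s) \<in> {1 / exp B..exp B}"
proof -
  show 1: "B \<ge> 1" "S Slow s \<in> {1 / B..B}" "S Sing s \<in> {1 / B..B}" "\<bar>S Pot s\<bar> \<le> B"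
    using assms by (auto simp: adm_def)
  have "exp (- B) \<le> exp (S Pot s)" using 1 by simp
  then show "exp (S Pot s) \<in> {1 / exp B..exp B}" using 1 by (auto simp: exp_minus field_simps)
qed

lemma cont_x1: assumes "cont_state S" "\<And>s. s \<ge> 0 \<Longrightarrow> S Slow s > 0 \<and> S Sing s > 0"
  shows "continuous_on {0..} (x1 S)" "continuous_on {0..} (g1 p S)" "continuous_on {0..} (h p S)"
    "continuous_on {0..} (num p S)"
proof -
  have c: "continuous_on {0..} (S i)" for i using assms by (auto simp: cont_state_def)
  show n: "continuous_on {0..} (num p S)"
    unfolding num_def[abs_def] by (intro continuous_intros continuous_on_Av c)
  show "continuous_on {0..} (x1 S)" "continuous_on {0..} (g1 p S)"
    unfolding x1_def[abs_def] g1_def[abs_def]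
    by (intro continuous_intros continuous_on_Jv c; use assms(2) in simp)+
  have "S Slow s * exp (S Pot s) \<noteq> 0" if "s \<ge> 0" for s using assms(2)[OF that] by auto
  then show "continuous_on {0..} (h p S)"
    unfolding h_def[abs_def] by (intro continuous_on_divide n continuous_intros c) auto
qed

section \<open>The contraction estimate\<close>

lemma interval_mult:
  fixes u v U V :: real
  assumes "u \<in> {1 / U..U}" "v \<in> {1 / V..V}" "U > 0" "V > 0"
  shows "u * v \<in> {1 / (U * V)..U * V}"
proof -
  have p: "1 / U > 0" "1 / V > 0" "u \<ge> 1 / U" "v \<ge> 1 / V" using assms by auto
  have uv: "u \<ge> 0" "v \<ge> 0" using p by linarith+
  have "(1 / U) * (1 / V) \<le> u * v" using p uv by (intro mult_mono less_imp_le[OF p(2)]) 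
  moreover have "u * v \<le> U * V" using uv assms by (intro mult_mono) auto
  ultimately show ?thesis by simp
qed

text \<open>\<open>Sing\<close> depends on \<open>Slow\<close> and \<open>Pot\<close> without a
  small factor, but on itself only through an integral. So its weight M is chosen large first, which
  makes the former influence harmless, and then l is chosen large in terms of M, which makes every
  influence through an integral small.\<close>

lemma contract:
  "\<exists>w l. l > 0 \<and> (\<forall>i. w i \<ge> 1) \<and> (\<forall>p\<in>params. \<forall>S S' e. fst p \<le> B \<longrightarrow> snd p \<le> B \<longrightarrow>
        e \<ge> 0 \<longrightarrow> cont_state S \<longrightarrow> cont_state S' \<longrightarrow> adm B T S \<longrightarrow> adm B T S' \<longrightarrow>
        near w e l T S S' \<longrightarrow> near w (e / 2) l T (\<Phi> p S) (\<Phi> p S'))"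
proof (cases "B \<ge> 1")
  case False
  then show ?thesis by (intro exI[of _ "\<lambda>_. 1"] exI[of _ 1]) (auto simp: adm_def)
next
  case B: True
  define V where "V = exp B"
  have V: "V \<ge> 1" using B by (simp add: V_def)
  \<comment> \<open>Bounds all products of the unknowns with room to spare; the factor 5 covers
    \<open>kk + 2 g\<close>, which is at most 3 B + 2 B.\<close>
  define W where "W = 5 * (B\<^sup>2 * V)"
  have BV: "1 \<le> B * V" "B \<le> B\<^sup>2" "V \<le> B * V" "B * V \<le> B\<^sup>2 * V" "B \<le> B * V" "1 \<le> B\<^sup>2 * V"
    using mult_mono[OF B V] mult_right_mono[OF B, of B] mult_right_mono[OF B, of V]
      mult_right_mono[OF B, of "B * V"] mult_left_mono[OF V, of B] B V
    by (auto simp: power2_eq_square mult.assoc intro: order_trans)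
  have W: "W \<ge> 1" "B * V \<le> W" "B\<^sup>2 * V \<le> W" "5 * B \<le> W" "2 * (B * V) \<le> W" "2 * (B\<^sup>2 * V) \<le> W"
  proof -
    have "0 \<le> B\<^sup>2 * V" "5 * B \<le> 5 * (B\<^sup>2 * V)" using BV by linarith+
    then show "W \<ge> 1" "B * V \<le> W" "B\<^sup>2 * V \<le> W" "5 * B \<le> W" "2 * (B * V) \<le> W" "2 * (B\<^sup>2 * V) \<le> W"
      using BV unfolding W_def by linarith+
  qed
  define N where "N = 2 * W + 2 * B + 2 * (T\<^sup>2 * W)"
  have N: "N \<ge> 0" using W B by (auto simp: N_def)
  \<comment> \<open>Four times the factor with which \<open>Slow\<close> and \<open>Pot\<close>
    enter \<open>Sing\<close> directly, so that this influence uses half of the allowed error M e /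
    2.\<close>
  define M where "M = 4 * (2 * W\<^sup>2 + N * W\<^sup>2 * W) + 1"
  have M: "M \<ge> 1" using W N by (auto simp: M_def)
  \<comment> \<open>The factor 8 serves twice: \<open>Slow\<close> and \<open>Pot\<close> are
    halved, and the integral part of the error of \<open>Sing\<close> is at most e / 4.\<close>
  define l where "l = 1 + 8 * \<bar>T\<bar> * W ^ 5 * (1 + M)"
  have l: "l > 0" "l \<ge> 8 * \<bar>T\<bar> * W ^ 5 * (1 + M)"
    using W M by (auto simp: l_def intro!: add_pos_nonneg mult_nonneg_nonneg)
  define w where "w i = (case i of Sing \<Rightarrow> M | _ \<Rightarrow> 1)" for i :: comp
  have w: "w i \<ge> 1" for i using M by (auto simp: w_def split: comp.split)
  have "near w (e / 2) l T (\<Phi> p S) (\<Phi> p S')"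
    if p: "p \<in> params" "fst p \<le> B" "snd p \<le> B" and e: "e \<ge> 0"
      and S: "cont_state S" "adm B T S" and S': "cont_state S'" "adm B T S'" and nr: "near w e l T S S'"
    for p S S' e
  proof -
    \<comment> \<open>One error that dominates both e, for \<open>Slow\<close> and
      \<open>Pot\<close>, and M e, for \<open>Sing\<close>.\<close>
    define E where "E = (1 + M) * e"
    have E: "E \<ge> 0" "e \<le> E" "M * e \<le> E" using e M by (auto simp: E_def algebra_simps)
    have ct: "continuous_on {0..} (S i)" "continuous_on {0..} (S' i)" for i
      using S S' by (auto simp: cont_state_def)
    note ad = adm_bounds[OF S(2)] and ad' = adm_bounds[OF S'(2)]
    have B0: "B > 0" "V > 0" using B V by auto
    have cx: "cl e l T (S Slow) (S' Slow)" and cg: "cl e l T (S Pot) (S' Pot)"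
      and cz: "cl (M * e) l T (S Sing) (S' Sing)"
    proof -
      have "cl (w i * e) l T (S i) (S' i)" for i using nr by (simp add: near_def)
      from this[of Slow] this[of Pot] this[of Sing]
      show "cl e l T (S Slow) (S' Slow)" "cl e l T (S Pot) (S' Pot)" "cl (M * e) l T (S Sing) (S' Sing)"
        by (simp_all add: w_def)
    qed
    let ?m = "\<lambda>s. exp (S Pot s)" and ?m' = "\<lambda>s. exp (S' Pot s)"
    have bx: "S Slow s \<in> {1 / B..B}" "S' Slow s \<in> {1 / B..B}"
      "S Sing s \<in> {1 / B..B}" "S' Sing s \<in> {1 / B..B}"
      "?m s \<in> {1 / V..V}" "?m' s \<in> {1 / V..V}" if "s \<in> {0..T}" for s
      using ad[OF that] ad'[OF that] by (auto simp: V_def)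
    have babs: "\<bar>u\<bar> \<le> U" if "u \<in> {1 / U..U}" "U > 0" for u U :: real
      using that order_trans[of 0 "1 / U" u] by (auto simp: abs_le_iff)
    have widen: "u \<in> {1 / W..W}" if "u \<in> {1 / U..U}" "U > 0" "U \<le> W" for u U :: real
      using that divide_left_mono[of U W 1] by auto
    have cm: "cl (V * e) l T ?m ?m'"
      using bx(5,6) by (intro cl_exp cg) auto
    have bxm: "S Slow s * ?m s \<in> {1 / (B * V)..B * V}" "S' Slow s * ?m' s \<in> {1 / (B * V)..B * V}"
      and bmz: "?m s * S Sing s \<in> {1 / (V * B)..V * B}" "?m' s * S' Sing s \<in> {1 / (V * B)..V * B}"
      if "s \<in> {0..T}" for s
      using bx[OF that] B0 by (intro interval_mult; simp)+
    have bxmz: "S Slow s * ?m s * S Sing s \<in> {1 / (B * V * B)..B * V * B}"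
      "S' Slow s * ?m' s * S' Sing s \<in> {1 / (B * V * B)..B * V * B}"
      if "s \<in> {0..T}" for s
      using bx[OF that] bxm[OF that] B0 by (intro interval_mult; simp)+
    have cxm: "cl (W * e) l T (\<lambda>s. S Slow s * ?m s) (\<lambda>s. S' Slow s * ?m' s)"
    proof (rule cl_mono[OF cl_mult[OF cx cm, where B = B and B' = V]])
      have "2 * (B * V) * e \<le> W * e" using W e by (intro mult_right_mono) auto
      then show "B * (V * e) + V * e \<le> W * e"
        using mult_right_mono[OF BV(3) e] by (simp add: algebra_simps)
    qed (use bx B0 babs in blast)+
    have cmz: "cl (W * E) l T (\<lambda>s. ?m s * S Sing s) (\<lambda>s. ?m' s * S' Sing s)"
    proof (rule cl_mono[OF cl_mult[OF cm cz, where B = V and B' = B]])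
      have "V * (M * e) \<le> (B * V) * E" using E BV B0 e M by (intro mult_mono) auto
      moreover have "B * (V * e) \<le> (B * V) * E"
        using mult_left_mono[OF E(2), of "B * V"] B0 by (simp add: mult.assoc)
      ultimately have "V * (M * e) + B * (V * e) \<le> (B * V) * E + (B * V) * E" by linarith
      also have "\<dots> = 2 * (B * V) * E" by simp
      also have "\<dots> \<le> W * E" using W E by (intro mult_right_mono) auto
      finally show "V * (M * e) + B * (V * e) \<le> W * E" .
    qed (use bx B0 babs in blast)+
    have cxmz: "cl (W * E) l T (\<lambda>s. S Slow s * ?m s * S Sing s) (\<lambda>s. S' Slow s * ?m' s * S' Sing s)"
    proof (rule cl_mono[OF cl_mult[OF cl_mult[OF cx cm, where B = B and B' = V] cz,
          where B = "B * V" and B' = B]])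
      have "B * V * (M * e) + B * (B * (V * e) + V * e) = B * V * (M * e + e) + B\<^sup>2 * V * e"
        by (simp add: algebra_simps power2_eq_square)
      also have "M * e + e = E" by (simp add: E_def algebra_simps)
      also have "B * V * E + B\<^sup>2 * V * e \<le> B\<^sup>2 * V * E + B\<^sup>2 * V * E"
        using BV B0 E e by (intro add_mono mult_mono) auto
      also have "\<dots> = 2 * (B\<^sup>2 * V) * E" by simp
      also have "\<dots> \<le> W * E" using W E by (intro mult_right_mono) auto
      finally show "B * V * (M * e) + B * (B * (V * e) + V * e) \<le> W * E" .
    qed (use bx bxm B0 babs in \<open>blast intro: mult_pos_pos\<close>)+
    have "2 \<le> W" using BV(6) unfolding W_def by linarith
    then have e2: "2 * e \<le> W * E" using E e by (intro mult_mono) auto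
    have wxm: "S Slow s * ?m s \<in> {1 / W..W}" "S' Slow s * ?m' s \<in> {1 / W..W}"
      "?m s * S Sing s \<in> {1 / W..W}" "?m' s * S' Sing s \<in> {1 / W..W}"
      "S Slow s * ?m s * S Sing s \<in> {1 / W..W}" "S' Slow s * ?m' s * S' Sing s \<in> {1 / W..W}"
      if "s \<in> {0..T}" for s
      using W B0
      by (intro widen[OF bxm(1)[OF that]] widen[OF bxm(2)[OF that]] widen[OF bmz(1)[OF that]]
          widen[OF bmz(2)[OF that]] widen[OF bxmz(1)[OF that]] widen[OF bxmz(2)[OF that]];
          simp add: power2_eq_square ac_simps)+
    have small: "\<bar>T\<bar> * (3 * W ^ 4 * (W * E)) / l \<le> e / 2"
    proof -
      have "6 * \<bar>T\<bar> * W ^ 5 * (1 + M) * e \<le> 8 * \<bar>T\<bar> * W ^ 5 * (1 + M) * e"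
        using e W M by (intro mult_right_mono) auto
      also have "\<dots> \<le> l * e" using l e by (intro mult_right_mono) auto
      finally show ?thesis using l by (simp add: E_def field_simps power_numeral_reduce)
    qed
    \<comment> \<open>\<open>Slow\<close> and \<open>Pot\<close> are both integrals of
      \<open>r * Jv\<close>, so one estimate serves for the two.\<close>
    have dint: "cl (e / 2) l T (\<lambda>r. r * Av 0 (\<lambda>r. r * Jv n u v r) r) (\<lambda>r. r * Av 0 (\<lambda>r. r * Jv n u' v' r) r)"
      if c: "continuous_on {0..} u" "continuous_on {0..} v" "continuous_on {0..} u'" "continuous_on {0..} v'"
        "\<And>s. s \<ge> 0 \<Longrightarrow> u s > 0" "\<And>s. s \<ge> 0 \<Longrightarrow> u' s > 0"
        and cl: "cl (W * E) l T u u'" "cl (W * E) l T v v'"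
        and bd: "\<And>s. s \<in> {0..T} \<Longrightarrow> u s \<in> {1 / W..W}" "\<And>s. s \<in> {0..T} \<Longrightarrow> u' s \<in> {1 / W..W}"
          "\<And>s. s \<in> {0..T} \<Longrightarrow> \<bar>v s\<bar> \<le> W" "\<And>s. s \<in> {0..T} \<Longrightarrow> \<bar>v' s\<bar> \<le> W" for u v u' v'
    proof -
      have WE: "0 \<le> W * E" "0 \<le> 3 * W ^ 4 * (W * E)" using W E by auto
      have "cl (3 * W ^ 4 * (W * E)) l T (Jv n u v) (Jv n u' v')"
        using W l WE by (intro cl_Jv c cl bd) auto
      then have "cl (\<bar>T\<bar> * (3 * W ^ 4 * (W * E))) l T (\<lambda>r. r * Jv n u v r) (\<lambda>r. r * Jv n u' v' r)"
        by (intro cl_rmult WE)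
      then have "cl (\<bar>T\<bar> * (3 * W ^ 4 * (W * E)) / l) l T
          (\<lambda>r. r * Av 0 (\<lambda>r. r * Jv n u v r) r) (\<lambda>r. r * Av 0 (\<lambda>r. r * Jv n u' v' r) r)"
        using l WE by (intro cl_gain continuous_intros continuous_on_Jv c) auto
      then show ?thesis by (rule cl_mono) (rule small)
    qed
    have pos: "S Slow s > 0" "S Sing s > 0" "S' Slow s > 0" "S' Sing s > 0" if "s \<ge> 0" for s
      using S(2) S'(2) that by (auto simp: adm_def)
    have Slow: "cl (e / 2) l T (\<Phi> p S Slow) (\<Phi> p S' Slow)"
    proof -
      have v: "cl (W * E) l T (\<lambda>s. b * (c + S Slow s)) (\<lambda>s. b * (c + S' Slow s))"
      proof (rule cl_mono[OF cl_cmult[OF cl_add[OF cl_const cx]]])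
        have "b * (0 + e) \<le> 2 * e" using cb e by (intro mult_mono) auto
        then show "b * (0 + e) \<le> W * E" using e2 by simp
      qed (use cb in auto)
      have vb: "\<bar>b * (c + u)\<bar> \<le> W" if "u \<in> {1 / B..B}" for u
      proof -
        have "\<bar>c + u\<bar> \<le> 1 + B" using babs[OF that B0(1)] cb by linarith
        then have "b * \<bar>c + u\<bar> \<le> 2 * (1 + B)" using cb B by (intro mult_mono) auto
        then show ?thesis using W(4) B cb by (simp add: abs_mult)
      qed
      have "cl (0 + e / 2) l T (\<lambda>r. fst p + r * Av 0 (x1 S) r) (\<lambda>r. fst p + r * Av 0 (x1 S') r)"
        unfolding x1_def[abs_def]
        by (intro cl_add cl_const dint cmz v continuous_intros ct wxm vb bx) (use pos in auto)
      then show ?thesis by (simp add: \<Phi>_def)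
    qed
    have Pot: "cl (e / 2) l T (\<Phi> p S Pot) (\<Phi> p S' Pot)"
    proof -
      have kp: "0 \<le> kk p" "kk p \<le> 3 * B"
      proof -
        show "0 \<le> kk p" using kk_pos[OF p(1)] by simp
        have "real (n + 1) * snd p \<le> 3 * B" using p n by (intro mult_mono) (auto simp: params_def)
        then show "kk p \<le> 3 * B" by (simp add: kk_def)
      qed
      have v: "cl (W * E) l T (\<lambda>s. kk p + 2 * S Pot s) (\<lambda>s. kk p + 2 * S' Pot s)"
        by (rule cl_mono[OF cl_add[OF cl_const[OF order_refl] cl_cmult[OF cg]]]) (use e2 in auto)
      have vb: "\<bar>kk p + 2 * u\<bar> \<le> W" if "\<bar>u\<bar> \<le> B" for u
        using that kp W(4) by linarith
      show ?thesis unfolding \<Phi>_def g1_def[abs_def] comp.case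
        by (intro dint cxmz v continuous_intros ct wxm vb ad(4) ad'(4)) (use pos in auto)
    qed
    have Sing: "cl (M * (e / 2)) l T (\<Phi> p S Sing) (\<Phi> p S' Sing)"
    proof -
      define u where "u = (\<lambda>s. S Slow s * ?m s * S Sing s)"
      define u' where "u' = (\<lambda>s. S' Slow s * ?m' s * S' Sing s)"
      have uc: "continuous_on {0..} u" "continuous_on {0..} u'"
        unfolding u_def u'_def by (intro continuous_intros ct)+
      have WE: "0 \<le> W * E" "0 \<le> W * e" using W E e by auto
      have 1: "cl (\<bar>T\<bar> * (W * E / l)) l T (\<lambda>r. r * (r * Av n u r)) (\<lambda>r. r * (r * Av n u' r))"
        using l WE cxmz unfolding u_def[symmetric] u'_def[symmetric]
        by (intro cl_rmult cl_gain uc) auto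
      have 2: "cl (W * e) l T (Av 0 (\<lambda>s. S Slow s * ?m s)) (Av 0 (\<lambda>s. S' Slow s * ?m' s))"
        using l WE by (intro cl_Av cxm continuous_intros ct) auto
      have 3: "cl (t1 * (W * e) + 0 + n * (\<bar>T\<bar> * (W * E / l))) l T (num p S) (num p S')"
        unfolding num_def[abs_def] u_def[symmetric] u'_def[symmetric]
        by (intro cl_add cl_cmult cl_const 1 2) (use t in auto)
      have nb: "\<bar>num p S' r\<bar> \<le> N" if r: "r \<in> {0..T}" for r
      proof -
        have "\<bar>Av 0 (\<lambda>s. S' Slow s * ?m' s) r\<bar> \<le> W"
          using r W by (intro Av_abs_bound continuous_intros ct babs wxm) auto
        then have a: "\<bar>t1 * Av 0 (\<lambda>s. S' Slow s * ?m' s) r\<bar> \<le> 2 * W"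
          using t n W unfolding abs_mult by (intro mult_mono) auto
        have "\<bar>t2 * fst p\<bar> \<le> 2 * B"
          using t n p unfolding abs_mult by (intro mult_mono) (auto simp: params_def)
        moreover have "\<bar>n * (r * (r * Av n u' r))\<bar> \<le> 2 * (T\<^sup>2 * W)"
        proof -
          have "\<bar>Av n u' r\<bar> \<le> W" unfolding u'_def
            using r W by (intro Av_abs_bound continuous_intros ct babs wxm) auto
          then have "r * (r * \<bar>Av n u' r\<bar>) \<le> T * (T * W)" using r W by (intro mult_mono mult_nonneg_nonneg) auto
          then have "real n * (r * (r * \<bar>Av n u' r\<bar>)) \<le> 2 * (T * (T * W))"
            using n r by (rule_tac mult_mono) auto
          then show ?thesis using r by (simp add: abs_mult power2_eq_square)
        qed
        ultimately show ?thesis using a unfolding num_def N_def u'_def[symmetric] by linarith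
      qed
      have w1: "S Slow s * ?m s \<ge> 1 / W" "S' Slow s * ?m' s \<ge> 1 / W" if "s \<in> {0..T}" for s
        using wxm[OF that] by auto
      have 4: "cl (W * (t1 * (W * e) + 0 + n * (\<bar>T\<bar> * (W * E / l))) + N * W\<^sup>2 * (W * e)) l T (h p S) (h p S')"
        unfolding h_def[abs_def] by (rule cl_divide[OF 3 cxm _ nb w1]) (use W in auto)
      have le: "W * (t1 * (W * e) + 0 + n * (\<bar>T\<bar> * (W * E / l))) + N * W\<^sup>2 * (W * e) \<le> M * (e / 2)"
      proof -
        have "t1 * (W * e) \<le> 2 * (W * e)" using t n WE by (intro mult_right_mono) auto
        moreover have "n * (\<bar>T\<bar> * (W * E / l)) \<le> 2 * (\<bar>T\<bar> * (W * E / l))"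
          using n WE l by (intro mult_right_mono) auto
        ultimately have "W * (t1 * (W * e) + 0 + n * (\<bar>T\<bar> * (W * E / l))) \<le> W * (2 * (W * e) + 2 * (\<bar>T\<bar> * (W * E / l)))"
          using W(1) by (intro mult_left_mono) linarith+
        then have i: "W * (t1 * (W * e) + 0 + n * (\<bar>T\<bar> * (W * E / l)))
            \<le> 2 * W\<^sup>2 * e + 2 * (W * (\<bar>T\<bar> * (W * E / l)))"
          by (simp add: algebra_simps power2_eq_square)
        have "8 * \<bar>T\<bar> * W\<^sup>2 * (1 + M) * e \<le> 8 * \<bar>T\<bar> * W ^ 5 * (1 + M) * e"
          using e W M by (intro mult_right_mono mult_left_mono power_increasing) auto
        also have "\<dots> \<le> l * e" using l e by (intro mult_right_mono) auto
        finally have "2 * (W * (\<bar>T\<bar> * (W * E / l))) \<le> e / 4"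
          using l by (simp add: E_def field_simps power2_eq_square)
        moreover have "M * (e / 2) = 2 * (2 * W\<^sup>2 * e + N * W\<^sup>2 * W * e) + e / 2"
          by (simp add: M_def algebra_simps)
        moreover have "0 \<le> 2 * W\<^sup>2 * e" "0 \<le> N * W\<^sup>2 * W * e" using W N e by auto
        moreover have "N * W\<^sup>2 * (W * e) = N * W\<^sup>2 * W * e" by simp
        moreover have "X + N' \<le> M'" if "2 * Q \<le> e / 4" "M' = 2 * (P1 + P2) + e / 2" "0 \<le> P1" "0 \<le> P2" "N' = P2"
          "X \<le> P1 + 2 * Q" for X Q P1 P2 N' M' :: real
          using that e by simp
        ultimately show ?thesis using i by blast
      qed
      have "cl (M * (e / 2)) l T (Av (n - 1) (h p S)) (Av (n - 1) (h p S'))"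
        by (rule cl_Av[OF cont_x1(3)[OF S(1)] cont_x1(3)[OF S'(1)] _ _ cl_mono[OF 4 le]])
          (use pos l M e in auto)
      then show ?thesis by (simp add: \<Phi>_def)
    qed
    show ?thesis unfolding near_def
    proof
      fix i show "cl (w i * (e / 2)) l T (\<Phi> p S i) (\<Phi> p S' i)"
        using Slow Pot Sing by (cases i) (auto simp: w_def)
    qed
  qed
  then show ?thesis using l w by blast
qed

end

section \<open>Invariance of the growth bounds\<close>

lemma Av_mono_index:
  assumes "continuous_on {0..} h" "r \<ge> 0" "j \<le> n" "\<And>s. 0 \<le> s \<Longrightarrow> s \<le> r \<Longrightarrow> h s \<ge> 0"
  shows "Av n h r \<le> Av j h r"
  unfolding Av_def
proof (rule integral_le[OF Av_integrable Av_integrable])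
  fix t :: real assume t: "t \<in> {0..1}"
  then have "h (t * r) \<ge> 0" using assms(2) by (intro assms(4)) (auto intro: mult_left_le_one_le)
  then show "t ^ n * h (t * r) \<le> t ^ j * h (t * r)"
    using t assms(3) by (intro mult_right_mono power_decreasing) auto
qed (use assms in auto)

lemma Av1_exp_square: "r \<ge> 0 \<Longrightarrow> r * (r * Av 1 (\<lambda>s. exp (s\<^sup>2)) r) = (exp (r\<^sup>2) - 1) / 2"
proof -
  assume r: "r \<ge> 0"
  have "((\<lambda>s. s * exp (s\<^sup>2)) has_integral exp (r\<^sup>2) / 2 - exp (0\<^sup>2) / 2) {0..r}"
  proof (rule fundamental_theorem_of_calculus[OF r])
    fix x :: real
    have "((\<lambda>s. exp (s\<^sup>2) / 2) has_real_derivative x * exp (x\<^sup>2)) (at x within {0..r})"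
      by (auto intro!: derivative_eq_intros)
    then show "((\<lambda>s. exp (s\<^sup>2) / 2) has_vector_derivative x * exp (x\<^sup>2)) (at x within {0..r})"
      by (simp add: has_real_derivative_iff_has_vector_derivative)
  qed
  from integral_unique[OF this] show ?thesis
    using Av_FTC[of "\<lambda>s. exp (s\<^sup>2)" r 1] r
    by (simp add: continuous_intros diff_divide_distrib power2_eq_square mult.assoc)
qed

text \<open>Differentiability is asked for r > 0 only; continuity and the value 0 at r = 0 fix the
  constant of integration.\<close>

lemma antideriv_unique:
  assumes u: "continuous_on {0..} u" "u 0 = 0" and phi: "continuous_on {0..} \<phi>"
    and d: "\<And>r. r > 0 \<Longrightarrow> (u has_real_derivative r ^ n * \<phi> r) (at r)" and r: "r \<ge> 0"
  shows "u r = r ^ (n + 1) * Av n \<phi> r"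
proof (cases "r = 0")
  case False
  then have r0: "r > 0" using r by simp
  have "((\<lambda>s. s ^ n * \<phi> s) has_integral u r - u 0) {0..r}"
    by (rule fundamental_theorem_of_calculus_interior[OF r])
      (use d u in \<open>auto simp: has_real_derivative_iff_has_vector_derivative[symmetric] intro: continuous_on_subset\<close>)
  then show ?thesis using Av_FTC[OF phi r, of n] u(2) by (simp add: integral_unique)
qed (use u in simp)

context singular_ivp
begin

context
  fixes p :: "real \<times> real" and S :: state
  assumes p: "p \<in> params" and S: "cont_state S" and K: "K p S"
begin

lemma fp: "fst p > 0" "kk p > 0"
  using p kk_pos[OF p] by (auto simp: params_def)

lemma KD:
  assumes "r \<ge> 0"
  shows "S Slow r \<ge> fst p" "c + S Slow r \<le> (c + fst p) * exp (2 * r)" "S Pot r \<ge> 0"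
    "S Pot r \<le> kk p * (exp (2 * r) - 1) / 2" "S Sing r \<ge> low p r" "S Sing r \<le> exp (r\<^sup>2)"
    "\<And>t. 0 \<le> t \<Longrightarrow> t \<le> 1 \<Longrightarrow> S Slow (t * r) \<le> S Slow r"
    "\<And>t. 0 \<le> t \<Longrightarrow> t \<le> 1 \<Longrightarrow> S Pot (t * r) \<le> S Pot r"
    "\<And>t. 0 \<le> t \<Longrightarrow> t \<le> 1 \<Longrightarrow> t ^ n * S Sing (t * r) \<le> S Sing r"
  using K assms unfolding K_def K_at_def by auto

lemma S_cont: "continuous_on {0..} (S i)"
  using S by (auto simp: cont_state_def)

lemma S_pos: assumes "r \<ge> 0" shows "S Slow r > 0" "S Sing r > 0"
  using K_pos[OF K p assms] by auto

lemma S_mono: assumes "0 \<le> s" "s \<le> r" shows "S Slow s \<le> S Slow r" "S Pot s \<le> S Pot r"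
proof -
  have "S Slow s \<le> S Slow r \<and> S Pot s \<le> S Pot r"
  proof (cases "r = 0")
    case False
    then have "0 \<le> s / r" "s / r \<le> 1" "s / r * r = s" using assms by auto
    then show ?thesis using KD(7,8)[of r "s / r"] assms by simp
  qed (use assms in simp)
  then show "S Slow s \<le> S Slow r" "S Pot s \<le> S Pot r" by auto
qed

lemma weight_mz: assumes r: "r \<ge> 0" and t: "0 \<le> t" "t \<le> 1"
  shows "t ^ n * (exp (S Pot (t * r)) * S Sing (t * r)) \<le> exp (S Pot r) * S Sing r"
proof -
  have "exp (S Pot (t * r)) * (t ^ n * S Sing (t * r)) \<le> exp (S Pot r) * S Sing r"
    using KD(8,9)[OF r t] S_pos(2)[of "t * r"] r t by (intro mult_mono) auto
  then show ?thesis by (simp add: ac_simps)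
qed

lemma weight_xmz: assumes r: "r \<ge> 0" and t: "0 \<le> t" "t \<le> 1"
  shows "t ^ n * (S Slow (t * r) * exp (S Pot (t * r)) * S Sing (t * r)) \<le> S Slow r * exp (S Pot r) * S Sing r"
proof -
  have "S Slow (t * r) * (t ^ n * (exp (S Pot (t * r)) * S Sing (t * r))) \<le> S Slow r * (exp (S Pot r) * S Sing r)"
    by (rule mult_mono[OF KD(7)[OF r t] weight_mz[OF r t]])
      (use S_pos[of "t * r"] S_pos[OF r] r t in \<open>auto simp: less_imp_le\<close>)
  then show ?thesis by (simp add: ac_simps)
qed

lemma x1_bounds: assumes r: "r \<ge> 0"
  shows "0 \<le> x1 S r" "x1 S r \<le> (c + fst p) * (exp (2 * r) - 1)"
proof -
  have c0: "0 \<le> b * (c + S Slow s)" if "s \<ge> 0" for s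
    using S_pos[OF that] cb by simp
  have cc: "continuous_on {0..} (\<lambda>s. b * (c + S Slow s))"
    "continuous_on {0..} (\<lambda>s. exp (S Pot s) * S Sing s)"
    by (intro continuous_intros S_cont)+
  have "0 \<le> Jv n (\<lambda>s. exp (S Pot s) * S Sing s) (\<lambda>s. b * (c + S Slow s)) r"
    unfolding Jv_def using S_pos r cb
    by (intro divide_nonneg_nonneg Av_nonneg continuous_intros S_cont mult_nonneg_nonneg add_nonneg_nonneg)
      (auto simp: less_imp_le)
  then show "0 \<le> x1 S r" using r by (simp add: x1_def)
  have "Jv n (\<lambda>s. exp (S Pot s) * S Sing s) (\<lambda>s. b * (c + S Slow s)) r \<le> Av 0 (\<lambda>s. b * (c + S Slow s)) r"
    using r S_pos weight_mz c0 by (intro Jv_le cc) auto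
  also have "\<dots> \<le> Av 0 (\<lambda>s. (b * (c + fst p)) * exp (2 * s)) r"
    using r KD(2) cb by (intro Av_mono continuous_intros S_cont) (auto simp: mult.assoc)
  finally have "x1 S r \<le> r * Av 0 (\<lambda>s. (b * (c + fst p)) * exp (2 * s)) r"
    unfolding x1_def using r by (intro mult_left_mono)
  also have "\<dots> = b / 2 * ((c + fst p) * (exp (2 * r) - 1))" using r by (subst Av0_exp) auto
  \<comment> \<open>The hypothesis b <= 2 cancels the 1/2 from integrating
    \<open>exp (2 * s)\<close>.\<close>
  also have "\<dots> \<le> 1 * ((c + fst p) * (exp (2 * r) - 1))"
    using cb fp r by (intro mult_right_mono mult_nonneg_nonneg) auto
  finally show "x1 S r \<le> (c + fst p) * (exp (2 * r) - 1)" by simp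
qed

lemma g1_bounds: assumes r: "r \<ge> 0"
  shows "0 \<le> g1 p S r" "g1 p S r \<le> kk p * (exp (2 * r) - 1) / 2"
proof -
  have c0: "0 \<le> kk p + 2 * S Pot s" if "s \<ge> 0" for s
    using KD(3)[OF that] fp by simp
  have cc: "continuous_on {0..} (\<lambda>s. kk p + 2 * S Pot s)"
    "continuous_on {0..} (\<lambda>s. S Slow s * exp (S Pot s) * S Sing s)"
    by (intro continuous_intros S_cont)+
  have "0 \<le> Jv n (\<lambda>s. S Slow s * exp (S Pot s) * S Sing s) (\<lambda>s. kk p + 2 * S Pot s) r"
    unfolding Jv_def using S_pos r c0
    by (intro divide_nonneg_nonneg Av_nonneg continuous_intros S_cont mult_nonneg_nonneg) (auto simp: less_imp_le)
  then show "0 \<le> g1 p S r" using r by (simp add: g1_def)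
  have "Jv n (\<lambda>s. S Slow s * exp (S Pot s) * S Sing s) (\<lambda>s. kk p + 2 * S Pot s) r \<le> Av 0 (\<lambda>s. kk p + 2 * S Pot s) r"
    using r S_pos weight_xmz c0 by (intro Jv_le cc) auto
  also have "\<dots> \<le> Av 0 (\<lambda>s. kk p * exp (2 * s)) r"
  proof (intro Av_mono continuous_intros S_cont r)
    fix s assume "0 \<le> s" "s \<le> r"
    then show "kk p + 2 * S Pot s \<le> kk p * exp (2 * s)" using KD(4)[of s] by (simp add: algebra_simps)
  qed
  finally have "g1 p S r \<le> r * Av 0 (\<lambda>s. kk p * exp (2 * s)) r"
    unfolding g1_def using r by (intro mult_left_mono)
  also have "\<dots> = kk p * (exp (2 * r) - 1) / 2" using r by (subst Av0_exp) auto
  finally show "g1 p S r \<le> kk p * (exp (2 * r) - 1) / 2" .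
qed

text \<open>By monotonicity \<open>x e^g\<close> lies between \<open>fst p\<close> and its value
  \<open>D\<close> at r. Dividing \<open>num\<close> by \<open>D\<close> leaves at most
  \<open>n (1 + exp (r^2)) / 2\<close> above, and below the relation t1 + t2 = n leaves at least
  \<open>n * fst p / D\<close>.\<close>

lemma h_bounds: assumes r: "r \<ge> 0"
  shows "n * low p r \<le> h p S r" "h p S r \<le> n * exp (r\<^sup>2)"
proof -
  define D where "D = S Slow r * exp (S Pot r)"
  have D: "fst p \<le> D" "D > 0"
  proof -
    show "D > 0" using S_pos[OF r] by (simp add: D_def)
    have "fst p * 1 \<le> S Slow r * exp (S Pot r)" using KD[OF r] fp by (intro mult_mono) auto
    then show "fst p \<le> D" by (simp add: D_def)
  qed
  have xm: "fst p \<le> S Slow s * exp (S Pot s)" "S Slow s * exp (S Pot s) \<le> D" if "0 \<le> s" "s \<le> r" for s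
  proof -
    have "fst p * 1 \<le> S Slow s * exp (S Pot s)" using KD[OF that(1)] fp by (intro mult_mono) auto
    then show "fst p \<le> S Slow s * exp (S Pot s)" by simp
    show "S Slow s * exp (S Pot s) \<le> D"
      unfolding D_def using S_mono[OF that] S_pos[OF that(1)] S_pos[OF r] by (intro mult_mono) auto
  qed
  have cont: "continuous_on {0..} (\<lambda>s. S Slow s * exp (S Pot s))"
    "continuous_on {0..} (\<lambda>s. S Slow s * exp (S Pot s) * S Sing s)"
    by (intro continuous_intros S_cont)+
  have A0: "fst p \<le> Av 0 (\<lambda>s. S Slow s * exp (S Pot s)) r" "Av 0 (\<lambda>s. S Slow s * exp (S Pot s)) r \<le> D"
    using Av_mono[OF continuous_on_const cont(1) r xm(1), of 0]
      Av_mono[OF cont(1) continuous_on_const r xm(2), of 0] by (auto simp: Av_const)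
  have An0: "Av n (\<lambda>s. S Slow s * exp (S Pot s) * S Sing s) r \<ge> 0"
    using S_pos r by (intro Av_nonneg cont) (auto simp: less_imp_le)
  have An: "r * (r * Av n (\<lambda>s. S Slow s * exp (S Pot s) * S Sing s) r) \<le> D * ((exp (r\<^sup>2) - 1) / 2)"
  proof -
    \<comment> \<open>Lowering the index to 1 covers both values of n and makes
      \<open>s * exp (s^2)\<close> explicitly integrable.\<close>
    have "Av n (\<lambda>s. S Slow s * exp (S Pot s) * S Sing s) r \<le> Av 1 (\<lambda>s. S Slow s * exp (S Pot s) * S Sing s) r"
      using n S_pos by (intro Av_mono_index cont r) (auto simp: less_imp_le)
    also have "\<dots> \<le> Av 1 (\<lambda>s. D * exp (s\<^sup>2)) r"
    proof (intro Av_mono cont r continuous_intros)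
      fix s assume s: "0 \<le> s" "s \<le> r"
      show "S Slow s * exp (S Pot s) * S Sing s \<le> D * exp (s\<^sup>2)"
        using xm(2)[OF s] KD(6)[OF s(1)] S_pos[OF s(1)] D by (intro mult_mono) auto
    qed
    finally have "r * (r * Av n (\<lambda>s. S Slow s * exp (S Pot s) * S Sing s) r) \<le> r * (r * Av 1 (\<lambda>s. D * exp (s\<^sup>2)) r)"
      using r by (intro mult_left_mono)
    also have "\<dots> = D * (r * (r * Av 1 (\<lambda>s. exp (s\<^sup>2)) r))" by (simp add: Av_cmult)
    also have "r * (r * Av 1 (\<lambda>s. exp (s\<^sup>2)) r) = (exp (r\<^sup>2) - 1) / 2" by (rule Av1_exp_square[OF r])
    finally show ?thesis .
  qed
  have "num p S r \<le> t1 * D + t2 * D + n * (D * ((exp (r\<^sup>2) - 1) / 2))"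
    unfolding num_def using A0 An D t by (intro add_mono mult_left_mono) auto
  also have "\<dots> = D * (n * ((1 + exp (r\<^sup>2)) / 2))"
  proof -
    have "t1 * D + t2 * D = n * D" by (simp flip: t(3) add: distrib_right)
    then show ?thesis by (simp add: field_simps)
  qed
  also have "\<dots> \<le> D * (n * exp (r\<^sup>2))"
    using D by (intro mult_left_mono) auto
  finally show "h p S r \<le> n * exp (r\<^sup>2)"
    unfolding h_def D_def[symmetric] using D by (simp add: field_simps)
  have "n * fst p = t1 * fst p + t2 * fst p" by (simp flip: t(3) add: distrib_right)
  also have "\<dots> \<le> num p S r"
    unfolding num_def using mult_nonneg_nonneg[OF of_nat_0_le_iff[of n] mult_nonneg_nonneg[OF r mult_nonneg_nonneg[OF r An0]]]
      mult_left_mono[OF A0(1) t(1)] by linarith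
  finally have 1: "n * fst p / D \<le> h p S r"
    unfolding h_def D_def[symmetric] using D by (intro divide_right_mono) auto
  have "low p r * D \<le> fst p"
  proof -
    have "S Slow r \<le> (c + fst p) * exp (2 * r)" using KD(2)[OF r] cb by simp
    moreover have "exp (S Pot r) \<le> exp (kk p * exp (2 * r) / 2)"
      using KD(4)[OF r] fp by (simp add: algebra_simps)
    ultimately have "D \<le> (c + fst p) * exp (2 * r) * exp (kk p * exp (2 * r) / 2)"
      unfolding D_def using fp cb by (intro mult_mono) auto
    then have "low p r * D \<le> low p r * ((c + fst p) * exp (2 * r) * exp (kk p * exp (2 * r) / 2))"
      using low_pos[OF p, of r] by (intro mult_left_mono) auto
    also have "\<dots> = fst p * (exp (- 2 * r - kk p * exp (2 * r) / 2) * exp (2 * r) * exp (kk p * exp (2 * r) / 2))"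
      using fp cb by (simp add: low_def)
    also have "\<dots> = fst p" by (simp add: exp_add[symmetric])
    finally show ?thesis .
  qed
  then have "low p r \<le> fst p / D" using D by (simp add: pos_le_divide_eq)
  then have "n * low p r \<le> n * (fst p / D)" by (rule mult_left_mono) simp
  then show "n * low p r \<le> h p S r" using 1 by simp
qed

lemma K_preserved: "K p (\<Phi> p S)"
  unfolding K_def
proof (intro allI impI)
  fix r :: real assume r: "r \<ge> 0"
  note cc = cont_x1[OF S] 
  have cx: "continuous_on {0..} (x1 S)" "continuous_on {0..} (g1 p S)" "continuous_on {0..} (h p S)"
    using cc S_pos by auto
  have "0 \<le> Av 0 (x1 S) r" "0 \<le> Av 0 (g1 p S) r"
    using r by (auto intro!: Av_nonneg cx x1_bounds g1_bounds)
  then have 1: "fst p \<le> \<Phi> p S Slow r" "0 \<le> \<Phi> p S Pot r" using r by (auto simp: \<Phi>_def)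
  have E: "exp (2 * r) \<ge> 1" using r by simp
  have 2: "c + \<Phi> p S Slow r \<le> (c + fst p) * exp (2 * r)"
  proof -
    have "Av 0 (x1 S) r \<le> Av 0 (\<lambda>s. (c + fst p) * exp (2 * s)) r"
    proof (intro Av_mono cx r continuous_intros)
      fix s assume "0 \<le> s" "s \<le> r"
      then show "x1 S s \<le> (c + fst p) * exp (2 * s)"
        using x1_bounds(2)[of s] fp cb by (simp add: right_diff_distrib)
    qed
    then have "r * Av 0 (x1 S) r \<le> r * Av 0 (\<lambda>s. (c + fst p) * exp (2 * s)) r" using r by (rule mult_left_mono)
    also have "\<dots> = (c + fst p) * ((exp (2 * r) - 1) / 2)" using r by (subst Av0_exp) auto
    also have "\<dots> \<le> (c + fst p) * (exp (2 * r) - 1)" using E fp cb by (intro mult_left_mono) auto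
    finally show ?thesis by (simp add: \<Phi>_def right_diff_distrib)
  qed
  have 3: "\<Phi> p S Pot r \<le> kk p * (exp (2 * r) - 1) / 2"
  proof -
    have "Av 0 (g1 p S) r \<le> Av 0 (\<lambda>s. (kk p / 2) * exp (2 * s)) r"
    proof (intro Av_mono cx r continuous_intros)
      fix s assume "0 \<le> s" "s \<le> r"
      then show "g1 p S s \<le> kk p / 2 * exp (2 * s)"
        using g1_bounds(2)[of s] fp by (simp add: right_diff_distrib)
    qed
    then have "r * Av 0 (g1 p S) r \<le> r * Av 0 (\<lambda>s. (kk p / 2) * exp (2 * s)) r" using r by (rule mult_left_mono)
    also have "\<dots> = (kk p / 2) * ((exp (2 * r) - 1) / 2)" using r by (subst Av0_exp) auto
    also have "\<dots> \<le> (kk p / 2) * (exp (2 * r) - 1)" using E fp by (intro mult_left_mono) auto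
    finally show ?thesis by (simp add: \<Phi>_def)
  qed
  \<comment> \<open>\<open>Av (n - 1)\<close> of the constant n v is v, so bounds for
    \<open>h\<close> carrying the factor n become bounds for \<open>Sing\<close> without it.\<close>
  have n1: "real (n - 1) + 1 = n" using n by (simp add: of_nat_diff)
  have 4: "low p r \<le> \<Phi> p S Sing r"
  proof -
    have "Av (n - 1) (\<lambda>_. n * low p r) r \<le> Av (n - 1) (h p S) r"
    proof (intro Av_mono cx r continuous_intros)
      fix s assume s: "0 \<le> s" "s \<le> r"
      have "n * low p r \<le> n * low p s" using low_mono[OF p s(2)] by (rule mult_left_mono) simp
      then show "n * low p r \<le> h p S s" using h_bounds(1)[OF s(1)] by linarith
    qed
    then show ?thesis using n by (simp add: \<Phi>_def Av_const n1)
  qed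
  have 5: "\<Phi> p S Sing r \<le> exp (r\<^sup>2)"
  proof -
    have "Av (n - 1) (h p S) r \<le> Av (n - 1) (\<lambda>_. n * exp (r\<^sup>2)) r"
    proof (intro Av_mono cx r continuous_intros)
      fix s assume s: "0 \<le> s" "s \<le> r"
      have "n * exp (s\<^sup>2) \<le> n * exp (r\<^sup>2)" using s by (intro mult_left_mono) (auto intro: power_mono)
      then show "h p S s \<le> n * exp (r\<^sup>2)" using h_bounds(2)[OF s(1)] by linarith
    qed
    then show ?thesis using n by (simp add: \<Phi>_def Av_const n1)
  qed
  have hn: "h p S s \<ge> 0" if "s \<ge> 0" for s
  proof -
    have "0 \<le> n * low p s" using low_pos[OF p, of s] by simp
    then show ?thesis using h_bounds(1)[OF that] by linarith
  qed
  have 6: "\<Phi> p S Slow (t * r) \<le> \<Phi> p S Slow r \<and> \<Phi> p S Pot (t * r) \<le> \<Phi> p S Pot r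
      \<and> t ^ n * \<Phi> p S Sing (t * r) \<le> \<Phi> p S Sing r" if "t \<in> {0..1}" for t
  proof -
    have t: "0 \<le> t" "t \<le> 1" using that by auto
    have "t * Av 0 (x1 S) (t * r) \<le> Av 0 (x1 S) r" "t * Av 0 (g1 p S) (t * r) \<le> Av 0 (g1 p S) r"
      using Av_star[OF cx(1) x1_bounds(1) t r, of 0] Av_star[OF cx(2) g1_bounds(1) t r, of 0] by auto
    then have "r * (t * Av 0 (x1 S) (t * r)) \<le> r * Av 0 (x1 S) r"
      "r * (t * Av 0 (g1 p S) (t * r)) \<le> r * Av 0 (g1 p S) r"
      using r by (auto intro: mult_left_mono)
    moreover have "t ^ n * Av (n - 1) (h p S) (t * r) \<le> Av (n - 1) (h p S) r"
      using Av_star[OF cx(3) hn t r, of "n - 1"] n by simp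
    ultimately show ?thesis by (simp add: \<Phi>_def ac_simps)
  qed
  show "K_at p (\<Phi> p S) r"
    unfolding K_at_def using 1 2 3 4 5 6 by blast
qed

end

lemma K_const_start: assumes p: "p \<in> params" shows "K p (start p)"
  unfolding K_def
proof (intro allI impI)
  fix r :: real assume r: "r \<ge> 0"
  have f: "fst p > 0" "kk p > 0" using p kk_pos[OF p] by (auto simp: params_def)
  have "(c + fst p) * 1 \<le> (c + fst p) * exp (2 * r)" using r f cb by (intro mult_left_mono) auto
  moreover have "0 \<le> kk p * exp (2 * r)" using f by simp
  then have "- 2 * r - kk p * exp (2 * r) / 2 \<le> 0" using r by simp
  then have "low p r \<le> 1 * 1" unfolding low_def
    using f cb r by (intro mult_mono) (auto simp: divide_le_eq)
  moreover have "t ^ n \<le> 1" if "t \<in> {0..1}" for t :: real using that by (auto intro: power_le_one)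
  ultimately show "K_at p (start p) r"
    using f r by (auto simp: K_at_def start_def)
qed

text \<open>All conditions are nonstrict and pointwise, hence closed. Strict positivity survives the
  limit because it is built in through \<open>fst p\<close> and \<open>low\<close>.\<close>

lemma K_closed:
  assumes K: "\<And>j. K p (X j)" and lim: "\<And>i r. r \<ge> 0 \<Longrightarrow> (\<lambda>j. X j i r) \<longlonglongrightarrow> L i r"
  shows "K p L"
  unfolding K_def K_at_def
proof (intro allI impI conjI ballI)
  fix r :: real assume r: "r \<ge> 0"
  note l = lim[OF r]
  have k: "X j Slow r \<ge> fst p" "c + X j Slow r \<le> (c + fst p) * exp (2 * r)" "X j Pot r \<ge> 0"
    "X j Pot r \<le> kk p * (exp (2 * r) - 1) / 2" "X j Sing r \<ge> low p r" "X j Sing r \<le> exp (r\<^sup>2)" for j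
    using K[of j] r unfolding K_def K_at_def by blast+
  show "fst p \<le> L Slow r" by (rule LIMSEQ_le_const[OF l]) (use k in blast)
  show "c + L Slow r \<le> (c + fst p) * exp (2 * r)"
    by (rule LIMSEQ_le_const2[OF tendsto_add[OF tendsto_const l]]) (use k in blast)
  show "0 \<le> L Pot r" by (rule LIMSEQ_le_const[OF l]) (use k in blast)
  show "L Pot r \<le> kk p * (exp (2 * r) - 1) / 2" by (rule LIMSEQ_le_const2[OF l]) (use k in blast)
  show "low p r \<le> L Sing r" by (rule LIMSEQ_le_const[OF l]) (use k in blast)
  show "L Sing r \<le> exp (r\<^sup>2)" by (rule LIMSEQ_le_const2[OF l]) (use k in blast)
  fix t :: real assume t: "t \<in> {0..1}"
  then have "t * r \<ge> 0" using r by simp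
  note lt = lim[OF this]
  have m: "X j Slow (t * r) \<le> X j Slow r" "X j Pot (t * r) \<le> X j Pot r"
    "t ^ n * X j Sing (t * r) \<le> X j Sing r" for j
    using K[of j] r t unfolding K_def K_at_def by blast+
  show "L Slow (t * r) \<le> L Slow r" by (rule LIMSEQ_le[OF lt l]) (use m in blast)
  show "L Pot (t * r) \<le> L Pot r" by (rule LIMSEQ_le[OF lt l]) (use m in blast)
  show "t ^ n * L Sing (t * r) \<le> L Sing r"
    by (rule LIMSEQ_le[OF tendsto_mult[OF tendsto_const lt] l]) (use m in blast)
qed

lemma K_imp_adm:
  assumes p: "p \<in> params"
  shows "\<exists>U B. open U \<and> p \<in> U \<and> (\<forall>q\<in>params \<inter> U. fst q \<le> B \<and> snd q \<le> B \<and> (\<forall>S. K q S \<longrightarrow> adm B T S))"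
proof -
  have f: "fst p > 0" "snd p > 0" using p by (auto simp: params_def)
  \<comment> \<open>On this neighbourhood x(0) stays away from 0 and both parameters stay
    bounded.\<close>
  define U where "U = {fst p / 2<..<2 * fst p} \<times> {..<2 * snd p}"
  define k where "k = 6 * snd p"
  \<comment> \<open>The bound \<open>low\<close> at its worst: initial value
    \<open>fst p / 2\<close>, c = 1, r = T, and \<open>kk <= 3 * (2 * snd p)\<close>.\<close>
  define l where "l = (fst p / 2) / (1 + fst p / 2) * exp (- 2 * T - k * exp (2 * T) / 2)"
  have l0: "l > 0" using f by (auto simp: l_def intro!: mult_pos_pos divide_pos_pos add_pos_pos)
  define B where "B = 1 + 2 * fst p + 2 * snd p + 2 / fst p + (1 + 2 * fst p) * exp (2 * T)
    + k * exp (2 * T) + exp (T\<^sup>2) + 1 / l"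
  have nn: "0 \<le> 2 / fst p" "0 \<le> (1 + 2 * fst p) * exp (2 * T)" "0 \<le> k * exp (2 * T)" "0 \<le> exp (T\<^sup>2)" "0 \<le> 1 / l"
    using f l0 by (auto simp: k_def)
  have B: "B \<ge> 1" "2 * fst p \<le> B" "2 * snd p \<le> B" "2 / fst p \<le> B" "(1 + 2 * fst p) * exp (2 * T) \<le> B"
    "k * exp (2 * T) \<le> B" "exp (T\<^sup>2) \<le> B" "1 / l \<le> B"
    using f nn unfolding B_def by linarith+
  have iB: "1 / B \<le> fst p / 2" "1 / B \<le> l"
    using B f l0 by (auto simp: field_simps)
  have "fst q \<le> B \<and> snd q \<le> B \<and> (\<forall>S. K q S \<longrightarrow> adm B T S)" if q: "q \<in> params \<inter> U" for q
  proof (intro conjI allI impI)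
    have fq: "fst p / 2 < fst q" "fst q < 2 * fst p" "snd q < 2 * snd p" "snd q > 0" "q \<in> params"
      using q by (auto simp: U_def params_def)
    show "fst q \<le> B" "snd q \<le> B" using fq B by auto
    have kq: "kk q \<le> k" "kk q > 0"
    proof -
      have "real (n + 1) * snd q \<le> 3 * (2 * snd p)" using fq n f by (intro mult_mono) auto
      then show "kk q \<le> k" by (simp add: kk_def k_def)
      show "kk q > 0" using kk_pos[OF fq(5)] .
    qed
    fix S assume K: "K q S"
    show "adm B T S"
      unfolding adm_def
    proof (intro conjI allI impI ballI)
      fix s :: real assume s: "s \<in> {0..T}"
      then have s0: "s \<ge> 0" "s \<le> T" by auto
      have k: "S Slow s \<ge> fst q" "c + S Slow s \<le> (c + fst q) * exp (2 * s)" "S Pot s \<ge> 0"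
        "S Pot s \<le> kk q * (exp (2 * s) - 1) / 2" "S Sing s \<ge> low q s" "S Sing s \<le> exp (s\<^sup>2)"
        using K s0 unfolding K_def K_at_def by blast+
      have es: "exp (2 * s) \<le> exp (2 * T)" "exp (s\<^sup>2) \<le> exp (T\<^sup>2)"
        using s0 by (auto intro: power_mono)
      have "(c + fst q) * exp (2 * s) \<le> (1 + 2 * fst p) * exp (2 * T)"
        using cb fq f es by (intro mult_mono) auto
      then show "S Slow s \<in> {1 / B..B}" using k B iB fq cb by auto
      have "l \<le> low q s"
      proof -
        have "l \<le> fst q / (c + fst q) * exp (- 2 * s - kk q * exp (2 * s) / 2)"
          unfolding l_def
        proof (rule mult_mono)
          have "(fst p / 2) * (c + fst q) \<le> fst q * (1 + fst p / 2)"
            using mult_mono[of "fst p / 2" "fst q" c 1] f fq cb by (simp add: algebra_simps)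
          then show "fst p / 2 / (1 + fst p / 2) \<le> fst q / (c + fst q)"
            using f fq cb by (subst frac_le_eq) (auto simp: divide_le_0_iff intro!: add_pos_pos add_nonneg_pos)
          have "kk q * exp (2 * s) \<le> k * exp (2 * T)" using kq es by (intro mult_mono) auto
          then show "exp (- 2 * T - k * exp (2 * T) / 2) \<le> exp (- 2 * s - kk q * exp (2 * s) / 2)"
            using s0 by simp
        qed (use fq f cb in auto)
        then show ?thesis by (simp add: low_def)
      qed
      then have "1 / B \<le> S Sing s" using k(5) iB(2) by linarith
      moreover have "S Sing s \<le> B" using k(6) B(7) es(2) by linarith
      ultimately show "S Sing s \<in> {1 / B..B}" by simp
      have "kk q * (exp (2 * s) - 1) / 2 \<le> k * exp (2 * T)"
      proof -
        have "exp (2 * s) - 1 \<le> exp (2 * T)" using es(1) by linarith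
        then have "kk q * (exp (2 * s) - 1) \<le> k * exp (2 * T)" using kq s0 by (intro mult_mono) auto
        moreover have "0 \<le> kk q * (exp (2 * s) - 1)" using kq s0 by simp
        ultimately show ?thesis by simp
      qed
      then show "\<bar>S Pot s\<bar> \<le> B" using k B by auto
    qed (use B K_pos[OF K fq(5)] in auto)
  qed
  moreover have "open U" "p \<in> U" using f by (auto simp: U_def open_Times mem_Times_iff)
  ultimately show ?thesis by blast
qed

lemma jcont_Phi:
  assumes S: "\<And>i. jcont params (\<lambda>p. V p i)" and K: "\<And>p. p \<in> params \<Longrightarrow> K p (V p)"
  shows "jcont params (\<lambda>p. x1 (V p))" "jcont params (\<lambda>p. g1 p (V p))" "jcont params (\<lambda>p. h p (V p))"
    "jcont params (\<lambda>p. \<Phi> p (V p) i)"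
proof -
  have nz: "V p Slow r \<noteq> 0" "V p Sing r \<noteq> 0" if "p \<in> params" "r \<ge> 0" for p r
    using K_pos[OF K[OF that(1)] that] by auto
  have S': "jcont params (\<lambda>p r. V p i r)" for i using S[of i] by simp
  have A: "jcont params (\<lambda>p r. Av n (\<lambda>s. q p s) r)" if "jcont params (\<lambda>p r. q p r)" for q n
    using jcont_Av[of params q n] that by simp
  have kk: "jcont params (\<lambda>p r. kk p)" "jcont params (\<lambda>p r. fst p)"
    unfolding kk_def by (intro jcont_param continuous_intros)+
  show x1: "jcont params (\<lambda>p. x1 (V p))"
    unfolding x1_def[abs_def]
    by (intro jcont_mult jcont_r jcont_Jv jcont_exp S' jcont_add jcont_const) (use nz in auto)
  show g1: "jcont params (\<lambda>p. g1 p (V p))"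
    unfolding g1_def[abs_def]
    by (intro jcont_mult jcont_r jcont_Jv jcont_exp S' jcont_add jcont_const kk) (use nz in auto)
  show h: "jcont params (\<lambda>p. h p (V p))"
    unfolding h_def[abs_def] num_def
    by (intro jcont_divide jcont_add jcont_mult jcont_const jcont_r A jcont_exp S' kk) (use nz in auto)
  show "jcont params (\<lambda>p. \<Phi> p (V p) i)"
  proof (cases i)
    case Slow
    have "jcont params (\<lambda>p r. fst p + r * Av 0 (x1 (V p)) r)"
      using x1 by (intro jcont_add jcont_mult jcont_r kk) (use jcont_Av[OF x1] in simp)
    then show ?thesis using Slow by (simp add: \<Phi>_def)
  next
    case Pot
    have "jcont params (\<lambda>p r. r * Av 0 (g1 p (V p)) r)"
      using g1 by (intro jcont_mult jcont_r) (use jcont_Av[OF g1] in simp)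
    then show ?thesis using Pot by (simp add: \<Phi>_def)
  next
    case Sing
    then show ?thesis using jcont_Av[OF h] by (simp add: \<Phi>_def)
  qed
qed

sublocale causal \<Phi> K adm start
proof
  show "\<bar>S i s\<bar> \<le> B" if "adm B T S" "s \<in> {0..T}" for B T S i s
  proof -
    have a: "B \<ge> 1" "S Slow s \<in> {1 / B..B}" "S Sing s \<in> {1 / B..B}" "\<bar>S Pot s\<bar> \<le> B"
      using that by (auto simp: adm_def)
    have "1 / B > 0" using a by simp
    then have "0 < S Slow s" "0 < S Sing s" using a less_le_trans[of 0 "1 / B"] by simp_all
    then show ?thesis using a by (cases i) auto
  qed
  show "adm B' T S" if "adm B T S" "B \<le> B'" for B B' T S
  proof -
    have "1 / B' \<le> 1 / B" using that by (intro divide_left_mono) (auto simp: adm_def)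
    then show ?thesis using that unfolding adm_def by (fastforce intro: order_trans)
  qed
  show "jcont params (\<lambda>p. start p i)" for i
    by (cases i) (auto simp: start_def intro!: jcont_param jcont_const continuous_intros)
  show "K p L" if "\<And>n. K p (X n)" "\<And>c r. r \<ge> 0 \<Longrightarrow> (\<lambda>n. X n c r) \<longlonglongrightarrow> L c r" for p X L
    using that by (rule K_closed)
qed (fact contract K_imp_adm K_preserved K_const_start jcont_Phi(4))+

end

section \<open>Fixed points, regularity, and the differential equations\<close>

lemma zero_deriv_const:
  fixes u :: "real \<Rightarrow> real"
  assumes "continuous_on {0..} u" "\<And>r. r > 0 \<Longrightarrow> (u has_real_derivative 0) (at r)" "r \<ge> 0"
  shows "u r = u 0"
proof (cases "r = 0")
  case False
  then show ?thesis using assms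
    by (intro DERIV_isconst_end) (auto intro: continuous_on_subset)
qed simp

lemma eq_at_0:
  fixes u v :: "real \<Rightarrow> real"
  assumes "continuous_on {0..} u" "continuous_on {0..} v" "\<And>r. r > 0 \<Longrightarrow> u r = v r"
  shows "u 0 = v 0"
proof (rule tendsto_unique)
  show "(u \<longlongrightarrow> u 0) (at 0 within {0..})" using assms(1) by (simp add: continuous_on_def)
  have "(v \<longlongrightarrow> v 0) (at 0 within {0..})" using assms(2) by (simp add: continuous_on_def)
  then show "(u \<longlongrightarrow> v 0) (at 0 within {0..})"
    by (rule Lim_transform_eventually) (use assms(3) in \<open>auto simp: eventually_at_filter intro!: always_eventually\<close>)
qed (simp add: trivial_limit_within Ici_islimpt)

lemma deriv_at_pos:
  assumes "(f has_real_derivative d) (at r within {0..})" "r > 0"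
  shows "(f has_real_derivative d) (at r)"
proof -
  have "at r within {0..} = at r" by (rule at_within_interior) (use assms in \<open>auto simp: interior_Ici\<close>)
  then show ?thesis using assms by simp
qed

text \<open>Variation of constants: \<open>(W u)' = W q\<close> if and only if \<open>u' = q - u W' / W\<close>.\<close>

lemma weighted_product_deriv:
  fixes u W :: "real \<Rightarrow> real"
  assumes "(W has_real_derivative W r * \<kappa>) (at r)" "(u has_real_derivative q - u r * \<kappa>) (at r)"
  shows "((\<lambda>s. W s * u s) has_real_derivative W r * q) (at r)"
  by (rule DERIV_cong[OF DERIV_mult[OF assms]]) (simp add: algebra_simps)

lemma weighted_quotient_deriv:
  fixes u W Q :: "real \<Rightarrow> real"
  assumes r: "r > 0" and Q: "(Q has_real_derivative W r * q) (at r)"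
    and W: "(W has_real_derivative W r * \<kappa>) (at r)"
    and eq: "\<And>s. s > 0 \<Longrightarrow> W s > 0" "\<And>s. s > 0 \<Longrightarrow> Q s = W s * u s"
  shows "(u has_real_derivative q - u r * \<kappa>) (at r)"
proof -
  have W0: "W r \<noteq> 0" using eq(1)[OF r] by simp
  have "((\<lambda>s. Q s / W s) has_real_derivative q - u r * \<kappa>) (at r)"
    by (rule DERIV_cong[OF DERIV_divide[OF Q W W0]]) (use W0 in \<open>simp add: eq(2)[OF r] field_simps\<close>)
  then show ?thesis
    by (rule has_field_derivative_transform_within_open[of _ _ _ "{0<..}"])
      (use r eq in \<open>auto simp: less_imp_neq[symmetric]\<close>)
qed

lemma weight_exp_deriv:
  fixes v g :: "real \<Rightarrow> real"
  assumes "(v has_real_derivative d) (at r)" "(g has_real_derivative e) (at r)" "v r > 0"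
  shows "((\<lambda>s. v s * exp (g s)) has_real_derivative v r * exp (g r) * (d / v r + e)) (at r)"
  by (rule DERIV_cong[OF DERIV_mult[OF assms(1) DERIV_fun_exp[OF assms(2)]]])
    (use assms(3) in \<open>simp add: field_simps\<close>)

lemma weight_mult_deriv:
  fixes v w :: "real \<Rightarrow> real"
  assumes "(v has_real_derivative d) (at r)" "(w has_real_derivative w r * e) (at r)" "v r > 0"
  shows "((\<lambda>s. v s * w s) has_real_derivative v r * w r * (d / v r + e)) (at r)"
  by (rule DERIV_cong[OF DERIV_mult[OF assms(1,2)]]) (use assms(3) in \<open>simp add: field_simps\<close>)

context singular_ivp
begin

text \<open>Only positivity is demanded, not membership in \<open>K\<close>, so that a state read
  off from an arbitrary soliton qualifies.\<close>

definition fixed :: "real \<times> real \<Rightarrow> state \<Rightarrow> bool" where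
  "fixed p S \<longleftrightarrow> cont_state S \<and> (\<forall>s\<ge>0. S Slow s > 0 \<and> S Sing s > 0) \<and> (\<forall>i. \<forall>r\<ge>0. \<Phi> p S i r = S i r)"

definition U :: "state \<Rightarrow> real \<Rightarrow> real" where "U S r = r ^ n * S Sing r"
definition U1 :: "real \<times> real \<Rightarrow> state \<Rightarrow> real \<Rightarrow> real" where "U1 p S r = r ^ (n - 1) * h p S r"

lemma fixed_fixp: "p \<in> params \<Longrightarrow> fixed p (fixp p)"
  unfolding fixed_def using cont_fixp fixp_eq K_pos[OF K_fixp] by blast

context
  fixes p S assumes fx: "fixed p S"
begin

lemma fxD: "continuous_on {0..} (S i)" "r \<ge> 0 \<Longrightarrow> S Slow r > 0" "r \<ge> 0 \<Longrightarrow> S Sing r > 0"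
    "r \<ge> 0 \<Longrightarrow> \<Phi> p S i r = S i r"
  using fx by (auto simp: fixed_def cont_state_def)

lemma fx_cont: "continuous_on {0..} (x1 S)" "continuous_on {0..} (g1 p S)" "continuous_on {0..} (h p S)"
  using fx by (auto simp: fixed_def intro!: cont_x1)

lemma d_Slow: assumes r: "r \<ge> 0" shows "(S Slow has_real_derivative x1 S r) (at r within {0..})"
proof -
  have "((\<lambda>r. fst p + r * Av 0 (x1 S) r) has_real_derivative x1 S r) (at r within {0..})"
    using DERIV_add[OF DERIV_const Av0_antideriv[OF fx_cont(1) r]] by simp
  then show ?thesis
    by (rule has_field_derivative_transform_within[of _ _ _ _ 1])
      (use r fxD(4)[of _ Slow] in \<open>auto simp: \<Phi>_def\<close>)
qed

lemma d_Pot: assumes r: "r \<ge> 0" shows "(S Pot has_real_derivative g1 p S r) (at r within {0..})"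
  by (rule has_field_derivative_transform_within[OF Av0_antideriv[OF fx_cont(2) r], of 1])
    (use r fxD(4)[of _ Pot] in \<open>auto simp: \<Phi>_def\<close>)

lemma d_U: assumes r: "r \<ge> 0" shows "(U S has_real_derivative U1 p S r) (at r within {0..})"
proof -
  have "((\<lambda>r. r ^ (n - 1 + 1) * Av (n - 1) (h p S) r) has_real_derivative r ^ (n - 1) * h p S r) (at r within {0..})"
    by (rule Av_antideriv[OF fx_cont(3) r])
  then show ?thesis
    unfolding U1_def
    by (rule has_field_derivative_transform_within[of _ _ _ _ 1])
      (use r fxD(4)[of _ Sing] n in \<open>auto simp: \<Phi>_def U_def\<close>)
qed

lemma at_0: "S Slow 0 = fst p" "S Pot 0 = 0" "S Sing 0 = h p S 0 / n" "x1 S 0 = 0" "g1 p S 0 = 0" "U S 0 = 0"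
proof -
  have "real (n - 1) + 1 = n" using n by (simp add: of_nat_diff)
  then show "S Sing 0 = h p S 0 / n"
    using fxD(4)[of 0 Sing] by (simp add: \<Phi>_def Av_at_0 del: of_nat_diff)
  show "S Slow 0 = fst p" "S Pot 0 = 0"
    using fxD(4)[of 0 Slow] fxD(4)[of 0 Pot] by (simp_all add: \<Phi>_def)
  show "x1 S 0 = 0" "g1 p S 0 = 0" "U S 0 = 0"
    using n by (simp_all add: x1_def g1_def U_def)
qed

text \<open>Because t1 + t2 = n, \<open>h\<close> starts at n and \<open>Sing\<close> at 1. This is
  the condition b'(0) = 1 or a'(0) = 1 of the collapsing factor, built into the operator.\<close>

lemma Sing_0: "S Sing 0 = 1"
proof -
  have "h p S 0 = n"
  proof -
    have "h p S 0 = (t1 * fst p + t2 * fst p) / fst p" by (simp add: h_def num_def Av_at_0 at_0(1,2))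
    also have "\<dots> = n" using fxD(2)[of 0] t(3) by (simp add: at_0(1) flip: distrib_right)
    finally show ?thesis .
  qed
  then show ?thesis using at_0(3) n by simp
qed

lemma U_pos: "r > 0 \<Longrightarrow> U S r > 0"
  using fxD(3)[of r] by (simp add: U_def)

lemma d_Um: assumes r: "r > 0"
  shows "((\<lambda>s. U S s * exp (S Pot s)) has_real_derivative
    U S r * exp (S Pot r) * (U1 p S r / U S r + g1 p S r)) (at r)"
  using r by (intro weight_exp_deriv U_pos deriv_at_pos[OF d_U] deriv_at_pos[OF d_Pot]) auto

lemma d_x1: assumes r: "r > 0"
  shows "(x1 S has_real_derivative b * (c + S Slow r) - x1 S r * (U1 p S r / U S r + g1 p S r)) (at r)"
proof (rule weighted_quotient_deriv[OF r _ d_Um[OF r]])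
  define \<phi> where "\<phi> = (\<lambda>s. exp (S Pot s) * S Sing s * (b * (c + S Slow s)))"
  have "continuous_on {0..} \<phi>" unfolding \<phi>_def by (intro continuous_intros fxD)
  from deriv_at_pos[OF Av_antideriv[OF this] r] r
  show "((\<lambda>s. s ^ (n + 1) * Av n \<phi> s) has_real_derivative
      U S r * exp (S Pot r) * (b * (c + S Slow r))) (at r)"
    by (simp add: \<phi>_def U_def ac_simps)
  show "s ^ (n + 1) * Av n \<phi> s = U S s * exp (S Pot s) * x1 S s" if "s > 0" for s
    using that fxD(3)[of s] by (simp add: U_def x1_def Jv_def \<phi>_def)
qed (use U_pos in simp)

lemma d_g1: assumes r: "r > 0"
  shows "(g1 p S has_real_derivative kk p + 2 * S Pot r
      - g1 p S r * (x1 S r / S Slow r + U1 p S r / U S r + g1 p S r)) (at r)"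
proof -
  have W: "((\<lambda>s. S Slow s * (U S s * exp (S Pot s))) has_real_derivative
      S Slow r * (U S r * exp (S Pot r)) * (x1 S r / S Slow r + (U1 p S r / U S r + g1 p S r))) (at r)"
    using r by (intro weight_mult_deriv d_Um deriv_at_pos[OF d_Slow] fxD) auto
  define \<phi> where "\<phi> = (\<lambda>s. S Slow s * exp (S Pot s) * S Sing s * (kk p + 2 * S Pot s))"
  have "continuous_on {0..} \<phi>" unfolding \<phi>_def by (intro continuous_intros fxD)
  from deriv_at_pos[OF Av_antideriv[OF this] r] r
  have Q: "((\<lambda>s. s ^ (n + 1) * Av n \<phi> s) has_real_derivative
      S Slow r * (U S r * exp (S Pot r)) * (kk p + 2 * S Pot r)) (at r)"
    by (simp add: \<phi>_def U_def ac_simps)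
  have "s ^ (n + 1) * Av n \<phi> s = S Slow s * (U S s * exp (S Pot s)) * g1 p S s" if "s > 0" for s
    using that fxD(2,3)[of s] by (simp add: U_def g1_def Jv_def \<phi>_def)
  from weighted_quotient_deriv[OF r Q W _ this] show ?thesis
    using U_pos fxD(2) by (simp add: add.assoc)
qed

end

text \<open>For \<open>n = 2\<close> the term \<open>t2 * fst p\<close> is absent, for \<open>n = 1\<close> it is the constant of integration.\<close>

lemma d_num:
  assumes S: "\<And>i. continuous_on {0..} (S i)" and r: "r > 0"
  shows "((\<lambda>s. s ^ (n - 1) * (num p S s - t2 * fst p)) has_real_derivative
    S Slow r * exp (S Pot r) * (t1 + n * U S r)) (at r)"
proof -
  have r0: "r \<ge> 0" using r by simp
  let ?xm = "\<lambda>s. S Slow s * exp (S Pot s)" and ?xmz = "\<lambda>s. S Slow s * exp (S Pot s) * S Sing s"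
  have c: "continuous_on {0..} ?xm" "continuous_on {0..} ?xmz" by (intro continuous_intros S)+
  note D1 = DERIV_cmult[OF deriv_at_pos[OF Av0_antideriv[OF c(1) r0] r]]
    and D2 = DERIV_cmult[OF deriv_at_pos[OF Av_antideriv[OF c(2) r0] r]]
  consider "n = 1" | "n = 2" using n by linarith
  then show ?thesis
  proof cases
    case 1
    then show ?thesis unfolding num_def U_def using D2[of 1 1] tt
      by (simp add: power2_eq_square mult.assoc mult.commute)
  next
    case 2
    have "((\<lambda>s. 2 * (s * Av 0 ?xm s) + 2 * (s ^ (2 + 1) * Av 2 ?xmz s)) has_real_derivative
        2 * ?xm r + 2 * (r ^ 2 * ?xmz r)) (at r)"
      by (rule DERIV_add[OF D1 D2])
    moreover have "(\<lambda>s. 2 * (s * Av 0 ?xm s) + 2 * (s ^ (2 + 1) * Av 2 ?xmz s))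
        = (\<lambda>s. s ^ (n - 1) * (num p S s - t2 * fst p))"
      unfolding num_def using 2 tt by (auto simp: power3_eq_cube algebra_simps)
    moreover have "2 * ?xm r + 2 * (r ^ 2 * ?xmz r) = S Slow r * exp (S Pot r) * (t1 + n * U S r)"
      unfolding U_def using 2 tt by (simp add: algebra_simps)
    ultimately show ?thesis by simp
  qed
qed

text \<open>For n = 2 both sides are 0, for n = 1 the exponent is 0.\<close>

lemma t2_pow: "t2 * s ^ (n - 1) = t2"
  using tt n by (cases "n = 2") auto

lemma d_U1: assumes fx: "fixed p S" and r: "r > 0"
  shows "(U1 p S has_real_derivative t1 + n * U S r - U1 p S r * (x1 S r / S Slow r + g1 p S r)) (at r)"
proof (rule weighted_quotient_deriv[OF r])
  note fx' = fxD[OF fx]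
  show "((\<lambda>s. S Slow s * exp (S Pot s)) has_real_derivative
      S Slow r * exp (S Pot r) * (x1 S r / S Slow r + g1 p S r)) (at r)"
    using r by (intro weight_exp_deriv fx' deriv_at_pos[OF d_Slow[OF fx]] deriv_at_pos[OF d_Pot[OF fx]]) auto
  show "((\<lambda>s. s ^ (n - 1) * (num p S s - t2 * fst p) + t2 * fst p) has_real_derivative
      S Slow r * exp (S Pot r) * (t1 + n * U S r)) (at r)"
    using DERIV_add[OF d_num[OF fx'(1) r, of p] DERIV_const[of "t2 * fst p"]] by simp
  fix s :: real assume s: "s > 0"
  show "S Slow s * exp (S Pot s) > 0" using fx'(2)[of s] s by simp
  have "s ^ (n - 1) * (num p S s - t2 * fst p) + t2 * fst p
      = s ^ (n - 1) * num p S s - (t2 * s ^ (n - 1)) * fst p + t2 * fst p"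
    by (simp add: algebra_simps)
  then show "s ^ (n - 1) * (num p S s - t2 * fst p) + t2 * fst p = S Slow s * exp (S Pot s) * U1 p S s"
    unfolding t2_pow using fx'(2)[of s] s by (simp add: U1_def h_def)
qed

text \<open>Bootstrapping by one derivative per round. \<open>Slow\<close> and \<open>Pot\<close>
  gain it because their derivatives are expressions of the current regularity. For
  \<open>Sing\<close>, a bare average, the gain must come from \<open>num\<close>.\<close>

lemma fixed_ck: assumes fx: "fixed p S"
  shows "ck j (S i)"
proof -
  note fx' = fxD[OF fx]
  have xm_pos: "S Slow r * exp (S Pot r) > 0" if "r \<ge> 0" for r using fx'(2)[OF that] by simp
  have mz_pos: "exp (S Pot r) * S Sing r > 0" if "r \<ge> 0" for r using fx'(3)[OF that] by simp
  have xmz_pos: "S Slow r * exp (S Pot r) * S Sing r > 0" if "r \<ge> 0" for r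
    using fx'(2,3)[OF that] by simp
  have "ck j (S Slow) \<and> ck j (S Pot) \<and> ck j (S Sing)"
  proof (induction j)
    case 0
    then show ?case using fx' by simp
  next
    case (Suc j)
    then have j: "ck j (S Slow)" "ck j (S Pot)" "ck j (S Sing)" by auto
    have x1: "ck j (x1 S)" unfolding x1_def[abs_def] Jv_def
      by (intro ck_mult ck_ident ck_divide ck_Av ck_exp ck_add ck_const j mz_pos)
    have g1: "ck j (g1 p S)" unfolding g1_def[abs_def] Jv_def
      by (intro ck_mult ck_ident ck_divide ck_Av ck_exp ck_add ck_const j xmz_pos)
    have h0: "ck j (h p S)" unfolding h_def[abs_def] num_def
      by (intro ck_mult ck_ident ck_divide ck_Av ck_exp ck_add ck_const j xm_pos)
    have sx: "ck (Suc j) (S Slow)" by (rule ck_SucI[OF d_Slow[OF fx] x1])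
    have sg: "ck (Suc j) (S Pot)" by (rule ck_SucI[OF d_Pot[OF fx] g1])
    have cU1: "ck j (U1 p S)" unfolding U1_def[abs_def] by (intro ck_mult ck_power ck_ident h0)
    have sU: "ck (Suc j) (U S)" by (rule ck_SucI[OF d_U[OF fx] cU1])
    have xmU: "ck (Suc j) (\<lambda>s. S Slow s * exp (S Pot s) * U S s)"
      by (intro ck_mult ck_exp sx sg sU)
    \<comment> \<open>Expresses the last term of \<open>num\<close> through U instead of
      \<open>Sing\<close>: U has already gained a derivative since U' is \<open>U1\<close>, whereas
      \<open>Sing\<close> has not.\<close>
    have e: "r * (r * Av n (\<lambda>s. S Slow s * exp (S Pot s) * S Sing s) r)
        = r ^ (2 - n) * Av 0 (\<lambda>s. S Slow s * exp (S Pot s) * U S s) r" for r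
    proof -
      have "(\<lambda>s. S Slow s * exp (S Pot s) * U S s) = (\<lambda>s. s ^ n * (S Slow s * exp (S Pot s) * S Sing s))"
        by (simp add: U_def ac_simps)
      then have e0: "Av 0 (\<lambda>s. S Slow s * exp (S Pot s) * U S s) r = r ^ n * Av n (\<lambda>s. S Slow s * exp (S Pot s) * S Sing s) r"
        using Av_power[of 0 n "\<lambda>s. S Slow s * exp (S Pot s) * S Sing s" r] by simp
      have e1: "r ^ (2 - n) * r ^ n = r * r" using n by (simp flip: power_add power2_eq_square)
      show ?thesis unfolding e0 mult.assoc[symmetric] e1 ..
    qed
    have "ck (Suc j) (num p S)" unfolding num_def[abs_def] e
      by (intro ck_mult ck_Av ck_exp ck_add ck_const ck_power ck_ident sx sg xmU)
    then have "ck (Suc j) (h p S)" unfolding h_def[abs_def]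
      by (intro ck_divide ck_mult ck_exp sx sg xm_pos)
    then have "ck (Suc j) (\<Phi> p S Sing)" by (simp only: \<Phi>_def comp.case ck_Av)
    then have "ck (Suc j) (S Sing)" by (rule ck_cong) (use fx'(4) in auto)
    then show ?case using sx sg by blast
  qed
  then show ?thesis by (cases i) auto
qed

lemma U_ck: assumes "fixed p S" shows "ck j (U S)"
  unfolding U_def[abs_def] by (intro ck_mult ck_power ck_ident fixed_ck[OF assms])

text \<open>Converse direction: a solution of the differential equations, regular at 0, solves the
  integral equations. Regularity of the collapsing factor is encoded by writing U' as
  \<open>r^(n-1) * H\<close> with H continuous up to 0; for n = 1 the value \<open>H 0\<close>
  supplies the constant of integration.\<close>

lemma fixed_char:
  assumes S: "\<And>i. continuous_on {0..} (S i)" "\<And>s. s \<ge> 0 \<Longrightarrow> S Slow s > 0" "\<And>s. s \<ge> 0 \<Longrightarrow> S Sing s > 0"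
    and c: "continuous_on {0..} X1" "continuous_on {0..} G1" "continuous_on {0..} H"
    and i: "S Slow 0 = fst p" "S Pot 0 = 0" "n = 1 \<Longrightarrow> H 0 = 1"
    and d: "\<And>r. r > 0 \<Longrightarrow> (S Slow has_real_derivative X1 r) (at r)"
      "\<And>r. r > 0 \<Longrightarrow> (S Pot has_real_derivative G1 r) (at r)"
      "\<And>r. r > 0 \<Longrightarrow> (U S has_real_derivative r ^ (n - 1) * H r) (at r)"
      "\<And>r. r > 0 \<Longrightarrow> (X1 has_real_derivative b * (c + S Slow r)
          - X1 r * (r ^ (n - 1) * H r / U S r + G1 r)) (at r)"
      "\<And>r. r > 0 \<Longrightarrow> (G1 has_real_derivative kk p + 2 * S Pot r
          - G1 r * (X1 r / S Slow r + r ^ (n - 1) * H r / U S r + G1 r)) (at r)"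
      "\<And>r. r > 0 \<Longrightarrow> ((\<lambda>r. r ^ (n - 1) * H r) has_real_derivative t1 + n * U S r
          - r ^ (n - 1) * H r * (X1 r / S Slow r + G1 r)) (at r)"
  shows "fixed p S"
proof -
  have Up: "U S r > 0" if "r > 0" for r using S(3)[of r] that by (simp add: U_def)
  have n0: "n \<noteq> 0" using n by simp
  have Um: "((\<lambda>s. U S s * exp (S Pot s)) has_real_derivative
      U S r * exp (S Pot r) * (r ^ (n - 1) * H r / U S r + G1 r)) (at r)" if "r > 0" for r
    using that by (intro weight_exp_deriv d Up)
  have x1: "x1 S r = X1 r" if r: "r > 0" for r
  proof -
    have "U S r * exp (S Pot r) * X1 r = r ^ (n + 1) * Av n (\<lambda>s. exp (S Pot s) * S Sing s * (b * (c + S Slow s))) r"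
    proof (rule antideriv_unique[where u = "\<lambda>r. U S r * exp (S Pot r) * X1 r"])
      show "((\<lambda>r. U S r * exp (S Pot r) * X1 r) has_real_derivative
          r ^ n * (exp (S Pot r) * S Sing r * (b * (c + S Slow r)))) (at r)" if "r > 0" for r
        using weighted_product_deriv[OF Um d(4)] that by (simp add: U_def ac_simps)
    qed (use r n0 in \<open>auto simp: U_def intro!: continuous_intros S c\<close>)
    then show ?thesis using r S(3)[of r] by (simp add: U_def x1_def Jv_def field_simps)
  qed
  have g1: "g1 p S r = G1 r" if r: "r > 0" for r
  proof -
    have "S Slow r * (U S r * exp (S Pot r)) * G1 r
      = r ^ (n + 1) * Av n (\<lambda>s. S Slow s * exp (S Pot s) * S Sing s * (kk p + 2 * S Pot s)) r"
    proof (rule antideriv_unique[where u = "\<lambda>r. S Slow r * (U S r * exp (S Pot r)) * G1 r"])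
      fix r :: real assume r: "r > 0"
      have "((\<lambda>r. S Slow r * (U S r * exp (S Pot r)) * G1 r) has_real_derivative
          S Slow r * (U S r * exp (S Pot r)) * (kk p + 2 * S Pot r)) (at r)"
        using r d(5)[OF r] S(2)[of r]
        by (intro weighted_product_deriv[OF weight_mult_deriv[OF d(1)[OF r] Um[OF r]]]) (auto simp: add.assoc)
      then show "((\<lambda>r. S Slow r * (U S r * exp (S Pot r)) * G1 r) has_real_derivative
          r ^ n * (S Slow r * exp (S Pot r) * S Sing r * (kk p + 2 * S Pot r))) (at r)"
        by (simp add: U_def ac_simps)
    qed (use r n0 in \<open>auto simp: U_def intro!: continuous_intros S c\<close>)
    then show ?thesis using r S(2,3)[of r] by (simp add: U_def g1_def Jv_def field_simps)
  qed
  have cs: "cont_state S" using S(1) by (simp add: cont_state_def)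
  have cc: "continuous_on {0..} (x1 S)" "continuous_on {0..} (g1 p S)" "continuous_on {0..} (h p S)"
    "continuous_on {0..} (num p S)"
    using cont_x1[OF cs] S by auto
  have h: "h p S r = H r" if r: "r > 0" for r
  proof -
    define u where "u = (\<lambda>r. S Slow r * exp (S Pot r) * (r ^ (n - 1) * H r) - r ^ (n - 1) * (num p S r - t2 * fst p))"
    have "u r = u 0"
    proof (rule zero_deriv_const)
      show "continuous_on {0..} u" unfolding u_def by (intro continuous_intros S c cc)
      fix r :: real assume r: "r > 0"
      have "((\<lambda>r. S Slow r * exp (S Pot r) * (r ^ (n - 1) * H r)) has_real_derivative
          S Slow r * exp (S Pot r) * (t1 + n * U S r)) (at r)"
        using r by (intro weighted_product_deriv[OF weight_exp_deriv[OF d(1)[OF r] d(2)[OF r] S(2)] d(6)]) auto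
      from DERIV_diff[OF this d_num[of S r p, OF S(1) r]]
      show "(u has_real_derivative 0) (at r)"
        by (simp add: u_def)
    qed (use r in simp)
    \<comment> \<open>Kept uniform in n through \<open>0^(n-1)\<close>, which is 1 for n = 1 and 0
      for n = 2.\<close>
    also have "u 0 = t2 * fst p * (0 ^ (n - 1) - 1 + 1) - t2 * fst p * 1 * 1 + (fst p * (0 ^ (n - 1) * H 0)) - 0 ^ (n - 1) * num p S 0 + t2 * fst p"
      using i by (simp add: u_def algebra_simps)
    also have "\<dots> = t2 * fst p"
    proof -
      consider "n = 1" | "n = 2" using n by linarith
      then show ?thesis unfolding num_def using i tt by cases (auto simp: Av_at_0)
    qed
    finally have "u r = t2 * fst p" .
    then have "S Slow r * exp (S Pot r) * (r ^ (n - 1) * H r) = r ^ (n - 1) * num p S r"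
    proof -
      have "u r = S Slow r * exp (S Pot r) * (r ^ (n - 1) * H r) - r ^ (n - 1) * num p S r + (t2 * r ^ (n - 1)) * fst p"
        by (simp add: u_def algebra_simps)
      then show ?thesis using \<open>u r = t2 * fst p\<close> unfolding t2_pow by simp
    qed
    then have "r ^ (n - 1) * (S Slow r * exp (S Pot r) * H r) = r ^ (n - 1) * num p S r"
      by (simp only: mult.left_commute)
    then have "S Slow r * exp (S Pot r) * H r = num p S r" using r by simp
    then show ?thesis using S(2)[of r] r by (simp add: h_def field_simps)
  qed
  have Slow: "\<Phi> p S Slow r = S Slow r" if r: "r \<ge> 0" for r
  proof -
    have "S Slow r - fst p = r ^ (0 + 1) * Av 0 (x1 S) r"
      by (rule antideriv_unique[OF _ _ cc(1) _ r]) (use DERIV_diff[OF d(1) DERIV_const] x1 i in \<open>auto intro!: continuous_intros S\<close>)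
    then show ?thesis by (simp add: \<Phi>_def)
  qed
  have Pot: "\<Phi> p S Pot r = S Pot r" if r: "r \<ge> 0" for r
  proof -
    have "S Pot r = r ^ (0 + 1) * Av 0 (g1 p S) r"
      by (rule antideriv_unique[OF _ _ cc(2) _ r]) (use d(2) g1 i in \<open>auto intro!: continuous_intros S\<close>)
    then show ?thesis by (simp add: \<Phi>_def)
  qed
  have Sing': "\<Phi> p S Sing r = S Sing r" if r: "r > 0" for r
  proof -
    have "U S r = r ^ (n - 1 + 1) * Av (n - 1) (h p S) r"
      by (rule antideriv_unique[OF _ _ cc(3)]) (use d(3) h r n0 in \<open>auto simp: U_def[abs_def] intro!: continuous_intros S\<close>)
    then show ?thesis using r n by (simp add: \<Phi>_def U_def)
  qed
  moreover have "\<Phi> p S Sing 0 = S Sing 0"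
    by (rule eq_at_0[OF _ S(1) Sing']) (auto simp: \<Phi>_def intro!: continuous_on_Av cc)
  ultimately have Sing: "\<Phi> p S Sing r = S Sing r" if "r \<ge> 0" for r
    using that by (cases "r = 0") auto
  have "\<Phi> p S i r = S i r" if "r \<ge> 0" for i r
    using Slow Pot Sing that by (cases i) auto
  then show ?thesis using cs S by (simp add: fixed_def)
qed

text \<open>Compactness of [0, T] bounds the unknowns and the inverses of the positive ones;
  uniqueness thus applies to every fixed point.\<close>

lemma fixed_adm:
  assumes "fixed p S" shows "\<exists>B. adm B T S"
proof -
  note fx' = fxD[OF assms]
  have "\<exists>B\<ge>1. \<forall>s\<in>{0..T}. \<bar>f s\<bar> \<le> B" if "continuous_on {0..} f" for f :: "real \<Rightarrow> real"
  proof -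
    have "bounded (f ` {0..T})"
      by (intro compact_imp_bounded compact_continuous_image continuous_on_subset[OF that]) auto
    then obtain B where "\<forall>s\<in>{0..T}. \<bar>f s\<bar> \<le> B" by (auto simp: bounded_iff)
    then show ?thesis by (intro exI[of _ "max B 1"]) (auto intro: le_max_iff_disj[THEN iffD2])
  qed note bd = this
  have ci: "continuous_on {0..} (\<lambda>s. inverse (S Slow s))" "continuous_on {0..} (\<lambda>s. inverse (S Sing s))"
    using fx'(2,3) by (auto intro!: continuous_intros fx' simp: less_imp_neq[symmetric])
  obtain B1 B2 B3 B4 B5 where B: "B1 \<ge> 1" "B2 \<ge> 1" "B3 \<ge> 1" "B4 \<ge> 1" "B5 \<ge> 1"
    and b: "\<And>s. s \<in> {0..T} \<Longrightarrow> \<bar>S Slow s\<bar> \<le> B1" "\<And>s. s \<in> {0..T} \<Longrightarrow> \<bar>S Sing s\<bar> \<le> B2"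
      "\<And>s. s \<in> {0..T} \<Longrightarrow> \<bar>S Pot s\<bar> \<le> B3" "\<And>s. s \<in> {0..T} \<Longrightarrow> \<bar>inverse (S Slow s)\<bar> \<le> B4"
      "\<And>s. s \<in> {0..T} \<Longrightarrow> \<bar>inverse (S Sing s)\<bar> \<le> B5"
    using bd[OF fx'(1)[of Slow]] bd[OF fx'(1)[of Sing]] bd[OF fx'(1)[of Pot]] bd[OF ci(1)] bd[OF ci(2)] by metis
  define B where "B = B1 + B2 + B3 + B4 + B5"
  have B': "B \<ge> 1" "B1 \<le> B" "B2 \<le> B" "B3 \<le> B" "B4 \<le> B" "B5 \<le> B" using B by (auto simp: B_def)
  have inv: "1 / B \<le> x" if "x > 0" "\<bar>inverse x\<bar> \<le> B" for x
    using that B'(1) by (simp add: field_simps)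
  have "adm B T S" unfolding adm_def
  proof (intro conjI allI impI ballI)
    fix s assume s: "s \<in> {0..T}"
    have "S Slow s > 0" "S Sing s > 0" using fx'(2,3) s by auto
    then show "S Slow s \<in> {1 / B..B}" "S Sing s \<in> {1 / B..B}" "\<bar>S Pot s\<bar> \<le> B"
      using b[OF s] B' inv[of "S Slow s"] inv[of "S Sing s"] by auto
  qed (use B' fx' in auto)
  then show ?thesis ..
qed

lemma fixed_unique:
  assumes "p \<in> params" "fixed p S" "r \<ge> 0"
  shows "S i r = fixp p i r"
proof -
  note S = assms(2) and F = fixed_fixp[OF assms(1)]
  show ?thesis
    by (rule fixp_unique[OF assms(1,3) _ _ fixed_adm[OF S] _ _ fixed_adm[OF F]])
      (use S F in \<open>unfold fixed_def, blast\<close>)+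
qed

end

subsection \<open>Solitons and the conserved form\<close>

lemma D_pos:
  assumes "(f has_real_derivative d) (at r)" "r > 0"
  shows "D f r = d"
  using has_deriv_D[of f d r] has_field_derivative_at_within[OF assms(1)] assms(2) by simp

lemma DD_pos:
  assumes "\<And>r. r > 0 \<Longrightarrow> (f has_real_derivative f1 r) (at r)" "(f1 has_real_derivative d) (at r)" "r > 0"
  shows "D (D f) r = d"
proof (rule D_pos[OF _ assms(3)])
  show "(D f has_real_derivative d) (at r)"
    by (rule has_field_derivative_transform_within_open[OF assms(2), of "{0<..}"])
      (use assms(3) D_pos[OF assms(1)] in auto)
qed

context flow
begin

lemma d_sqrt:
  assumes r: "r > 0" shows "((\<lambda>r. sqrt (Y r)) has_real_derivative b1 r) (at r)"
  using DERIV_chain'[OF dY[OF r] DERIV_real_sqrt[OF Y_pos[OF r]]]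
  by (simp add: b1_def field_simps)

text \<open>The equations for a'' and b'' are \<open>da1\<close> and \<open>dY1\<close> rewritten
  with b = sqrt Y. After inserting them, the equation for f'' is exactly the vanishing of
  \<open>G\<close>.\<close>

lemma flow_soliton:
  assumes "smooth_halfline a" "smooth_halfline (\<lambda>r. sqrt (Y r))" "smooth_halfline (\<lambda>r. - g r)"
  shows "soliton a (\<lambda>r. sqrt (Y r)) (\<lambda>r. - g r)"
  unfolding soliton_def
proof (intro conjI assms allI impI)
  fix r :: real assume r: "r > 0"
  show pos: "a r > 0" "sqrt (Y r) > 0" using a_pos[OF r] Y_pos[OF r] by auto
  define s where "s = sqrt (Y r)"
  have s: "s > 0" "Y r = s\<^sup>2" using pos Y_pos[OF r] by (auto simp: s_def)
  note dsq = d_sqrt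
  have "((\<lambda>r. Y1 r / (2 * sqrt (Y r))) has_real_derivative
     ((2 + 2 * Y r - Y1 r * (a1 r / a r + g1 r)) * (2 * sqrt (Y r)) - Y1 r * (2 * b1 r))
       / (2 * sqrt (Y r) * (2 * sqrt (Y r)))) (at r)"
    using pos by (intro DERIV_divide dY1 DERIV_cmult dsq r) auto
  then have db1: "(b1 has_real_derivative
     ((2 + 2 * s\<^sup>2 - Y1 r * (a1 r / a r + g1 r)) * (2 * s) - Y1 r * (2 * b1 r)) / (2 * s * (2 * s))) (at r)"
    by (simp add: b1_def[abs_def] s(2) abs_of_pos[OF s(1)])
  have Y1: "Y1 r = 2 * s * b1 r" using s(1) by (simp add: b1_def s_def[symmetric])
  have Da: "D a r = a1 r" "D (D a) r = a r - a1 r * (Y1 r / Y r + g1 r)"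
    by (rule D_pos[OF da[OF r] r], rule DD_pos[OF da da1[OF r] r])
  have Db: "D (\<lambda>r. sqrt (Y r)) r = b1 r" by (rule D_pos[OF dsq[OF r] r])
  have DDb: "D (D (\<lambda>r. sqrt (Y r))) r
      = ((2 + 2 * s\<^sup>2 - Y1 r * (a1 r / a r + g1 r)) * (2 * s) - Y1 r * (2 * b1 r)) / (2 * s * (2 * s))"
    by (rule DD_pos[OF dsq db1 r])
  have df: "((\<lambda>r. - g r) has_real_derivative - g1 r) (at r)" if "r > 0" for r
    by (rule DERIV_minus[OF dg[OF that]])
  have Df: "D (\<lambda>r. - g r) r = - g1 r" "D (D (\<lambda>r. - g r)) r = - v' r"
    by (rule D_pos[OF df[OF r] r], rule DD_pos[OF df DERIV_minus[OF dg1'[OF r]] r])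
  have AB: "A r = a1 r / a r" "B r = b1 r / s" using s by (auto simp: A_def B_def Y1 power2_eq_square)
  have 1: "D (D a) r / a r = 1 - A r * (2 * B r + g1 r)"
    using pos s by (simp add: Da AB Y1 field_simps power2_eq_square)
  have 2: "D (D (\<lambda>r. sqrt (Y r))) r / sqrt (Y r) = 1 / Y r + 1 - B r * (A r + g1 r) - (B r)\<^sup>2"
    using pos(1) s(1) by (simp add: DDb AB Y1 s(2) s_def[symmetric] field_simps power2_eq_square)
  show "D (D (\<lambda>r. - g r)) r = D (D a) r / a r + 2 * (D (D (\<lambda>r. sqrt (Y r))) r / sqrt (Y r)) - 1"
    unfolding 1 2 Df using G_zero[OF r]
    by (simp add: G_def v'_def xi_def algebra_simps power2_eq_square)
  show "D (D a) r = - 2 * (D a r * D (\<lambda>r. sqrt (Y r)) r / sqrt (Y r)) + D a r * D (\<lambda>r. - g r) r + a r"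
    using s(1) by (simp add: Da Db Df Y1 s(2) s_def[symmetric] field_simps power2_eq_square)
  show "D (D (\<lambda>r. sqrt (Y r))) r = (1 - (D (\<lambda>r. sqrt (Y r)) r)\<^sup>2) / sqrt (Y r)
      - D a r * D (\<lambda>r. sqrt (Y r)) r / a r + D (\<lambda>r. sqrt (Y r)) r * D (\<lambda>r. - g r) r + sqrt (Y r)"
    using pos(1) s(1) by (simp add: DDb Da Db Df Y1 s(2) s_def[symmetric] field_simps power2_eq_square)
qed

lemma D_sqrt: "r > 0 \<Longrightarrow> D (\<lambda>r. sqrt (Y r)) r = b1 r"
  by (rule D_pos[OF d_sqrt])

lemma D_a: "r > 0 \<Longrightarrow> D a r = a1 r"
  by (rule D_pos[OF da])

lemma bounded_at_1_eq: "bounded_at_1 M \<longleftrightarrow> a1 1 / a 1 \<le> M \<and> Y1 1 / (2 * Y 1) \<le> M \<and> 1 / Y 1 \<le> M \<and>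
    a1 1 / a 1 + 2 * (Y1 1 / (2 * Y 1)) + g1 1 \<le> M \<and> 1 / M \<le> g1 1 \<and>
    1 / M \<le> k + 2 * g 1 - g1 1 * (a1 1 / a 1 + 2 * (Y1 1 / (2 * Y 1)) + g1 1)"
  by (simp add: bounded_at_1_def v'_def xi_def A_def B_def)

text \<open>Strict inequalities, so that by continuity the same M serves for all nearby
  parameters.\<close>

lemma exists_bound: "\<exists>M\<ge>1. a1 1 / a 1 < M \<and> Y1 1 / (2 * Y 1) < M \<and> 1 / Y 1 < M \<and>
    a1 1 / a 1 + 2 * (Y1 1 / (2 * Y 1)) + g1 1 < M \<and> 1 / M < g1 1 \<and>
    1 / M < k + 2 * g 1 - g1 1 * (a1 1 / a 1 + 2 * (Y1 1 / (2 * Y 1)) + g1 1)"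
proof -
  have g: "g1 1 > 0" "v' 1 > 0" using g1_pos[of 1] v'_pos[of 1] by auto
  define M where "M = 1 + \<bar>A 1\<bar> + \<bar>B 1\<bar> + \<bar>1 / Y 1\<bar> + \<bar>xi 1\<bar> + 1 / g1 1 + 1 / v' 1"
  have i: "1 / g1 1 > 0" "1 / v' 1 > 0" using g by auto
  have M: "M \<ge> 1" "A 1 < M" "B 1 < M" "1 / Y 1 < M" "xi 1 < M" "1 / g1 1 < M" "1 / v' 1 < M"
    using i unfolding M_def by linarith+
  have "1 / M < g1 1" "1 / M < v' 1" using M(1,6,7) g by (auto simp: field_simps)
  with M show ?thesis by (intro exI[of _ M]) (simp add: v'_def xi_def A_def B_def)
qed

end

section \<open>Limits of the slopes and their continuity\<close>

lemma bound_tendsto_exp: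
  fixes q :: "real \<Rightarrow> real"
  assumes "\<And>r. r \<ge> R \<Longrightarrow> \<bar>ln (q r) - l\<bar> \<le> K / r" "\<And>r. r > 0 \<Longrightarrow> q r > 0"
  shows "(q \<longlongrightarrow> exp l) at_top"
proof -
  have "((\<lambda>r. ln (q r) - l) \<longlongrightarrow> 0) at_top"
  proof (rule Lim_null_comparison)
    show "\<forall>\<^sub>F r in at_top. norm (ln (q r) - l) \<le> K / r"
      using eventually_ge_at_top[of R] by eventually_elim (use assms(1) in simp)
    show "((\<lambda>r. K / r) \<longlongrightarrow> 0) at_top"
      by (intro tendsto_divide_0[OF tendsto_const] filterlim_at_top_imp_at_infinity filterlim_ident)
  qed
  then have "((\<lambda>r. ln (q r)) \<longlongrightarrow> l) at_top" by (simp add: LIM_zero_iff)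
  then have "((\<lambda>r. exp (ln (q r))) \<longlongrightarrow> exp l) at_top" by (rule tendsto_exp)
  then show ?thesis
    by (rule Lim_transform_eventually)
      (use eventually_gt_at_top[of 0] in \<open>eventually_elim, simp add: assms(2)\<close>)
qed

lemma local_uniform_limit_continuous:
  fixes q :: "real \<times> real \<Rightarrow> real \<Rightarrow> real" and l :: "real \<times> real \<Rightarrow> real"
  assumes c: "\<And>r. r > 0 \<Longrightarrow> continuous_on P (\<lambda>p. q p r)"
    and b: "\<And>p0. p0 \<in> P \<Longrightarrow> \<exists>U R K. open U \<and> p0 \<in> U \<and> (\<forall>p\<in>P \<inter> U. \<forall>r\<ge>R. \<bar>q p r - l p\<bar> \<le> K / r)"
  shows "continuous_on P l"
  unfolding continuous_on_eq_continuous_within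
proof
  fix p0 assume p0: "p0 \<in> P"
  from b[OF this] obtain U R K where U: "open U" "p0 \<in> U"
    and K: "\<And>p r. p \<in> P \<inter> U \<Longrightarrow> r \<ge> R \<Longrightarrow> \<bar>q p r - l p\<bar> \<le> K / r" by blast
  have "uniform_limit (P \<inter> U) (\<lambda>r p. q p r) l at_top"
    unfolding uniform_limit_iff
  proof (intro allI impI)
    fix e :: real assume e: "e > 0"
    have "((\<lambda>r. K / r) \<longlongrightarrow> 0) at_top"
      by (intro tendsto_divide_0[OF tendsto_const] filterlim_at_top_imp_at_infinity filterlim_ident)
    then have "\<forall>\<^sub>F r in at_top. K / r < e" using e by (rule order_tendstoD)
    then show "\<forall>\<^sub>F r in at_top. \<forall>p\<in>P \<inter> U. dist (q p r) (l p) < e"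
      using eventually_ge_at_top[of R] by eventually_elim (use K in \<open>force simp: dist_real_def\<close>)
  qed
  moreover have "\<forall>\<^sub>F r in at_top. continuous_on (P \<inter> U) (\<lambda>p. q p r)"
    using eventually_gt_at_top[of "0::real"] by eventually_elim (auto intro: continuous_on_subset[OF c])
  ultimately have "continuous_on (P \<inter> U) l"
    by (intro uniform_limit_theorem) auto
  then have "continuous (at p0 within P \<inter> U) l"
    using p0 U by (auto simp: continuous_on_eq_continuous_within)
  moreover have "at p0 within P \<inter> U = at p0 within P"
    by (rule at_within_nhd[of _ U]) (use U in auto)
  ultimately show "continuous (at p0 within P) l" by simp
qed

text \<open>The constants \<open>flow.RR M\<close> and \<open>flow.K3 M\<close> involve no solution,
  and one M works near each parameter. So the logarithms of the slopes converge uniformly there, and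
  their limits are continuous.\<close>

lemma slopes_continuous:
  fixes kf :: "real \<times> real \<Rightarrow> real" and a a1 Y Y1 g g1 :: "real \<times> real \<Rightarrow> real \<Rightarrow> real"
  assumes fl: "\<And>p. p \<in> params \<Longrightarrow> flow (kf p) (a p) (a1 p) (Y p) (Y1 p) (g p) (g1 p)"
    and jc: "jcont params a" "jcont params a1" "jcont params Y" "jcont params Y1" "jcont params g" "jcont params g1"
    and kf: "continuous_on params kf"
    and sol: "\<And>p. p \<in> params \<Longrightarrow> soliton (a p) (\<lambda>r. sqrt (Y p r)) (\<lambda>r. - g p r)"
      "\<And>p. p \<in> params \<Longrightarrow> bc (fst p) (- snd p) (a p) (\<lambda>r. sqrt (Y p r)) (\<lambda>r. - g p r)"
    and unique: "\<And>p a' b' f' r. p \<in> params \<Longrightarrow> soliton a' b' f' \<Longrightarrow> bc (fst p) (- snd p) a' b' f' \<Longrightarrow>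
      r \<ge> 0 \<Longrightarrow> a' r = a p r \<and> b' r = sqrt (Y p r)"
  shows "slopes bc \<in> params \<rightarrow> {0<..} \<times> {0<..} \<and> continuous_on params (slopes bc)"
proof -
  define bb where "bb p = flow.b1 (Y p) (Y1 p)" for p
  have bb: "bb p r = Y1 p r / (2 * sqrt (Y p r))" if "p \<in> params" for p r
    unfolding bb_def by (rule flow.b1_def[OF fl[OF that]])
  have pos: "a p r > 0" "Y p r > 0" "a1 p r > 0" "bb p r > 0" if "p \<in> params" "r > 0" for p r
    using flow.a_pos[OF fl] flow.Y_pos[OF fl] flow.a1_pos[OF fl] flow.b1_pos[OF fl] that
    unfolding bb_def by blast+
  \<comment> \<open>\<open>flow.bounded_at_1\<close> written out, which exhibits its continuous
    dependence on p.\<close>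
  define bd where "bd p M \<longleftrightarrow> a1 p 1 / a p 1 \<le> M \<and> Y1 p 1 / (2 * Y p 1) \<le> M \<and> 1 / Y p 1 \<le> M \<and>
    a1 p 1 / a p 1 + 2 * (Y1 p 1 / (2 * Y p 1)) + g1 p 1 \<le> M \<and> 1 / M \<le> g1 p 1 \<and>
    1 / M \<le> kf p + 2 * g p 1 - g1 p 1 * (a1 p 1 / a p 1 + 2 * (Y1 p 1 / (2 * Y p 1)) + g1 p 1)" for p M
  have lim: "\<exists>l. \<forall>r\<ge>flow.RR M. \<bar>ln (a1 p r) - l\<bar> \<le> flow.K3 M / r"
      "\<exists>l. \<forall>r\<ge>flow.RR M. \<bar>ln (bb p r) - l\<bar> \<le> flow.K3 M / r"
    if "p \<in> params" "M \<ge> 1" "bd p M" for p M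
  proof -
    have "flow.bounded_at_1 (kf p) (a p) (a1 p) (Y p) (Y1 p) (g p) (g1 p) M"
      using that unfolding flow.bounded_at_1_eq[OF fl[OF that(1)]] bd_def by blast
    from flow.slopes_limit[OF fl[OF that(1)] that(2) this]
    show "\<exists>l. \<forall>r\<ge>flow.RR M. \<bar>ln (a1 p r) - l\<bar> \<le> flow.K3 M / r"
      "\<exists>l. \<forall>r\<ge>flow.RR M. \<bar>ln (bb p r) - l\<bar> \<le> flow.K3 M / r"
      unfolding bb_def by blast+
  qed
  have nbhd: "\<exists>U M. open U \<and> p0 \<in> U \<and> M \<ge> 1 \<and> (\<forall>p\<in>params \<inter> U. bd p M)" if p0: "p0 \<in> params" for p0
  proof -
    obtain M where M: "M \<ge> 1" and lt: "a1 p0 1 / a p0 1 < M" "Y1 p0 1 / (2 * Y p0 1) < M" "1 / Y p0 1 < M"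
      "a1 p0 1 / a p0 1 + 2 * (Y1 p0 1 / (2 * Y p0 1)) + g1 p0 1 < M" "1 / M < g1 p0 1"
      "1 / M < kf p0 + 2 * g p0 1 - g1 p0 1 * (a1 p0 1 / a p0 1 + 2 * (Y1 p0 1 / (2 * Y p0 1)) + g1 p0 1)"
      using flow.exists_bound[OF fl[OF p0]] by blast
    have c1: "continuous_on params (\<lambda>p. a p 1)" "continuous_on params (\<lambda>p. a1 p 1)" "continuous_on params (\<lambda>p. Y p 1)"
      "continuous_on params (\<lambda>p. Y1 p 1)" "continuous_on params (\<lambda>p. g p 1)" "continuous_on params (\<lambda>p. g1 p 1)"
      using jc by (auto intro: jcont_at)
    have nz: "a p 1 \<noteq> 0" "Y p 1 \<noteq> 0" "2 * Y p 1 \<noteq> 0" if "p \<in> params" for p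
      using pos[OF that, of 1] by auto
    have c2: "continuous_on params (\<lambda>p. a1 p 1 / a p 1)" "continuous_on params (\<lambda>p. Y1 p 1 / (2 * Y p 1))"
      "continuous_on params (\<lambda>p. 1 / Y p 1)"
      by (intro continuous_intros c1 ballI nz; assumption)+
    have c3: "continuous_on params (\<lambda>p. a1 p 1 / a p 1 + 2 * (Y1 p 1 / (2 * Y p 1)) + g1 p 1)"
      by (intro continuous_on_add continuous_on_mult_left c1 c2)
    have c4: "continuous_on params (\<lambda>p. kf p + 2 * g p 1 - g1 p 1 * (a1 p 1 / a p 1 + 2 * (Y1 p 1 / (2 * Y p 1)) + g1 p 1))"
      by (intro continuous_on_diff continuous_on_add continuous_on_mult continuous_on_const kf c1 c3)
    have ev: "\<forall>\<^sub>F p in at p0 within params. q p < m" if "continuous_on params q" "q p0 < m" for q :: "real \<times> real \<Rightarrow> real" and m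
      using that p0 by (auto simp: continuous_on_def intro: order_tendstoD)
    have ev': "\<forall>\<^sub>F p in at p0 within params. m < q p" if "continuous_on params q" "m < q p0" for q :: "real \<times> real \<Rightarrow> real" and m
      using that p0 by (auto simp: continuous_on_def intro: order_tendstoD)
    have "\<forall>\<^sub>F p in at p0 within params. bd p M"
      using ev[OF c2(1) lt(1)] ev[OF c2(2) lt(2)] ev[OF c2(3) lt(3)] ev[OF c3 lt(4)] ev'[OF c1(6) lt(5)] ev'[OF c4 lt(6)]
      by eventually_elim (simp add: bd_def less_imp_le)
    then obtain U where U: "open U" "p0 \<in> U" "\<And>p. p \<in> U \<Longrightarrow> p \<noteq> p0 \<Longrightarrow> p \<in> params \<Longrightarrow> bd p M"
      unfolding eventually_at_topological by auto
    have "bd p0 M" unfolding bd_def using lt by (intro conjI less_imp_le)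
    then have "\<forall>p\<in>params \<inter> U. bd p M" using U(3) by (metis IntE)
    then show ?thesis using U(1,2) M by (intro exI[of _ U] exI[of _ M] conjI)
  qed
  have "\<exists>la lb. (a1 p \<longlongrightarrow> exp la) at_top \<and> (bb p \<longlongrightarrow> exp lb) at_top" if p: "p \<in> params" for p
  proof -
    obtain M where M: "M \<ge> 1" "bd p M" using nbhd[OF p] p by blast
    from lim[OF p this] obtain la lb where
      "\<And>r. r \<ge> flow.RR M \<Longrightarrow> \<bar>ln (a1 p r) - la\<bar> \<le> flow.K3 M / r"
      "\<And>r. r \<ge> flow.RR M \<Longrightarrow> \<bar>ln (bb p r) - lb\<bar> \<le> flow.K3 M / r" by blast
    then show ?thesis using bound_tendsto_exp pos[OF p] by blast
  qed
  then obtain la lb where l: "\<And>p. p \<in> params \<Longrightarrow> (a1 p \<longlongrightarrow> exp (la p)) at_top"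
    "\<And>p. p \<in> params \<Longrightarrow> (bb p \<longlongrightarrow> exp (lb p)) at_top" by metis
  have cont: "continuous_on params ll"
    if q: "\<And>r. r > 0 \<Longrightarrow> continuous_on params (\<lambda>p. q p r)" "\<And>p r. p \<in> params \<Longrightarrow> r > 0 \<Longrightarrow> q p r > 0"
      and ql: "\<And>p. p \<in> params \<Longrightarrow> (q p \<longlongrightarrow> exp (ll p)) at_top"
      and qb: "\<And>p M. p \<in> params \<Longrightarrow> M \<ge> 1 \<Longrightarrow> bd p M \<Longrightarrow> \<exists>l. \<forall>r\<ge>flow.RR M. \<bar>ln (q p r) - l\<bar> \<le> flow.K3 M / r"
    for q ll
  proof (rule local_uniform_limit_continuous[where q = "\<lambda>p r. ln (q p r)"])
    show "continuous_on params (\<lambda>p. ln (q p r))" if r: "r > 0" for r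
      using q(2)[OF _ r] by (intro continuous_on_ln q(1) r) force
    fix p0 assume "p0 \<in> params"
    from nbhd[OF this] obtain U M where U: "open U" "p0 \<in> U" "M \<ge> 1" and M: "\<And>p. p \<in> params \<inter> U \<Longrightarrow> bd p M" by blast
    have "\<bar>ln (q p r) - ll p\<bar> \<le> flow.K3 M / r" if p: "p \<in> params \<inter> U" and r: "r \<ge> flow.RR M" for p r
    proof -
      from qb[OF _ U(3) M[OF p]] p obtain l where l: "\<And>r. r \<ge> flow.RR M \<Longrightarrow> \<bar>ln (q p r) - l\<bar> \<le> flow.K3 M / r" by blast
      \<comment> \<open>The l of the estimate could depend on M; uniqueness of limits identifies it
        with the previously chosen \<open>ll p\<close>.\<close>
      have "(q p \<longlongrightarrow> exp l) at_top" using p by (intro bound_tendsto_exp[OF l] q(2)) auto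
      with ql[of p] p have "exp l = exp (ll p)"
        by (intro tendsto_unique[OF trivial_limit_at_top_linorder]) auto
      then show ?thesis using l[OF r] by simp
    qed
    then show "\<exists>U R K. open U \<and> p0 \<in> U \<and> (\<forall>p\<in>params \<inter> U. \<forall>r\<ge>R. \<bar>ln (q p r) - ll p\<bar> \<le> K / r)"
      using U by blast
  qed
  have cla: "continuous_on params la"
    by (rule cont[of a1]) (use jcont_at[OF jc(2)] pos lim l in auto)
  have cb: "continuous_on params (\<lambda>p. bb p r)" if r: "r > 0" for r
  proof -
    have "continuous_on params (\<lambda>p. Y1 p r / (2 * sqrt (Y p r)))"
      using r pos(2)[OF _ r] by (intro continuous_intros jcont_at[OF jc(4)] jcont_at[OF jc(3)]) force+
    then show ?thesis by (rule continuous_on_eq) (simp add: bb)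
  qed
  have clb: "continuous_on params lb"
    by (rule cont[of bb, OF cb pos(4) l(2) lim(2)])
  have slopes: "slopes bc p = (exp (la p), exp (lb p))" if p: "p \<in> params" for p
    unfolding slopes_def
  proof (rule the_equality)
    have da: "(D (a p) \<longlongrightarrow> exp (la p)) at_top"
      by (rule Lim_transform_eventually[OF l(1)[OF p]])
        (use eventually_gt_at_top[of 0] in \<open>eventually_elim, simp add: flow.D_a[OF fl[OF p]]\<close>)
    have db: "(D (\<lambda>r. sqrt (Y p r)) \<longlongrightarrow> exp (lb p)) at_top"
      by (rule Lim_transform_eventually[OF l(2)[OF p]])
        (use eventually_gt_at_top[of 0] in \<open>eventually_elim, simp add: flow.D_sqrt[OF fl[OF p]] bb_def\<close>)
    show "\<exists>a b f. soliton a b f \<and> bc (fst p) (- snd p) a b f \<and>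
      (D a \<longlongrightarrow> fst (exp (la p), exp (lb p))) at_top \<and> (D b \<longlongrightarrow> snd (exp (la p), exp (lb p))) at_top"
      using sol[OF p] da db by (intro exI[of _ "a p"] exI[of _ "\<lambda>r. sqrt (Y p r)"] exI[of _ "\<lambda>r. - g p r"]) simp
    fix s assume "\<exists>a b f. soliton a b f \<and> bc (fst p) (- snd p) a b f \<and>
      (D a \<longlongrightarrow> fst s) at_top \<and> (D b \<longlongrightarrow> snd s) at_top"
    then obtain a' b' f' where s: "soliton a' b' f'" "bc (fst p) (- snd p) a' b' f'"
      and sl: "(D a' \<longlongrightarrow> fst s) at_top" "(D b' \<longlongrightarrow> snd s) at_top" by blast
    \<comment> \<open>Two solutions are compared on {0..} only; since \<open>D\<close> is relative
      to {0..}, that determines their derivatives.\<close>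
    have eq: "D u r = D u' r" if "r > 0" "\<And>r. r \<ge> 0 \<Longrightarrow> u r = u' r" "smooth_halfline u" for u u' r
    proof -
      have "(u has_real_derivative D u r) (at r within {0..})"
        using smooth_deriv[OF that(3), of r 0] that(1) by simp
      then have "(u' has_real_derivative D u r) (at r within {0..})"
        by (rule has_field_derivative_transform_within[of _ _ _ _ 1]) (use that in auto)
      then show ?thesis using has_deriv_D that(1) by fastforce
    qed
    have sm: "smooth_halfline a'" "smooth_halfline b'" using s(1) by (auto simp: soliton_def)
    have e: "D a' r = D (a p) r" "D b' r = D (\<lambda>r. sqrt (Y p r)) r" if "r > 0" for r
      using unique[OF p s] that by (auto intro!: eq sm)
    have "\<forall>\<^sub>F r in at_top. D (a p) r = D a' r" "\<forall>\<^sub>F r in at_top. D (\<lambda>r. sqrt (Y p r)) r = D b' r"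
      using eventually_gt_at_top[of "0::real"] by (eventually_elim, simp add: e)+
    then have "(D a' \<longlongrightarrow> exp (la p)) at_top" "(D b' \<longlongrightarrow> exp (lb p)) at_top"
      using Lim_transform_eventually da db by blast+
    with sl have "fst s = exp (la p)" "snd s = exp (lb p)"
      by (auto intro: tendsto_unique[OF trivial_limit_at_top_linorder])
    then show "s = (exp (la p), exp (lb p))" by (simp add: prod_eq_iff)
  qed
  have "continuous_on params (\<lambda>p. (exp (la p), exp (lb p)))" by (intro continuous_intros cla clb)
  then have "continuous_on params (slopes bc)" by (rule continuous_on_eq) (simp add: slopes)
  then show ?thesis using slopes by auto
qed

section \<open>Behaviour at r = 0\<close>

lemma quotient_limit_0:
  fixes u :: "real \<Rightarrow> real"
  assumes "(u has_real_derivative d) (at 0 within {0..})" "u 0 = 0"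
  shows "((\<lambda>r. u r / r) \<longlongrightarrow> d) (at 0 within {0..})"
  using assms by (simp add: has_field_derivative_iff)

lemma mult_deriv_0:
  fixes J :: "real \<Rightarrow> real"
  assumes "continuous_on {0..} J"
  shows "((\<lambda>r. r * J r) has_real_derivative J 0) (at 0 within {0..})"
proof -
  have "(J \<longlongrightarrow> J 0) (at 0 within {0..})" using assms by (simp add: continuous_on_def)
  then have "((\<lambda>r. (r * J r - 0 * J 0) / (r - 0)) \<longlongrightarrow> J 0) (at 0 within {0..})"
    by (rule Lim_transform_eventually) (auto simp: eventually_at_filter)
  then show ?thesis by (simp add: has_field_derivative_iff)
qed

lemma DD_at_0:
  assumes "\<And>r. r \<ge> 0 \<Longrightarrow> (f has_real_derivative f1 r) (at r within {0..})"
    "(f1 has_real_derivative d) (at 0 within {0..})"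
  shows "D (D f) 0 = d"
proof (rule has_deriv_D)
  show "(D f has_real_derivative d) (at 0 within {0..})"
    by (rule has_field_derivative_transform_within[OF assms(2), of 1]) (use has_deriv_D[OF assms(1)] in auto)
qed simp

lemma continuous_on_halflineI:
  fixes u v :: "real \<Rightarrow> real"
  assumes "continuous_on {0<..} v" "\<And>r. r > 0 \<Longrightarrow> u r = v r" "(v \<longlongrightarrow> u 0) (at 0 within {0..})"
  shows "continuous_on {0..} u"
  unfolding continuous_on_def
proof
  fix x :: real assume "x \<in> {0..}"
  then consider "x = 0" | "x > 0" by fastforce
  then show "(u \<longlongrightarrow> u x) (at x within {0..})"
  proof cases
    case 1
    show ?thesis unfolding 1
      by (rule Lim_transform_eventually[OF assms(3)]) (use assms(2) in \<open>auto simp: eventually_at_filter\<close>)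
  next
    case 2
    have i: "at x within {0..} = at x" "at x within {0<..} = at x"
      using 2 by (auto intro!: at_within_interior simp: interior_Ici interior_open)
    have "(v \<longlongrightarrow> v x) (at x)" using assms(1) 2 i(2) unfolding continuous_on_def by (metis greaterThan_iff)
    then have "(u \<longlongrightarrow> v x) (at x)"
    proof (rule Lim_transform_eventually)
      have "\<forall>\<^sub>F y in at x. y > 0" using 2 by (intro order_tendstoD(1)[OF tendsto_ident_at])
      then show "\<forall>\<^sub>F y in at x. v y = u y" by eventually_elim (simp add: assms(2))
    qed
    then show ?thesis using assms(2)[OF 2] i(1) by simp
  qed
qed

section \<open>The first integral of an arbitrary soliton\<close>

context
  fixes a b f assumes sol: "soliton a b f"
begin

lemma sol_smooth: "smooth_halfline a" "smooth_halfline b" "smooth_halfline f"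
  using sol by (auto simp: soliton_def)

lemma sol_within:
  assumes "r \<ge> 0" "u \<in> {a, b, f}"
  shows "(u has_real_derivative D u r) (at r within {0..})"
    "(D u has_real_derivative D (D u) r) (at r within {0..})"
    "((D u) \<longlongrightarrow> D u r) (at r within {0..})" "(D (D u) \<longlongrightarrow> D (D u) r) (at r within {0..})"
    "(u \<longlongrightarrow> u r) (at r within {0..})"
proof -
  have s: "smooth_halfline u" using assms(2) sol_smooth by auto
  show 1: "(u has_real_derivative D u r) (at r within {0..})"
    "(D u has_real_derivative D (D u) r) (at r within {0..})"
    using smooth_deriv[OF s assms(1), of 0] smooth_deriv[OF s assms(1), of 1] by simp_all
  have 3: "(D (D u) has_real_derivative D (D (D u)) r) (at r within {0..})"
    using smooth_deriv[OF s assms(1), of 2] by (simp add: numeral_2_eq_2)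
  show "((D u) \<longlongrightarrow> D u r) (at r within {0..})" "(D (D u) \<longlongrightarrow> D (D u) r) (at r within {0..})"
    "(u \<longlongrightarrow> u r) (at r within {0..})"
    using DERIV_continuous[OF 1(1)] DERIV_continuous[OF 1(2)] DERIV_continuous[OF 3]
    by (auto simp: continuous_within)
qed

lemma sol_cont:
  assumes "u \<in> {a, b, f}" shows "continuous_on {0..} u" "continuous_on {0..} (D u)"
  using sol_within[OF _ assms] by (auto simp: continuous_on_def)

lemma sol_at:
  assumes "r > 0" "u \<in> {a, b, f}"
  shows "(u has_real_derivative D u r) (at r)" "(D u has_real_derivative D (D u) r) (at r)"
  using sol_within(1,2)[OF _ assms(2), of r] assms(1) by (auto intro: deriv_at_pos)

lemma sol_eqs:
  assumes "r > 0"
  shows "a r > 0" "b r > 0" "D (D f) r = D (D a) r / a r + 2 * (D (D b) r / b r) - 1"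
    "D (D a) r = - 2 * (D a r * D b r / b r) + D a r * D f r + a r"
    "D (D b) r = (1 - (D b r)\<^sup>2) / b r - D a r * D b r / a r + D b r * D f r + b r"
  using sol assms unfolding soliton_def by blast+

text \<open>\<open>E\<close> is the conserved quantity with f'' eliminated by the first soliton
  equation, so no third derivative of f arises. Its derivative collapses to
  \<open>2 * (A + 2 * B - f' - xi)\<close>, which is 0 by the definition of
  \<open>xi\<close>.\<close>

lemma conservation:
  "\<exists>C. \<forall>r>0. D (D f) r + (D a r / a r + 2 * (D b r / b r) - D f r) * D f r - 2 * f r = C"
proof -
  define A where "A r = D a r / a r" for r
  define B where "B r = D b r / b r" for r
  define xi where "xi r = A r + 2 * B r - D f r" for r
  define E where "E r = (A r)\<^sup>2 + 2 * (B r)\<^sup>2 - (xi r)\<^sup>2 + 2 + 2 / (b r)\<^sup>2 - 2 * f r" for r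
  have q: "D (D a) r / a r = - 2 * (A r * B r) + A r * D f r + 1"
    "D (D b) r / b r = 1 / (b r)\<^sup>2 - (B r)\<^sup>2 - A r * B r + B r * D f r + 1"
    if "r > 0" for r
    using sol_eqs(1,2)[OF that] unfolding sol_eqs(4,5)[OF that] A_def B_def
    by (simp_all add: field_simps power2_eq_square)
  have dA: "(A has_real_derivative 1 - xi r * A r) (at r)" if r: "r > 0" for r
  proof -
    have "(A has_real_derivative (D (D a) r * a r - D a r * D a r) / (a r * a r)) (at r)"
      unfolding A_def[abs_def] using sol_at[OF r] sol_eqs(1)[OF r] by (intro DERIV_divide) auto
    also have "(D (D a) r * a r - D a r * D a r) / (a r * a r) = D (D a) r / a r - A r * A r"
      using sol_eqs(1)[OF r] by (simp add: A_def diff_divide_distrib)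
    finally show ?thesis by (simp add: q[OF r] xi_def algebra_simps)
  qed
  have dB: "(B has_real_derivative 1 + 1 / (b r)\<^sup>2 - xi r * B r) (at r)" if r: "r > 0" for r
  proof -
    have "(B has_real_derivative (D (D b) r * b r - D b r * D b r) / (b r * b r)) (at r)"
      unfolding B_def[abs_def] using sol_at[OF r] sol_eqs(2)[OF r] by (intro DERIV_divide) auto
    also have "(D (D b) r * b r - D b r * D b r) / (b r * b r) = D (D b) r / b r - B r * B r"
      using sol_eqs(2)[OF r] by (simp add: B_def diff_divide_distrib)
    finally show ?thesis by (simp add: q[OF r] xi_def algebra_simps power2_eq_square)
  qed
  have ddf: "D (D f) r = (1 - xi r * A r) + (A r)\<^sup>2 + 2 * (1 + 1 / (b r)\<^sup>2 - xi r * B r + (B r)\<^sup>2) - 1" if r: "r > 0" for r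
    unfolding sol_eqs(3)[OF r] q[OF r] by (simp add: xi_def algebra_simps power2_eq_square)
  have dxi: "(xi has_real_derivative 1 - (A r)\<^sup>2 - 2 * (B r)\<^sup>2) (at r)" if r: "r > 0" for r
  proof -
    have "(xi has_real_derivative (1 - xi r * A r) + 2 * (1 + 1 / (b r)\<^sup>2 - xi r * B r) - D (D f) r) (at r)"
      unfolding xi_def[abs_def] using sol_at(2)[OF r]
      by (intro DERIV_add DERIV_diff DERIV_cmult dA[OF r, unfolded xi_def] dB[OF r, unfolded xi_def]) auto
    then show ?thesis by (rule DERIV_cong) (simp add: ddf[OF r])
  qed
  have "(E has_real_derivative 0) (at r within {0<..})" if "r \<in> {0<..}" for r
  proof -
    have r: "r > 0" using that by simp
    have db: "((\<lambda>r. 2 / (b r)\<^sup>2) has_real_derivative - 4 * (B r / (b r)\<^sup>2)) (at r)"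
      by (rule derivative_eq_intros sol_at(1)[OF r] refl)+
        (use sol_eqs(2)[OF r] in \<open>auto simp: B_def power2_eq_square field_simps\<close>)
    have "(E has_real_derivative 2 * A r * (1 - xi r * A r) + 2 * (2 * B r * (1 + 1 / (b r)\<^sup>2 - xi r * B r))
       - 2 * xi r * (1 - (A r)\<^sup>2 - 2 * (B r)\<^sup>2) - 4 * (B r / (b r)\<^sup>2) - 2 * D f r) (at r)"
      unfolding E_def[abs_def]
      by (rule derivative_eq_intros dA[OF r] dB[OF r] dxi[OF r] db sol_at(1)[OF r, of f] refl | simp)+
    moreover have "2 * A r * (1 - xi r * A r) + 2 * (2 * B r * (1 + 1 / (b r)\<^sup>2 - xi r * B r))
       - 2 * xi r * (1 - (A r)\<^sup>2 - 2 * (B r)\<^sup>2) - 4 * (B r / (b r)\<^sup>2) - 2 * D f r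
       = 2 * (A r + 2 * B r - D f r - xi r)"
      by (simp add: algebra_simps power2_eq_square)
    ultimately show ?thesis by (auto simp: xi_def intro: has_field_derivative_at_within)
  qed
  then obtain C where C: "\<And>r. r \<in> {0<..} \<Longrightarrow> E r = C"
    using has_field_derivative_zero_constant[of "{0<..}" E] by auto
  have "D (D f) r + (D a r / a r + 2 * (D b r / b r) - D f r) * D f r - 2 * f r = E r" if r: "r > 0" for r
  proof -
    have "(D a r / a r + 2 * (D b r / b r) - D f r) = xi r" by (simp add: xi_def A_def B_def)
    moreover have "xi r * D f r = xi r * A r + 2 * (xi r * B r) - (xi r)\<^sup>2"
    proof -
      have e: "D f r = A r + 2 * B r - xi r" by (simp add: xi_def)
      show ?thesis by (subst e) (simp add: algebra_simps power2_eq_square)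
    qed
    ultimately show ?thesis unfolding ddf[OF r] E_def by (simp add: algebra_simps)
  qed
  then show ?thesis using C by auto
qed

text \<open>The constant is found by letting r tend to 0; c is the contribution of the collapsing
  factor, where a singular logarithmic derivative meets the zero of f'.\<close>

lemma conservation_value:
  assumes f0: "D f 0 = 0" "f 0 = 0"
    and lim: "((\<lambda>r. (D a r / a r + 2 * (D b r / b r)) * D f r) \<longlongrightarrow> c) (at 0 within {0..})" and r: "r > 0"
  shows "D (D f) r + (D a r / a r + 2 * (D b r / b r) - D f r) * D f r - 2 * f r = D (D f) 0 + c"
proof -
  obtain C where C: "\<And>r. r > 0 \<Longrightarrow> D (D f) r + (D a r / a r + 2 * (D b r / b r) - D f r) * D f r - 2 * f r = C"
    using conservation by blast
  have f: "(f \<longlongrightarrow> 0) (at 0 within {0..})" "(D f \<longlongrightarrow> 0) (at 0 within {0..})"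
    "(D (D f) \<longlongrightarrow> D (D f) 0) (at 0 within {0..})"
    using sol_within(3-5)[of 0 f] f0 by auto
  have "((\<lambda>r. D (D f) r + (D a r / a r + 2 * (D b r / b r)) * D f r - D f r * D f r - 2 * f r)
     \<longlongrightarrow> D (D f) 0 + c - 0 * 0 - 2 * 0) (at 0 within {0..})"
    by (intro tendsto_intros lim f)
  then have "((\<lambda>_. C) \<longlongrightarrow> D (D f) 0 + c - 0 * 0 - 2 * 0) (at (0::real) within {0..})"
  proof (rule Lim_transform_eventually)
    have "D (D f) r + (D a r / a r + 2 * (D b r / b r)) * D f r - D f r * D f r - 2 * f r = C" if "r > 0" for r
      using C[OF that] by (simp add: left_diff_distrib)
    then show "\<forall>\<^sub>F r in at 0 within {0..}.
        D (D f) r + (D a r / a r + 2 * (D b r / b r)) * D f r - D f r * D f r - 2 * f r = C"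
      unfolding eventually_at_filter by (intro always_eventually) auto
  qed
  moreover have "((\<lambda>_. C) \<longlongrightarrow> C) (at (0::real) within {0..})" by simp
  ultimately have "C = D (D f) 0 + c - 0 * 0 - 2 * 0"
    by (intro tendsto_unique[of "at (0::real) within {0..}"]) (auto simp: trivial_limit_within Ici_islimpt)
  then show ?thesis using C[OF r] by simp
qed

end

context singular_ivp
begin

text \<open>The average of the constant \<open>kk\<close> at 0 is \<open>kk / (n + 1)\<close>; the
  normalisation of \<open>kk\<close> therefore makes g''(0) the prescribed parameter.\<close>

lemma g1_deriv_0:
  assumes fx: "fixed p S"
  shows "(g1 p S has_real_derivative snd p) (at 0 within {0..})"
proof -
  note fx' = fxD[OF fx]
  let ?J = "Jv n (\<lambda>s. S Slow s * exp (S Pot s) * S Sing s) (\<lambda>s. kk p + 2 * S Pot s)"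
  have "continuous_on {0..} ?J"
    using fx' by (intro continuous_on_Jv continuous_intros) auto
  from mult_deriv_0[OF this] have "(g1 p S has_real_derivative ?J 0) (at 0 within {0..})"
    by (simp add: g1_def[abs_def])
  moreover have "?J 0 = snd p"
  proof -
    have "S Slow 0 * exp (S Pot 0) * S Sing 0 \<noteq> 0" using fx'(2,3)[of 0] by simp
    then show ?thesis by (simp add: Jv_def Av_at_0 at_0(2)[OF fx] kk_def)
  qed
  ultimately show ?thesis by simp
qed

lemma jcont_solution:
  "jcont params (\<lambda>p. x1 (fixp p))" "jcont params (\<lambda>p. g1 p (fixp p))"
  "jcont params (\<lambda>p. U (fixp p))" "jcont params (\<lambda>p. U1 p (fixp p))"
proof -
  note J = jcont_Phi[where V = fixp, OF jcont_fixp K_fixp]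
  show "jcont params (\<lambda>p. x1 (fixp p))" "jcont params (\<lambda>p. g1 p (fixp p))"
    using J(1,2) by simp_all
  show "jcont params (\<lambda>p. U (fixp p))"
    unfolding U_def[abs_def] by (rule jcont_mult[OF jcont_power[OF jcont_r] jcont_fixp])
  show "jcont params (\<lambda>p. U1 p (fixp p))"
    unfolding U1_def[abs_def] by (rule jcont_mult[OF jcont_power[OF jcont_r] J(3)])
qed

text \<open>Known for the constructed solution through \<open>K\<close>, and passed on to any fixed
  point by uniqueness.\<close>

lemma Pot_nonneg: "p \<in> params \<Longrightarrow> fixed p S \<Longrightarrow> r > 0 \<Longrightarrow> S Pot r \<ge> 0"
  using K_fixp[of p] fixed_unique[of p S r Pot] by (auto simp: K_def K_at_def)

lemma U1_0: "fixed p S \<Longrightarrow> n = 1 \<Longrightarrow> U1 p S 0 = 1"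
  unfolding U1_def using at_0(3)[of p S] Sing_0[of p S] by simp

lemma U1_cont: assumes "fixed p S" shows "continuous_on {0..} (U1 p S)" "continuous_on {0..} (U S)"
  unfolding U1_def[abs_def] U_def[abs_def]
  by (intro continuous_intros fx_cont[OF assms] fxD[OF assms])+

end

lemma jcont_reparam:
  assumes "jcont P h" "continuous_on P q" "q ` P \<subseteq> P"
  shows "jcont P (\<lambda>p. h (q p))"
  unfolding jcont_def
proof (rule continuous_on_compose2[OF assms(1)[unfolded jcont_def], where f = "\<lambda>z. (q (fst z), snd z)", simplified])
  show "continuous_on (P \<times> {0..}) (\<lambda>z. (q (fst z), snd z :: real))"
    by (intro continuous_intros continuous_on_compose2[OF assms(2)]) auto
  show "(\<lambda>z. (q (fst z), snd z)) ` (P \<times> {0..}) \<subseteq> P \<times> {0..}" using assms(3) by auto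
qed

subsection \<open>\<open>S\<^sup>1 \<times> \<real>\<^sup>3\<close>\<close>

text \<open>Sources: a for the function a, and 2 + 2 Y for the collapsing function Y.\<close>

interpretation R3: singular_ivp 2 0 1 2 0
  by standard auto

lemma R3_flow:
  assumes p: "p \<in> params" and fx: "R3.fixed p S"
  shows "flow (R3.kk p) (S Slow) (R3.x1 S) (R3.U S) (R3.U1 p S)
    (S Pot) (R3.g1 p S)"
proof -
  show ?thesis
  proof (unfold_locales)
    fix r :: real assume r: "r > 0"
    then have r0: "r \<ge> 0" by simp
    show "(S Slow has_real_derivative R3.x1 S r) (at r)"
      "(R3.U S has_real_derivative R3.U1 p S r) (at r)"
      "(S Pot has_real_derivative R3.g1 p S r) (at r)"
      by (intro deriv_at_pos[OF _ r] R3.d_Slow[OF fx r0] R3.d_U[OF fx r0] R3.d_Pot[OF fx r0])+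
    show "(R3.x1 S has_real_derivative S Slow r
        - R3.x1 S r * (R3.U1 p S r / R3.U S r + R3.g1 p S r)) (at r)"
      using R3.d_x1[OF fx r] by simp
    show "(R3.U1 p S has_real_derivative 2 + 2 * R3.U S r
        - R3.U1 p S r * (R3.x1 S r / S Slow r + R3.g1 p S r)) (at r)"
      using R3.d_U1[OF fx r] by simp
    show "(R3.g1 p S has_real_derivative R3.kk p + 2 * S Pot r
        - R3.g1 p S r * (R3.x1 S r / S Slow r
          + R3.U1 p S r / R3.U S r + R3.g1 p S r)) (at r)"
      by (rule R3.d_g1[OF fx r])
    show "S Slow r > 0" "R3.U S r > 0" "S Pot r \<ge> 0"
      using R3.fxD(2)[OF fx r0] R3.U_pos[OF fx r] R3.Pot_nonneg[OF p fx r] by auto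
  qed (use R3.fx_cont[OF fx] R3.fxD(1)[OF fx] R3.U1_cont[OF fx] R3.at_0[OF fx] R3.kk_pos[OF p]
      in \<open>auto simp: R3.U1_def\<close>)
qed

lemma R3_solution:
  assumes p: "p \<in> params" and fx: "R3.fixed p S"
  shows "soliton (S Slow) (\<lambda>r. sqrt (R3.U S r)) (\<lambda>r. - S Pot r)"
    "bc_S1R3 (fst p) (- snd p) (S Slow) (\<lambda>r. sqrt (R3.U S r)) (\<lambda>r. - S Pot r)"
proof -
  note at0 = R3.at_0[OF fx]
  \<comment> \<open>Y vanishes at 0, where the square root is not smooth; extracting the factor r
    leaves the root of a positive function.\<close>
  have eq: "r * sqrt (S Sing r) = sqrt (R3.U S r)" if "r \<ge> 0" for r
    using that by (simp add: R3.U_def real_sqrt_mult)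
  have "ck j (\<lambda>r. r * sqrt (S Sing r))" for j
    by (intro ck_mult ck_ident ck_sqrt R3.fixed_ck[OF fx] R3.fxD(3)[OF fx])
  then have "ck j (\<lambda>r. sqrt (R3.U S r))" for j by (rule ck_cong) (rule eq)
  then show "soliton (S Slow) (\<lambda>r. sqrt (R3.U S r)) (\<lambda>r. - S Pot r)"
    by (intro flow.flow_soliton[OF R3_flow[OF p fx]] ck_imp_smooth ck_uminus R3.fixed_ck[OF fx])
  have da: "D (S Slow) 0 = 0"
    using has_deriv_D[OF R3.d_Slow[OF fx order_refl]] at0 by simp
  have "((\<lambda>r. r * sqrt (S Sing r)) has_real_derivative sqrt (S Sing 0)) (at 0 within {0..})"
    by (intro mult_deriv_0 continuous_intros R3.fxD(1)[OF fx])
  then have "((\<lambda>r. sqrt (R3.U S r)) has_real_derivative sqrt (S Sing 0)) (at 0 within {0..})"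
    by (rule has_field_derivative_transform_within[of _ _ _ _ 1]) (auto simp: eq)
  then have db: "D (\<lambda>r. sqrt (R3.U S r)) 0 = 1"
    using has_deriv_D R3.Sing_0[OF fx] by fastforce
  have df: "((\<lambda>r. - S Pot r) has_real_derivative - R3.g1 p S r) (at r within {0..})"
    if "r \<ge> 0" for r by (rule DERIV_minus[OF R3.d_Pot[OF fx that]])
  have df0: "D (\<lambda>r. - S Pot r) 0 = 0"
    using has_deriv_D[OF df[OF order_refl]] at0 by simp
  have "D (D (\<lambda>r. - S Pot r)) 0 = - snd p"
    by (rule DD_at_0[OF df DERIV_minus[OF R3.g1_deriv_0[OF fx]]])
  then show "bc_S1R3 (fst p) (- snd p) (S Slow) (\<lambda>r. sqrt (R3.U S r)) (\<lambda>r. - S Pot r)"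
    using da db df0 at0(1,2,6) by (simp add: bc_S1R3_def)
qed

lemma R3_unique:
  assumes p: "p \<in> params" and sol: "soliton a b f" and bc: "bc_S1R3 (fst p) (- snd p) a b f" and r: "r \<ge> 0"
  shows "a r = R3.fixp p Slow r \<and> b r = sqrt (R3.U (R3.fixp p) r)"
proof -
  note at = sol_at[OF sol] and eqs = sol_eqs[OF sol] and wi = sol_within[OF sol] and ct = sol_cont[OF sol]
  have i: "a 0 = fst p" "D a 0 = 0" "b 0 = 0" "D b 0 = 1" "f 0 = 0" "D f 0 = 0" "D (D f) 0 = - snd p"
    using bc by (auto simp: bc_S1R3_def)
  have pp: "fst p > 0" using p by (simp add: params_def mem_Times_iff)
  have bq: "((\<lambda>r. b r / r) \<longlongrightarrow> 1) (at 0 within {0..})"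
    using quotient_limit_0[OF wi(1)[of 0 b]] i by simp
  have fq: "((\<lambda>r. D f r / r) \<longlongrightarrow> - snd p) (at 0 within {0..})"
    using quotient_limit_0[OF wi(2)[of 0 f]] i by simp
  have lims: "(a \<longlongrightarrow> fst p) (at 0 within {0..})" "(D a \<longlongrightarrow> 0) (at 0 within {0..})"
    "(D b \<longlongrightarrow> 1) (at 0 within {0..})" "(D f \<longlongrightarrow> 0) (at 0 within {0..})"
    using wi(3,5)[of 0 a] wi(3)[of 0 b] wi(3)[of 0 f] i by auto
  \<comment> \<open>The collapsing factor contributes \<open>2 * (b'/b) * f'\<close>, tending to
    \<open>-2 * snd p\<close>; together with f''(0) this gives
    \<open>-3 * snd p = - kk p\<close>.\<close>
  have "((\<lambda>r. D a r / a r * D f r + 2 * (D b r / (b r / r)) * (D f r / r))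
      \<longlongrightarrow> 0 / fst p * 0 + 2 * (1 / 1) * (- snd p)) (at 0 within {0..})"
    using pp by (intro tendsto_intros lims bq fq) auto
  then have "((\<lambda>r. (D a r / a r + 2 * (D b r / b r)) * D f r)
      \<longlongrightarrow> 0 / fst p * 0 + 2 * (1 / 1) * (- snd p)) (at 0 within {0..})"
    by (rule Lim_transform_eventually) (auto simp: eventually_at_filter algebra_simps)
  then have con: "D (D f) r + (D a r / a r + 2 * (D b r / b r) - D f r) * D f r - 2 * f r = - R3.kk p"
    if "r > 0" for r
    using conservation_value[OF sol i(6,5) _ that] i(7) by (simp add: R3.kk_def)
  define S :: state where "S = (\<lambda>i. case i of Slow \<Rightarrow> a | Pot \<Rightarrow> (\<lambda>r. - f r)
      | Sing \<Rightarrow> (\<lambda>r. if r = 0 then 1 else (b r / r)\<^sup>2))"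
  \<comment> \<open>Half of the regularity at 0: \<open>Y' = 2 b b'\<close> equals
    \<open>r * H r\<close>, and the value 2 is the limit from b'(0) = 1.\<close>
  define H where "H r = (if r = 0 then 2 else 2 * (b r / r) * D b r)" for r
  have US: "R3.U S = (\<lambda>r. (b r)\<^sup>2)"
    using i by (auto simp: R3.U_def S_def power_divide)
  have rH: "r ^ (2 - 1) * H r = 2 * b r * D b r" for r using i by (simp add: H_def)
  have cpos: "continuous_on {0<..} b" "continuous_on {0<..} (D b)"
    using ct[of b] by (auto intro: continuous_on_subset)
  have cS: "continuous_on {0..} (S i)" for i
  proof (cases i)
    case Sing
    have "continuous_on {0<..} (\<lambda>r. (b r / r)\<^sup>2)" by (intro continuous_intros cpos) auto
    moreover have "((\<lambda>r. (b r / r)\<^sup>2) \<longlongrightarrow> 1\<^sup>2) (at 0 within {0..})" by (intro tendsto_intros bq)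
    ultimately have "continuous_on {0..} (\<lambda>r. if r = 0 then 1 else (b r / r)\<^sup>2)"
      by (intro continuous_on_halflineI[where v = "\<lambda>r. (b r / r)\<^sup>2"]) auto
    then show ?thesis using Sing by (simp add: S_def)
  qed (use ct in \<open>auto simp: S_def intro!: continuous_intros\<close>)
  have cH: "continuous_on {0..} H"
  proof -
    have "continuous_on {0<..} (\<lambda>r. 2 * (b r / r) * D b r)" by (intro continuous_intros cpos) auto
    moreover have "((\<lambda>r. 2 * (b r / r) * D b r) \<longlongrightarrow> 2 * 1 * 1) (at 0 within {0..})"
      by (intro tendsto_intros bq lims)
    ultimately show ?thesis
      by (intro continuous_on_halflineI[where v = "\<lambda>r. 2 * (b r / r) * D b r"]) (auto simp: H_def)
  qed
  have "R3.fixed p S"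
  proof (rule R3.fixed_char[where ?X1.0 = "D a" and ?G1.0 = "\<lambda>r. - D f r" and H = H], unfold rH US)
    fix s :: real assume "s \<ge> 0"
    then consider "s = 0" | "s > 0" by fastforce
    then show "S Slow s > 0" "S Sing s > 0"
      using eqs(1,2)[of s] i pp by (cases; auto simp: S_def)+
  next
    fix r :: real assume r: "r > 0"
    note e = eqs[OF r]
    show "(S Slow has_real_derivative D a r) (at r)" "(S Pot has_real_derivative - D f r) (at r)"
      using at[OF r] by (auto simp: S_def intro!: derivative_intros)
    show "((\<lambda>r. (b r)\<^sup>2) has_real_derivative 2 * b r * D b r) (at r)"
      by (rule derivative_eq_intros at(1)[OF r] refl)+ auto
    have "D (D a) r = 1 * (0 + S Slow r) - D a r * (2 * b r * D b r / (b r)\<^sup>2 + - D f r)"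
      unfolding e(4) using e(1,2) by (simp add: S_def field_simps power2_eq_square)
    then show "(D a has_real_derivative 1 * (0 + S Slow r) - D a r * (2 * b r * D b r / (b r)\<^sup>2 + - D f r)) (at r)"
      using at(2)[OF r, of a] by simp
    have "- D (D f) r = R3.kk p + 2 * S Pot r - - D f r * (D a r / S Slow r + 2 * b r * D b r / (b r)\<^sup>2 + - D f r)"
      using con[OF r] e(1,2) by (simp add: S_def field_simps power2_eq_square)
    then show "((\<lambda>r. - D f r) has_real_derivative
        R3.kk p + 2 * S Pot r - - D f r * (D a r / S Slow r + 2 * b r * D b r / (b r)\<^sup>2 + - D f r)) (at r)"
      using DERIV_minus[OF at(2)[OF r, of f]] by simp
    have "((\<lambda>r. 2 * b r * D b r) has_real_derivative 2 * D b r * D b r + D (D b) r * (2 * b r)) (at r)"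
      by (intro DERIV_mult DERIV_cmult at[OF r]) auto
    moreover have "2 * D b r * D b r + D (D b) r * (2 * b r)
        = 2 + real 2 * (b r)\<^sup>2 - 2 * b r * D b r * (D a r / S Slow r + - D f r)"
      unfolding e(5) using e(1,2) by (simp add: S_def field_simps power2_eq_square)
    ultimately show "((\<lambda>r. 2 * b r * D b r) has_real_derivative
        2 + real 2 * (b r)\<^sup>2 - 2 * b r * D b r * (D a r / S Slow r + - D f r)) (at r)" by simp
  qed (use cS cH ct i in \<open>auto simp: S_def intro!: continuous_intros\<close>)
  note u = R3.fixed_unique[OF p this r]
  have "(b r)\<^sup>2 = R3.U (R3.fixp p) r"
    using fun_cong[OF US, of r] u[of Sing] by (simp add: R3.U_def)
  moreover have "b r \<ge> 0" using eqs(2)[of r] i r by (cases "r = 0") auto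
  ultimately have "b r = sqrt (R3.U (R3.fixp p) r)" by (metis real_sqrt_unique)
  then show ?thesis using u[of Slow] by (simp add: S_def)
qed

lemma R3_continuous:
  "slopes bc_S1R3 \<in> params \<rightarrow> {0<..} \<times> {0<..} \<and> continuous_on params (slopes bc_S1R3)"
proof (rule slopes_continuous[OF R3_flow[OF _ R3.fixed_fixp]])
  show "continuous_on params R3.kk" unfolding R3.kk_def[abs_def] by (intro continuous_intros)
qed (use R3.jcont_fixp R3.jcont_solution R3_solution[OF _ R3.fixed_fixp] R3_unique in blast)+

subsection \<open>\<open>S\<^sup>2 \<times> \<real>\<^sup>2\<close>\<close>

text \<open>The roles are exchanged: the source is 2 (1 + Y) for the noncollapsing Y, and a for the
  collapsing function a.\<close>

interpretation R2: singular_ivp 1 1 2 0 1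
  by standard auto

text \<open>The noncollapsing unknown is Y = b^2, whose initial value is the square of the parameter
  b0.\<close>

definition sq :: "real \<times> real \<Rightarrow> real \<times> real" where "sq p = ((fst p)\<^sup>2, snd p)"

lemma sq_params: "p \<in> params \<Longrightarrow> sq p \<in> params"
  by (auto simp: sq_def params_def)

lemma R2_flow:
  assumes p: "p \<in> params" and fx: "R2.fixed p S"
  shows "flow (R2.kk p) (R2.U S) (R2.U1 p S) (S Slow) (R2.x1 S)
    (S Pot) (R2.g1 p S)"
proof -
  show ?thesis
  proof (unfold_locales)
    fix r :: real assume r: "r > 0"
    then have r0: "r \<ge> 0" by simp
    show "(S Slow has_real_derivative R2.x1 S r) (at r)"
      "(R2.U S has_real_derivative R2.U1 p S r) (at r)"
      "(S Pot has_real_derivative R2.g1 p S r) (at r)"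
      by (intro deriv_at_pos[OF _ r] R2.d_Slow[OF fx r0] R2.d_U[OF fx r0] R2.d_Pot[OF fx r0])+
    show "(R2.x1 S has_real_derivative 2 + 2 * S Slow r
        - R2.x1 S r * (R2.U1 p S r / R2.U S r + R2.g1 p S r)) (at r)"
      using R2.d_x1[OF fx r] by (simp add: distrib_left)
    show "(R2.U1 p S has_real_derivative R2.U S r
        - R2.U1 p S r * (R2.x1 S r / S Slow r + R2.g1 p S r)) (at r)"
      using R2.d_U1[OF fx r] by simp
    show "(R2.g1 p S has_real_derivative R2.kk p + 2 * S Pot r
        - R2.g1 p S r * (R2.U1 p S r / R2.U S r
          + R2.x1 S r / S Slow r + R2.g1 p S r)) (at r)"
      using R2.d_g1[OF fx r] by (simp add: add.commute)
    show "S Slow r > 0" "R2.U S r > 0" "S Pot r \<ge> 0"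
      using R2.fxD(2)[OF fx r0] R2.U_pos[OF fx r] R2.Pot_nonneg[OF p fx r] by auto
  qed (use R2.fx_cont[OF fx] R2.fxD(1)[OF fx] R2.fxD(2)[OF fx, of 0] R2.U1_cont[OF fx] R2.at_0[OF fx]
      R2.U1_0[OF fx refl] R2.kk_pos[OF p] in auto)
qed

lemma R2_solution:
  assumes p: "p \<in> params" and fx: "R2.fixed (sq p) S"
  shows "soliton (R2.U S) (\<lambda>r. sqrt (S Slow r)) (\<lambda>r. - S Pot r)"
    "bc_S2R2 (fst p) (- snd p) (R2.U S) (\<lambda>r. sqrt (S Slow r)) (\<lambda>r. - S Pot r)"
proof -
  note at0 = R2.at_0[OF fx]
  show "soliton (R2.U S) (\<lambda>r. sqrt (S Slow r)) (\<lambda>r. - S Pot r)"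
    by (intro flow.flow_soliton[OF R2_flow[OF sq_params[OF p] fx]] ck_imp_smooth ck_uminus ck_sqrt R2.U_ck[OF fx]
        R2.fixed_ck[OF fx] R2.fxD(2)[OF fx])
  have da: "D (R2.U S) 0 = 1"
    using has_deriv_D[OF R2.d_U[OF fx order_refl]] R2.U1_0[OF fx refl] by simp
  have f: "fst (sq p) > 0" "sqrt (fst (sq p)) = fst p" using p by (auto simp: sq_def params_def)
  have "((\<lambda>r. sqrt (S Slow r)) has_real_derivative
      inverse (sqrt (S Slow 0)) / 2 * R2.x1 S 0) (at 0 within {0..})"
    using f at0 by (intro DERIV_chain'[OF R2.d_Slow[OF fx order_refl] DERIV_real_sqrt]) auto
  then have db: "D (\<lambda>r. sqrt (S Slow r)) 0 = 0"
    using has_deriv_D at0 by fastforce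
  have df: "((\<lambda>r. - S Pot r) has_real_derivative - R2.g1 (sq p) S r) (at r within {0..})"
    if "r \<ge> 0" for r by (rule DERIV_minus[OF R2.d_Pot[OF fx that]])
  have df0: "D (\<lambda>r. - S Pot r) 0 = 0"
    using has_deriv_D[OF df[OF order_refl]] at0 by simp
  have snd_sq: "snd (sq p) = snd p" by (simp add: sq_def)
  have "D (D (\<lambda>r. - S Pot r)) 0 = - snd p"
    by (rule DD_at_0[OF df DERIV_minus[OF R2.g1_deriv_0[OF fx, unfolded snd_sq]]])
  then show "bc_S2R2 (fst p) (- snd p) (R2.U S) (\<lambda>r. sqrt (S Slow r)) (\<lambda>r. - S Pot r)"
    using da db df0 at0(1,2,6) f by (simp add: bc_S2R2_def)
qed

lemma R2_unique:
  assumes p: "p \<in> params" and sol: "soliton a b f" and bc: "bc_S2R2 (fst p) (- snd p) a b f" and r: "r \<ge> 0"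
  shows "a r = R2.U (R2.fixp (sq p)) r \<and> b r = sqrt (R2.fixp (sq p) Slow r)"
proof -
  note at = sol_at[OF sol] and eqs = sol_eqs[OF sol] and wi = sol_within[OF sol] and ct = sol_cont[OF sol]
  have i: "a 0 = 0" "D a 0 = 1" "b 0 = fst p" "D b 0 = 0" "f 0 = 0" "D f 0 = 0" "D (D f) 0 = - snd p"
    using bc by (auto simp: bc_S2R2_def)
  have pp: "fst p > 0" using p by (simp add: params_def mem_Times_iff)
  have aq: "((\<lambda>r. a r / r) \<longlongrightarrow> 1) (at 0 within {0..})"
    using quotient_limit_0[OF wi(1)[of 0 a]] i by simp
  have fq: "((\<lambda>r. D f r / r) \<longlongrightarrow> - snd p) (at 0 within {0..})"
    using quotient_limit_0[OF wi(2)[of 0 f]] i by simp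
  have lims: "(b \<longlongrightarrow> fst p) (at 0 within {0..})" "(D a \<longlongrightarrow> 1) (at 0 within {0..})"
    "(D b \<longlongrightarrow> 0) (at 0 within {0..})" "(D f \<longlongrightarrow> 0) (at 0 within {0..})"
    using wi(3)[of 0 a] wi(3,5)[of 0 b] wi(3)[of 0 f] i by auto
  \<comment> \<open>Here \<open>(a'/a) * f'\<close> tends to \<open>- snd p\<close>, and adding
    f''(0) gives \<open>-2 * snd p\<close>, which is \<open>- kk\<close> for n = 1.\<close>
  have "((\<lambda>r. D a r / (a r / r) * (D f r / r) + 2 * (D b r / b r) * D f r)
      \<longlongrightarrow> 1 / 1 * (- snd p) + 2 * (0 / fst p) * 0) (at 0 within {0..})"
    using pp by (intro tendsto_intros lims aq fq) auto
  then have "((\<lambda>r. (D a r / a r + 2 * (D b r / b r)) * D f r)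
      \<longlongrightarrow> 1 / 1 * (- snd p) + 2 * (0 / fst p) * 0) (at 0 within {0..})"
    by (rule Lim_transform_eventually) (auto simp: eventually_at_filter algebra_simps)
  note lim = this
  have con: "D (D f) r + (D a r / a r + 2 * (D b r / b r) - D f r) * D f r - 2 * f r = - R2.kk (sq p)"
    if "r > 0" for r
    unfolding conservation_value[OF sol i(6,5) lim that] R2.kk_def sq_def using i(7) by simp
  define S :: state where "S = (\<lambda>i. case i of Slow \<Rightarrow> (\<lambda>r. (b r)\<^sup>2) | Pot \<Rightarrow> (\<lambda>r. - f r)
      | Sing \<Rightarrow> (\<lambda>r. if r = 0 then 1 else a r / r))"
  have US: "R2.U S = a" unfolding R2.U_def[abs_def] S_def using i by auto
  have rH: "r ^ (1 - 1) * D a r = D a r" for r by simp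
  have cS: "continuous_on {0..} (S i)" for i
  proof (cases i)
    case Sing
    have "continuous_on {0<..} (\<lambda>r. a r / r)"
      using ct[of a] by (intro continuous_intros) (auto intro: continuous_on_subset)
    then have "continuous_on {0..} (\<lambda>r. if r = 0 then 1 else a r / r)"
      using aq by (intro continuous_on_halflineI[where v = "\<lambda>r. a r / r"]) auto
    then show ?thesis using Sing by (simp add: S_def)
  qed (use ct in \<open>auto simp: S_def intro!: continuous_intros\<close>)
  have "R2.fixed (sq p) S"
  proof (rule R2.fixed_char[where ?X1.0 = "\<lambda>r. 2 * b r * D b r" and ?G1.0 = "\<lambda>r. - D f r" and H = "D a"], unfold rH US)
    fix s :: real assume "s \<ge> 0"
    then consider "s = 0" | "s > 0" by fastforce
    then show "S Slow s > 0" "S Sing s > 0"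
      using eqs(1,2)[of s] i pp by (cases; auto simp: S_def)+
  next
    fix r :: real assume r: "r > 0"
    note e = eqs[OF r]
    show "(a has_real_derivative D a r) (at r)" "(S Pot has_real_derivative - D f r) (at r)"
      using at[OF r] by (auto simp: S_def intro!: derivative_intros)
    have "((\<lambda>r. (b r)\<^sup>2) has_real_derivative 2 * b r * D b r) (at r)"
      by (rule derivative_eq_intros at(1)[OF r] refl)+ auto
    then show "(S Slow has_real_derivative 2 * b r * D b r) (at r)" by (simp add: S_def)
    have "D (D a) r = 0 + real 1 * a r - D a r * (2 * b r * D b r / S Slow r + - D f r)"
      unfolding e(4) using e(1,2) by (simp add: S_def field_simps power2_eq_square)
    then show "(D a has_real_derivative 0 + real 1 * a r - D a r * (2 * b r * D b r / S Slow r + - D f r)) (at r)"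
      using at(2)[OF r, of a] by simp
    have "- D (D f) r = R2.kk (sq p) + 2 * S Pot r - - D f r * (2 * b r * D b r / S Slow r + D a r / a r + - D f r)"
      using con[OF r] e(1,2) by (simp add: S_def field_simps power2_eq_square)
    then show "((\<lambda>r. - D f r) has_real_derivative
        R2.kk (sq p) + 2 * S Pot r - - D f r * (2 * b r * D b r / S Slow r + D a r / a r + - D f r)) (at r)"
      using DERIV_minus[OF at(2)[OF r, of f]] by simp
    have "((\<lambda>r. 2 * b r * D b r) has_real_derivative 2 * D b r * D b r + D (D b) r * (2 * b r)) (at r)"
      by (intro DERIV_mult DERIV_cmult at[OF r]) auto
    moreover have "2 * D b r * D b r + D (D b) r * (2 * b r)
        = 2 * (1 + S Slow r) - 2 * b r * D b r * (D a r / a r + - D f r)"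
      unfolding e(5) using e(1,2) by (simp add: S_def field_simps power2_eq_square)
    ultimately show "((\<lambda>r. 2 * b r * D b r) has_real_derivative
        2 * (1 + S Slow r) - 2 * b r * D b r * (D a r / a r + - D f r)) (at r)" by simp
  qed (use cS ct i in \<open>auto simp: S_def sq_def intro!: continuous_intros\<close>)
  note u = R2.fixed_unique[OF sq_params[OF p] this r]
  have "R2.U S r = R2.U (R2.fixp (sq p)) r" unfolding R2.U_def using u[of Sing] by simp
  then have "a r = R2.U (R2.fixp (sq p)) r" unfolding US .
  moreover have "b r \<ge> 0" using eqs(2)[of r] i r pp by (cases "r = 0") auto
  moreover have "(b r)\<^sup>2 = R2.fixp (sq p) Slow r" using u[of Slow] by (simp add: S_def)
  ultimately show ?thesis by (metis real_sqrt_unique)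
qed

lemma R2_continuous:
  "slopes bc_S2R2 \<in> params \<rightarrow> {0<..} \<times> {0<..} \<and> continuous_on params (slopes bc_S2R2)"
proof (rule slopes_continuous[OF R2_flow[OF sq_params R2.fixed_fixp[OF sq_params]]])
  have sq: "continuous_on params sq" "sq ` params \<subseteq> params"
    unfolding sq_def[abs_def] using sq_params by (auto intro!: continuous_intros simp: sq_def)
  note J = jcont_reparam[OF _ sq]
  show "jcont params (\<lambda>p. R2.U (R2.fixp (sq p)))" "jcont params (\<lambda>p. R2.U1 (sq p) (R2.fixp (sq p)))"
    "jcont params (\<lambda>p. R2.fixp (sq p) Slow)" "jcont params (\<lambda>p. R2.x1 (R2.fixp (sq p)))"
    "jcont params (\<lambda>p. R2.fixp (sq p) Pot)" "jcont params (\<lambda>p. R2.g1 (sq p) (R2.fixp (sq p)))"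
    using J[OF R2.jcont_solution(1)] J[OF R2.jcont_solution(2)] J[OF R2.jcont_solution(3)]
      J[OF R2.jcont_solution(4)] J[OF R2.jcont_fixp[of Slow]] J[OF R2.jcont_fixp[of Pot]] by auto
  show "continuous_on params (\<lambda>p. R2.kk (sq p))" unfolding R2.kk_def sq_def by (intro continuous_intros)
qed (use R2_solution[OF _ R2.fixed_fixp[OF sq_params]] R2_unique in blast)+

theorem theorem7p10:
  shows "(F_S1R3 \<in> {0<..} \<times> {0<..} \<rightarrow> {0<..} \<times> {0<..} \<and> continuous_on ({0<..} \<times> {0<..}) F_S1R3) \<and>
         (F_S2R2 \<in> {0<..} \<times> {0<..} \<rightarrow> {0<..} \<times> {0<..} \<and> continuous_on ({0<..} \<times> {0<..}) F_S2R2)"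
  using R3_continuous R2_continuous unfolding F_S1R3_def F_S2R2_def params_def by blast

end
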